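(* Let $n\ge1$ be an integer, $p>2$, $\theta>0$ and $l=p/(p-1)$, and let $$\Theta_{l,\theta}=\{(x,t)\in\mathbf{R}^{n}\times\mathbf{R}: 0<-t<\theta|x|^l<\theta\},\qquad M_\theta:=\frac{p-2}{p}\biggl(\frac{1}{np\theta}\biggr)^{1/(p-2)}.$$ If $f:\partial\Theta_{l,\theta}\to\mathbf{R}$ satisfies $$|f(x,t)-f(0,0)|\le M_\theta|x|^{p/(p-1)}\quad\text{for all }(x,t)\in\partial\Theta_{l,\theta},$$ then $$\lim_{\Theta_{l,\theta}\ni\xi\to(0,0)}\underline{H}_{\Theta_{l,\theta}}f(\xi)=\lim_{\Theta_{l,\theta}\ni\xi\to(0,0)}\overline{H}_{\Theta_{l,\theta}}f(\xi)=f(0,0).$$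
   Context: Let $n\ge1$ be an integer, $1<p<\infty$, and let $\Theta\subset\mathbf{R}^{n+1}$ be a nonempty bounded open set, with points written $(x,t)$, $x\in\mathbf{R}^n$, $t\in\mathbf{R}$. $\nabla$ and $\operatorname{div}$ are taken with respect to $x$ only, and $\partial\Theta$ is the full topological boundary. The $p$-parabolic equation is $\partial_t u-\Delta_p u=0$, where $\Delta_p u=\operatorname{div}(|\nabla u|^{p-2}\nabla u)$. Solutions: $u:\Theta\to[-\infty,\infty]$ is a (weak) solution if for every open cylinder $U_{t_1,t_2}=U\times(t_1,t_2)\Subset\Theta$ we have $u\in C([t_1,t_2];L^2(U))\cap L^p(t_1,t_2;W^{1,p}(U))$ and $$\int_{t_1}^{t_2}\int_U|\nabla u|^{p-2}\nabla u\cdot\nabla\varphi\,dx\,dt-\int_{t_1}^{t_2}\int_U u\,\frac{\partial\varphi}{\partial t}\,dx\,dt=0\quad\text{for all }\varphi\in C_0^\infty(U_{t_1,t_2}).$$ A $p$-parabolic function is a continuous solution. Superparabolic functions: $u:\Theta\to(-\infty,\infty]$ is $p$-superparabolic if (i) $u$ is lower semicontinuous; (ii) $u$ is finite in a dense subset of $\Theta$; (iii) for every space-time box $Q_{t_1,t_2}=Q\times(t_1,t_2)\Subset\Theta$, $Q=(a_1,b_1)\times\dots\times(a_n,b_n)$, and every $h$ that is $p$-parabolic in $Q_{t_1,t_2}$, continuous on $\overline{Q_{t_1,t_2}}$ and satisfies $h\le u$ on the parabolic boundary $(\overline{Q}\times\{t_1\})\cup(\partial Q\times(t_1,t_2])$,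 we have $h\le u$ in $Q_{t_1,t_2}$. A function $v:\Theta\to[-\infty,\infty)$ is $p$-subparabolic if $-v$ is $p$-superparabolic. Perron solutions: for bounded $f:\partial\Theta\to\mathbf{R}$, let $\mathcal{U}_f$ be the set of $p$-superparabolic $u$ on $\Theta$ with $\liminf_{\Theta\ni\eta\to\xi}u(\eta)\ge f(\xi)$ for all $\xi\in\partial\Theta$, and $\mathcal{L}_f$ the set of $p$-subparabolic $u$ on $\Theta$ with $\limsup_{\Theta\ni\eta\to\xi}u(\eta)\le f(\xi)$ for all $\xi\in\partial\Theta$. For $\xi\in\Theta$ set $\overline{H}_\Theta f(\xi)=\inf_{u\in\mathcal{U}_f}u(\xi)$ (upper Perron solution) and $\underline{H}_\Theta f(\xi)=\sup_{u\in\mathcal{L}_f}u(\xi)$ (lower Perron solution). *)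

theory Defs
  imports "HOL-Analysis.Analysis"
begin

text \<open>Points of space-time are pairs \<open>(x, t)\<close> of type \<open>'a \<times> real\<close>; the space \<open>'a\<close> is
  \<open>real ^ 'n\<close> in the application. Functions on a set are total functions of which only the values
  on that set are used.\<close>

definition compactly_in :: "'a::topological_space set \<Rightarrow> 'a set \<Rightarrow> bool" where
  "compactly_in A B \<longleftrightarrow> compact (closure A) \<and> closure A \<subseteq> B"

primrec C_k :: "nat \<Rightarrow> ('a::euclidean_space \<Rightarrow> real) \<Rightarrow> bool" where
  "C_k 0 f \<longleftrightarrow> continuous_on UNIV f"
| "C_k (Suc k) f \<longleftrightarrow> (\<forall>x. f differentiable (at x)) \<and>
     (\<forall>b\<in>Basis. C_k k (\<lambda>x. frechet_derivative f (at x) b))"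

text \<open>A function in \<open>C\<^sub>0\<^sup>\<infinity>(U)\<close>, extended by zero to the whole space.\<close>

definition test_function :: "'a::euclidean_space set \<Rightarrow> ('a \<Rightarrow> real) \<Rightarrow> bool" where
  "test_function U \<phi> \<longleftrightarrow> (\<forall>k. C_k k \<phi>) \<and> compactly_in {x. \<phi> x \<noteq> 0} U"

definition grad :: "('a::euclidean_space \<Rightarrow> real) \<Rightarrow> 'a \<Rightarrow> 'a" where
  "grad f x = (\<Sum>b\<in>Basis. frechet_derivative f (at x) b *\<^sub>R b)"

definition grad_x :: "('a::euclidean_space \<times> real \<Rightarrow> real) \<Rightarrow> 'a \<times> real \<Rightarrow> 'a" where
  "grad_x \<phi> z = grad (\<lambda>x. \<phi> (x, snd z)) (fst z)"

definition deriv_t :: "('a::euclidean_space \<times> real \<Rightarrow> real) \<Rightarrow> 'a \<times> real \<Rightarrow> real" where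
  "deriv_t \<phi> z = deriv (\<lambda>t. \<phi> (fst z, t)) (snd z)"

definition in_Lp :: "real \<Rightarrow> 'a::euclidean_space set \<Rightarrow> ('a \<Rightarrow> 'b::euclidean_space) \<Rightarrow> bool" where
  "in_Lp q A f \<longleftrightarrow> f \<in> borel_measurable (lebesgue_on A) \<and>
     integrable (lebesgue_on A) (\<lambda>x. norm (f x) powr q)"

text \<open>Extended-real-valued elements of a Lebesgue space are finite almost everywhere, and
  \<open>real_of_ereal\<close> then changes them on a null set only.\<close>

definition in_Lp_ereal :: "real \<Rightarrow> 'a::euclidean_space set \<Rightarrow> ('a \<Rightarrow> ereal) \<Rightarrow> bool" where
  "in_Lp_ereal q A u \<longleftrightarrow> (AE x in lebesgue_on A. \<bar>u x\<bar> \<noteq> \<infinity>) \<and> in_Lp q A (\<lambda>x. real_of_ereal (u x))"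

text \<open>\<open>v\<close> belongs to \<open>W\<^sup>1\<^sup>,\<^sup>p(U)\<close> with weak (distributional) gradient \<open>G\<close>.\<close>

definition sobolev_with_grad ::
  "real \<Rightarrow> 'a::euclidean_space set \<Rightarrow> ('a \<Rightarrow> real) \<Rightarrow> ('a \<Rightarrow> 'a) \<Rightarrow> bool" where
  "sobolev_with_grad p U v G \<longleftrightarrow> in_Lp p U v \<and> in_Lp p U G \<and>
     (\<forall>\<phi>. test_function U \<phi> \<longrightarrow>
        (LINT x|lebesgue_on U. v x *\<^sub>R grad \<phi> x) = - (LINT x|lebesgue_on U. \<phi> x *\<^sub>R G x))"

text \<open>\<open>u\<close> belongs to \<open>L\<^sup>p(t\<^sub>1, t\<^sub>2; W\<^sup>1\<^sup>,\<^sup>p(U))\<close> with spatial weak gradient \<open>G\<close>: almost every time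
  slice lies in \<open>W\<^sup>1\<^sup>,\<^sup>p(U)\<close>, and \<open>|u|\<^sup>p + |G|\<^sup>p\<close> is integrable over the cylinder.\<close>

definition parabolic_sobolev_with_grad ::
  "real \<Rightarrow> 'a::euclidean_space set \<Rightarrow> real \<Rightarrow> real \<Rightarrow>
   ('a \<times> real \<Rightarrow> ereal) \<Rightarrow> ('a \<times> real \<Rightarrow> 'a) \<Rightarrow> bool" where
  "parabolic_sobolev_with_grad p U t1 t2 u G \<longleftrightarrow>
     in_Lp_ereal p (U \<times> {t1<..<t2}) u \<and> in_Lp p (U \<times> {t1<..<t2}) G \<and>
     (AE t in lebesgue_on {t1<..<t2}.
        sobolev_with_grad p U (\<lambda>x. real_of_ereal (u (x, t))) (\<lambda>x. G (x, t)))"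

text \<open>\<open>u \<in> C([t\<^sub>1, t\<^sub>2]; L\<^sup>2(U))\<close>.\<close>

definition continuous_in_L2 ::
  "'a::euclidean_space set \<Rightarrow> real \<Rightarrow> real \<Rightarrow> ('a \<times> real \<Rightarrow> ereal) \<Rightarrow> bool" where
  "continuous_in_L2 U t1 t2 u \<longleftrightarrow>
     (\<forall>t\<in>{t1..t2}. in_Lp_ereal 2 U (\<lambda>x. u (x, t))) \<and>
     (\<forall>s\<in>{t1..t2}.
        ((\<lambda>t. LINT x|lebesgue_on U. (real_of_ereal (u (x, t)) - real_of_ereal (u (x, s)))\<^sup>2)
           \<longlongrightarrow> 0) (at s within {t1..t2}))"

text \<open>Where \<open>G z = 0\<close> the flux \<open>|G|\<^bsup>p-2\<^esup>G\<close> is \<open>0\<close>, also for \<open>p \<le> 2\<close>.\<close>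

definition weak_solution ::
  "real \<Rightarrow> ('a::euclidean_space \<times> real) set \<Rightarrow> ('a \<times> real \<Rightarrow> ereal) \<Rightarrow> bool" where
  "weak_solution p \<Theta> u \<longleftrightarrow>
     (\<forall>U t1 t2. open U \<and> t1 < t2 \<and> compactly_in (U \<times> {t1<..<t2}) \<Theta> \<longrightarrow>
        continuous_in_L2 U t1 t2 u \<and>
        (\<exists>G. parabolic_sobolev_with_grad p U t1 t2 u G \<and>
           (\<forall>\<phi>. test_function (U \<times> {t1<..<t2}) \<phi> \<longrightarrow>
              (LINT z|lebesgue_on (U \<times> {t1<..<t2}).
                 (norm (G z) powr (p - 2) *\<^sub>R G z) \<bullet> grad_x \<phi> z)
            - (LINT z|lebesgue_on (U \<times> {t1<..<t2}). real_of_ereal (u z) * deriv_t \<phi> z) = 0)))"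

text \<open>Continuous solutions; continuity is understood for real-valued functions.\<close>

definition p_parabolic ::
  "real \<Rightarrow> ('a::euclidean_space \<times> real) set \<Rightarrow> ('a \<times> real \<Rightarrow> real) \<Rightarrow> bool" where
  "p_parabolic p \<Theta> h \<longleftrightarrow> weak_solution p \<Theta> (\<lambda>z. ereal (h z)) \<and> continuous_on \<Theta> h"

definition parabolic_boundary ::
  "'a::euclidean_space set \<Rightarrow> real \<Rightarrow> real \<Rightarrow> ('a \<times> real) set" where
  "parabolic_boundary Q t1 t2 = closure Q \<times> {t1} \<union> frontier Q \<times> {t1<..t2}"

definition p_superparabolic ::
  "real \<Rightarrow> ('a::euclidean_space \<times> real) set \<Rightarrow> ('a \<times> real \<Rightarrow> ereal) \<Rightarrow> bool" where
  "p_superparabolic p \<Theta> u \<longleftrightarrow>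
     (\<forall>z\<in>\<Theta>. u z \<noteq> -\<infinity>) \<and>
     (\<forall>c. openin (top_of_set \<Theta>) {z \<in> \<Theta>. c < u z}) \<and>
     \<Theta> \<subseteq> closure {z \<in> \<Theta>. \<bar>u z\<bar> \<noteq> \<infinity>} \<and>
     (\<forall>a b t1 t2 h.
        (\<forall>i\<in>Basis. a \<bullet> i < b \<bullet> i) \<and> t1 < t2 \<and> compactly_in (box a b \<times> {t1<..<t2}) \<Theta> \<and>
        p_parabolic p (box a b \<times> {t1<..<t2}) h \<and>
        continuous_on (closure (box a b \<times> {t1<..<t2})) h \<and>
        (\<forall>z\<in>parabolic_boundary (box a b) t1 t2. ereal (h z) \<le> u z) \<longrightarrow>
        (\<forall>z\<in>box a b \<times> {t1<..<t2}. ereal (h z) \<le> u z))"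

definition p_subparabolic ::
  "real \<Rightarrow> ('a::euclidean_space \<times> real) set \<Rightarrow> ('a \<times> real \<Rightarrow> ereal) \<Rightarrow> bool" where
  "p_subparabolic p \<Theta> v \<longleftrightarrow> p_superparabolic p \<Theta> (\<lambda>z. - v z)"

definition upper_class ::
  "real \<Rightarrow> ('a::euclidean_space \<times> real) set \<Rightarrow> ('a \<times> real \<Rightarrow> real) \<Rightarrow> ('a \<times> real \<Rightarrow> ereal) set" where
  "upper_class p \<Theta> f = {u. p_superparabolic p \<Theta> u \<and>
     (\<forall>\<xi>\<in>frontier \<Theta>. ereal (f \<xi>) \<le> Liminf (at \<xi> within \<Theta>) u)}"

definition lower_class ::
  "real \<Rightarrow> ('a::euclidean_space \<times> real) set \<Rightarrow> ('a \<times> real \<Rightarrow> real) \<Rightarrow> ('a \<times> real \<Rightarrow> ereal) set" where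
  "lower_class p \<Theta> f = {u. p_subparabolic p \<Theta> u \<and>
     (\<forall>\<xi>\<in>frontier \<Theta>. Limsup (at \<xi> within \<Theta>) u \<le> ereal (f \<xi>))}"

definition upper_perron ::
  "real \<Rightarrow> ('a::euclidean_space \<times> real) set \<Rightarrow> ('a \<times> real \<Rightarrow> real) \<Rightarrow> 'a \<times> real \<Rightarrow> ereal" where
  "upper_perron p \<Theta> f \<xi> = (INF u\<in>upper_class p \<Theta> f. u \<xi>)"

definition lower_perron ::
  "real \<Rightarrow> ('a::euclidean_space \<times> real) set \<Rightarrow> ('a \<times> real \<Rightarrow> real) \<Rightarrow> 'a \<times> real \<Rightarrow> ereal" where
  "lower_perron p \<Theta> f \<xi> = (SUP u\<in>lower_class p \<Theta> f. u \<xi>)"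

definition Theta_dom :: "real \<Rightarrow> real \<Rightarrow> ((real ^ 'n) \<times> real) set" where
  "Theta_dom l \<theta> = {(x, t). 0 < - t \<and> - t < \<theta> * norm x powr l \<and> \<theta> * norm x powr l < \<theta>}"

definition M_const :: "nat \<Rightarrow> real \<Rightarrow> real \<Rightarrow> real" where
  "M_const n p \<theta> = (p - 2) / p * (1 / (real n * p * \<theta>)) powr (1 / (p - 2))"

end

theory Submission
  imports Defs "HOL-Computational_Algebra.Polynomial"
begin

text \<open>The barrier is \<open>w = a \<bar>x\<bar>\<^sup>l + b t\<close> with \<open>l = p / (p - 1)\<close> and
  \<open>b = n (a l) powr (p - 1)\<close>: its flux \<open>\<bar>\<nabla>w\<bar> powr (p - 2) \<nabla>w\<close> is the linear field
  \<open>(a l) powr (p - 1) x\<close>, so \<open>w\<close> and \<open>- w\<close> solve the equation. On the closure of the domain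
  \<open>w \<ge> (a - b \<theta>) \<bar>x\<bar>\<^sup>l\<close>, and \<open>M\<close> is the maximum of \<open>a - b \<theta>\<close> over \<open>a\<close>. Hence
  \<open>f (0, 0) + w\<close> belongs to the upper class and every member of the upper class lies above
  \<open>f (0, 0) - w\<close>; the lower class is treated by changing signs.

  For the first claim \<open>w\<close> is compared with an arbitrary weak solution: the equation for the difference
  is mollified and multiplied by the square of the positive part, and the flux is monotone. For the
  second claim a superparabolic function is compared with \<open>- w\<close> on a domain which is not a box; at a
  point where \<open>- w\<close>, made slightly strict, touches it from below, another explicit solution on a small box
  gives a contradiction.\<close>

section \<open>Smooth bump functions\<close>

text \<open>A weak solution need not have a time derivative that is a function, so its positive part
  is not an admissible multiplier. Mollifying in space and time at once turns the weak identities
  into pointwise ones, but the mollified flux is not the flux of the mollified gradient: the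
  monotone term has a sign only in the limit. Fatou's lemma is therefore applied after adding a
  majorant, obtained from the inequalities of Young and Jensen, whose integral does not change under
  mollification. The function compared with a solution carries an additional term
  \<open>\<delta> * exp (m * (t - t0))\<close>. It makes the supersolution strict, so that a
  vanishing energy directly forces the positive part to vanish. For large \<open>m\<close> it also
  lifts the function above the solution at the final time, where no boundary inequality is given;
  the set where the inequality fails is then compactly contained in the open cylinder. The integrals
  of the definitions run over \<open>lebesgue_on\<close>, while translations and Fubini are used
  over \<open>lborel\<close>; Borel versions extended by zero mediate between the two.\<close>

lemma C_k_SucD: "C_k (Suc k) f \<Longrightarrow> C_k k f"
proof (induction k arbitrary: f)
  case 0
  then show ?case
    by (auto intro!: continuous_at_imp_continuous_on differentiable_imp_continuous_within)
next
  case (Suc k)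
  then show ?case by (metis C_k.simps(2))
qed

lemma C_k_continuous: "C_k k f \<Longrightarrow> continuous_on UNIV f"
  by (induction k) (auto dest: C_k_SucD simp del: C_k.simps(2))

text \<open>\<open>C_k\<close> is phrased with \<open>frechet_derivative\<close>. This rule and its
  converse below admit any witness of the derivative, so that the closure properties reduce to the
  usual differentiation rules.\<close>

lemma C_k_SucI:
  assumes "\<And>x. (f has_derivative f' x) (at x)" "\<And>b. b \<in> Basis \<Longrightarrow> C_k k (\<lambda>x. f' x b)"
  shows "C_k (Suc k) f"
proof -
  have "frechet_derivative f (at x) = f' x" for x
    using assms(1) frechet_derivative_at by metis
  then show ?thesis using assms by (auto simp: differentiable_def)
qed

lemma C_k_SucE:
  assumes "C_k (Suc k) f"
  obtains f' where "\<And>x. (f has_derivative f' x) (at x)" "\<And>b. b \<in> Basis \<Longrightarrow> C_k k (\<lambda>x. f' x b)"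
  using assms frechet_derivative_works[of f] by (auto intro: that[of "\<lambda>x. frechet_derivative f (at x)"])

lemma C_k_const: "C_k k (\<lambda>x. c)"
  by (induction k arbitrary: c) (auto intro!: C_k_SucI[where f' = "\<lambda>x v. 0"] simp del: C_k.simps(2))

lemma C_k_add: "C_k k f \<Longrightarrow> C_k k g \<Longrightarrow> C_k k (\<lambda>x. f x + g x)"
proof (induction k arbitrary: f g)
  case 0
  then show ?case by (auto intro: continuous_intros)
next
  case (Suc k)
  obtain f' where f: "\<And>x. (f has_derivative f' x) (at x)" "\<And>b. b \<in> Basis \<Longrightarrow> C_k k (\<lambda>x. f' x b)"
    using C_k_SucE[OF Suc.prems(1)] by blast
  obtain g' where g: "\<And>x. (g has_derivative g' x) (at x)" "\<And>b. b \<in> Basis \<Longrightarrow> C_k k (\<lambda>x. g' x b)"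
    using C_k_SucE[OF Suc.prems(2)] by blast
  show ?case
    by (rule C_k_SucI[where f' = "\<lambda>x v. f' x v + g' x v"]) (auto intro!: has_derivative_add f g Suc.IH)
qed

lemma C_k_sum: "(\<And>i. i \<in> I \<Longrightarrow> C_k k (f i)) \<Longrightarrow> C_k k (\<lambda>x. \<Sum>i\<in>I. f i x)"
  by (induction I rule: infinite_finite_induct) (auto intro: C_k_const C_k_add)

lemma C_k_mult: "C_k k f \<Longrightarrow> C_k k g \<Longrightarrow> C_k k (\<lambda>x. f x * g x)"
proof (induction k arbitrary: f g)
  case 0
  then show ?case by (auto intro: continuous_intros)
next
  case (Suc k)
  obtain f' where f: "\<And>x. (f has_derivative f' x) (at x)" "\<And>b. b \<in> Basis \<Longrightarrow> C_k k (\<lambda>x. f' x b)"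
    using C_k_SucE[OF Suc.prems(1)] by blast
  obtain g' where g: "\<And>x. (g has_derivative g' x) (at x)" "\<And>b. b \<in> Basis \<Longrightarrow> C_k k (\<lambda>x. g' x b)"
    using C_k_SucE[OF Suc.prems(2)] by blast
  show ?case
    by (rule C_k_SucI[where f' = "\<lambda>x v. f x * g' x v + f' x v * g x"])
      (auto intro!: has_derivative_mult f g Suc.IH C_k_add C_k_SucD[OF Suc.prems(1)] C_k_SucD[OF Suc.prems(2)]
        simp del: C_k.simps)
qed

lemma C_k_linear:
  assumes "bounded_linear f"
  shows "C_k k f"
proof (cases k)
  case 0
  then show ?thesis using assms by (simp add: linear_continuous_on)
next
  case (Suc m)
  show ?thesis
    unfolding Suc
    by (rule C_k_SucI[where f' = "\<lambda>x. f"]) (rule bounded_linear_imp_has_derivative[OF assms] C_k_const)+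
qed

lemma C_k_affine:
  fixes L :: "'a::euclidean_space \<Rightarrow> 'b::euclidean_space"
  assumes "C_k k f" "bounded_linear L"
  shows "C_k k (\<lambda>x. f (c + L x))"
  using assms(1)
proof (induction k arbitrary: f)
  case 0
  have L: "continuous_on UNIV (\<lambda>x. c + L x)"
    by (intro continuous_on_add continuous_on_const linear_continuous_on assms(2))
  have f: "continuous_on UNIV f"
    using 0 by simp
  show ?case
    unfolding C_k.simps by (rule continuous_on_compose2[OF f L subset_UNIV])
next
  case (Suc k)
  obtain f' where f: "\<And>x. (f has_derivative f' x) (at x)" "\<And>b. b \<in> Basis \<Longrightarrow> C_k k (\<lambda>x. f' x b)"
    using C_k_SucE[OF Suc.prems(1)] by blast
  have L: "((\<lambda>x. c + L x) has_derivative L) (at x)" for x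
    using has_derivative_add[OF has_derivative_const bounded_linear_imp_has_derivative[OF assms(2)], of c "at x"] by simp
  show ?case
  proof (rule C_k_SucI[where f' = "\<lambda>x v. f' (c + L x) (L v)"])
    show "((\<lambda>x. f (c + L x)) has_derivative (\<lambda>v. f' (c + L x) (L v))) (at x)" for x
      by (rule has_derivative_compose[OF L f(1)])
    fix b :: 'a assume "b \<in> Basis"
    \<comment> \<open>\<open>C_k\<close> controls derivatives along basis vectors only, and
      \<open>L b\<close> need not be one; expanding it in the basis reduces to those.\<close>
    have "f' z v = (\<Sum>e\<in>Basis. (v \<bullet> e) * f' z e)" for z v
    proof -
      have lin: "linear (f' z)"
        using has_derivative_linear[OF f(1)] .
      have "f' z v = f' z (\<Sum>e\<in>Basis. (v \<bullet> e) *\<^sub>R e)"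
        by (simp add: euclidean_representation)
      also have "\<dots> = (\<Sum>e\<in>Basis. (v \<bullet> e) * f' z e)"
        by (simp only: linear_sum[OF lin] linear_scale[OF lin] real_scaleR_def)
      finally show ?thesis .
    qed
    then have eq: "(\<lambda>x. f' (c + L x) (L b)) = (\<lambda>x. \<Sum>e\<in>Basis. (L b \<bullet> e) * f' (c + L x) e)"
      by blast
    show "C_k k (\<lambda>x. f' (c + L x) (L b))"
      unfolding eq
    proof (rule C_k_sum, rule C_k_mult[OF C_k_const])
      show "C_k k (\<lambda>x. f' (c + L x) e)" if "e \<in> Basis" for e
        using Suc.IH[of "\<lambda>z. f' z e"] f(2)[OF that] by simp
    qed
  qed
qed

text \<open>\<open>\<psi>\<close> lists a function together with all its derivatives. Proving the
  claim for every \<open>m\<close> at once lets the induction step differentiate a single time,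
  passing from \<open>\<psi> m\<close> to \<open>\<psi> (Suc m)\<close>.\<close>

lemma C_k_compose_real:
  fixes \<psi> :: "nat \<Rightarrow> real \<Rightarrow> real"
  assumes "\<And>m x. (\<psi> m has_real_derivative \<psi> (Suc m) x) (at x)" "\<And>k. C_k k f"
  shows "C_k k (\<lambda>x. \<psi> m (f x))"
proof (induction k arbitrary: m)
  case 0
  have "continuous_on UNIV (\<psi> m)"
    using assms(1) DERIV_isCont continuous_at_imp_continuous_on by blast
  then show ?case
    using continuous_on_compose2[of UNIV "\<psi> m" UNIV f] assms(2)[of 0] by auto
next
  case (Suc k)
  obtain f' where f: "\<And>x. (f has_derivative f' x) (at x)" "\<And>b. b \<in> Basis \<Longrightarrow> C_k k (\<lambda>x. f' x b)"
    using C_k_SucE[OF assms(2)] by blast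
  show ?case
  proof (rule C_k_SucI[where f' = "\<lambda>x v. \<psi> (Suc m) (f x) * f' x v"])
    show "((\<lambda>x. \<psi> m (f x)) has_derivative (\<lambda>v. \<psi> (Suc m) (f x) * f' x v)) (at x)" for x
      using has_derivative_compose[OF f(1) assms(1)[unfolded has_field_derivative_def]] by simp
  qed (auto intro!: C_k_mult Suc.IH f(2))
qed

text \<open>Differentiating \<open>q (1/x) * exp (- 1/x)\<close> gives
  \<open>(1/x)\<^sup>2 * (q - q') (1/x) * exp (- 1/x)\<close>; the factor \<open>[:0, 0, 1:]\<close>
  is that square.\<close>

primrec flat_poly :: "nat \<Rightarrow> real poly" where
  "flat_poly 0 = 1"
| "flat_poly (Suc m) = [:0, 0, 1:] * (flat_poly m - pderiv (flat_poly m))"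

text \<open>The \<open>m\<close>-th derivative of \<open>exp (-1/x)\<close>, which is flat at \<open>0\<close>.\<close>

definition flat :: "nat \<Rightarrow> real \<Rightarrow> real" where
  "flat m x = (if x > 0 then poly (flat_poly m) (1 / x) * exp (- (1 / x)) else 0)"

lemma poly_times_exp_minus_tendsto_0: "((\<lambda>x. poly q x * exp (- x)) \<longlongrightarrow> 0) (at_top :: real filter)"
proof -
  have "((\<lambda>x. \<Sum>i\<le>degree q. coeff q i * (x ^ i / exp x)) \<longlongrightarrow> (\<Sum>i\<le>degree q. coeff q i * 0)) at_top"
    by (intro tendsto_intros tendsto_power_div_exp_0)
  then show ?thesis
    by (simp add: poly_altdef sum_distrib_right exp_minus divide_inverse mult.assoc)
qed

lemma flat_DERIV: "(flat m has_real_derivative flat (Suc m) x) (at x)"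
proof (cases x "0 :: real" rule: linorder_cases)
  case less
  then have "eventually (\<lambda>y. flat m y = 0) (nhds x)"
    using eventually_nhds_in_open[of "{..<0}" x] by (auto elim!: eventually_mono simp: flat_def)
  then show ?thesis using less
    by (subst DERIV_cong_ev[OF refl _ refl, where g = "\<lambda>y. 0"]) (auto simp: flat_def)
next
  case greater
  have ev: "eventually (\<lambda>y. flat m y = poly (flat_poly m) (1 / y) * exp (- (1 / y))) (nhds x)"
    using eventually_nhds_in_open[of "{0<..}" x] greater
    by (auto elim!: eventually_mono simp: flat_def)
  have "((\<lambda>y. poly (flat_poly m) (1 / y) * exp (- (1 / y))) has_real_derivative flat (Suc m) x) (at x)"
  proof -
    have i: "((\<lambda>y. 1 / y) has_real_derivative - ((1 / x)\<^sup>2)) (at x)"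
      using greater by (auto intro!: derivative_eq_intros simp: power2_eq_square)
    have e: "((\<lambda>y. exp (- (1 / y))) has_real_derivative exp (- (1 / x)) * (1 / x)\<^sup>2) (at x)"
      using DERIV_chain2[OF DERIV_exp DERIV_minus[OF i]] by simp
    have "flat (Suc m) x = poly (pderiv (flat_poly m)) (1 / x) * - ((1 / x)\<^sup>2) * exp (- (1 / x)) +
        exp (- (1 / x)) * (1 / x)\<^sup>2 * poly (flat_poly m) (1 / x)"
      using greater by (simp add: flat_def power2_eq_square ring_distribs)
    then show ?thesis
      using DERIV_mult[OF DERIV_chain2[OF poly_DERIV i] e] by simp
  qed
  then show ?thesis by (subst DERIV_cong_ev[OF refl ev refl])
next
  case equal
  \<comment> \<open>From the right the difference quotient at 0 carries one more factor
    \<open>1 / h\<close>, hence \<open>[:0, 1:]\<close>; the exponential still wins. From the left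
    it is 0.\<close>
  have "((\<lambda>h. poly ([:0, 1:] * flat_poly m) (1 / h) * exp (- (1 / h))) \<longlongrightarrow> 0) (at_right (0::real))"
    using filterlim_compose[OF poly_times_exp_minus_tendsto_0[of "[:0, 1:] * flat_poly m"]
        filterlim_inverse_at_top_right]
    unfolding inverse_eq_divide .
  then have "((\<lambda>h. flat m h / h) \<longlongrightarrow> 0) (at_right 0)"
    by (rule Lim_transform_eventually)
      (auto simp: eventually_at_right_field flat_def field_simps intro!: exI[of _ 1])
  moreover have "((\<lambda>h. flat m h / h) \<longlongrightarrow> 0) (at_left 0)"
    by (rule tendsto_eventually) (auto simp: eventually_at_left_field flat_def intro!: exI[of _ "-1"])
  ultimately show ?thesis
    using equal by (auto simp: has_field_derivative_iff filterlim_split_at flat_def)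
qed

lemma flat_nonneg: "flat 0 x \<ge> 0" and flat_pos_iff: "flat 0 x > 0 \<longleftrightarrow> x > 0"
  by (auto simp: flat_def)

text \<open>The squared norm is a polynomial in the coordinates, so the bump is smooth at the origin
  as well. \<open>Suc k\<close> keeps the radius meaningful for \<open>k = 0\<close>.\<close>

definition bump :: "nat \<Rightarrow> 'a::euclidean_space \<Rightarrow> real" where
  "bump k z = flat 0 ((1 / real (Suc k))\<^sup>2 - (norm z)\<^sup>2)"

lemma bump_C_k: "C_k m (bump k)"
proof -
  have "C_k j (\<lambda>z :: 'a. (1 / real (Suc k))\<^sup>2 + (-1) * (\<Sum>b\<in>Basis. (z \<bullet> b) * (z \<bullet> b)))" for j
    by (intro C_k_add C_k_mult C_k_sum C_k_const C_k_linear bounded_linear_inner_left)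
  moreover have eq: "bump k = (\<lambda>z :: 'a. flat 0 ((1 / real (Suc k))\<^sup>2 + (-1) * (\<Sum>b\<in>Basis. (z \<bullet> b) * (z \<bullet> b))))"
  proof
    show "bump k z = flat 0 ((1 / real (Suc k))\<^sup>2 + (-1) * (\<Sum>b\<in>Basis. (z \<bullet> b) * (z \<bullet> b)))" for z :: 'a
      unfolding bump_def euclidean_inner[symmetric] power2_norm_eq_inner by simp
  qed
  ultimately show ?thesis
    unfolding eq by (intro C_k_compose_real[of flat, OF flat_DERIV])
qed

lemma bump_nonneg: "bump k z \<ge> 0"
  by (simp add: bump_def flat_nonneg)

lemma bump_pos_iff: "bump k z > 0 \<longleftrightarrow> norm z < 1 / real (Suc k)"
proof -
  have "(1 / real (Suc k))\<^sup>2 \<le> (norm z)\<^sup>2 \<longleftrightarrow> 1 / real (Suc k) \<le> norm z"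
    using abs_le_square_iff[of "1 / real (Suc k)" "norm z"] by simp
  then show ?thesis
    unfolding bump_def flat_pos_iff by linarith
qed

lemma bump_eq_0: "norm z \<ge> 1 / real (Suc k) \<Longrightarrow> bump k z = 0"
  using bump_pos_iff[of k z] bump_nonneg[of k z] by linarith

section \<open>Directional derivatives and integration by parts\<close>

text \<open>A derivative along one fixed direction, required at every base point and hence along
  entire lines. It is what the translation argument below consumes, and it is stable under products
  and under composition with functions of one variable such as the squared positive part.\<close>

definition has_dir_deriv :: "'a::real_normed_vector \<Rightarrow> ('a \<Rightarrow> real) \<Rightarrow> ('a \<Rightarrow> real) \<Rightarrow> bool" where
  "has_dir_deriv c F F' \<longleftrightarrow> (\<forall>z. ((\<lambda>s. F (z + s *\<^sub>R c)) has_real_derivative F' z) (at 0))"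

lemma has_dir_derivD: "has_dir_deriv c F F' \<Longrightarrow> ((\<lambda>s. F (z + s *\<^sub>R c)) has_real_derivative F' z) (at 0)"
  by (simp add: has_dir_deriv_def)

lemma has_dir_deriv_line:
  assumes "has_dir_deriv c F F'"
  shows "((\<lambda>s. F (z + s *\<^sub>R c)) has_real_derivative F' (z + s *\<^sub>R c)) (at s)"
proof -
  have "((\<lambda>r. F (z + s *\<^sub>R c + r *\<^sub>R c)) has_real_derivative F' (z + s *\<^sub>R c)) (at 0)"
    by (rule has_dir_derivD[OF assms])
  then have "((\<lambda>r. F (z + (r + s) *\<^sub>R c)) has_real_derivative F' (z + s *\<^sub>R c)) (at 0)"
    by (simp add: algebra_simps)
  then show ?thesis
    using DERIV_shift[of "\<lambda>r. F (z + r *\<^sub>R c)" _ 0 s] by simp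
qed

lemma has_dir_deriv_mult:
  assumes "has_dir_deriv c F F'" "has_dir_deriv c G G'"
  shows "has_dir_deriv c (\<lambda>z. F z * G z) (\<lambda>z. F' z * G z + F z * G' z)"
  unfolding has_dir_deriv_def
proof
  fix z
  show "((\<lambda>s. F (z + s *\<^sub>R c) * G (z + s *\<^sub>R c)) has_real_derivative F' z * G z + F z * G' z) (at 0)"
    using DERIV_mult[OF assms[THEN has_dir_derivD, of z]] by (simp add: algebra_simps)
qed

lemma has_dir_deriv_compose:
  assumes "has_dir_deriv c F F'" "\<And>s. (g has_real_derivative g' s) (at s)"
  shows "has_dir_deriv c (\<lambda>z. g (F z)) (\<lambda>z. g' (F z) * F' z)"
  unfolding has_dir_deriv_def
proof
  fix z
  show "((\<lambda>s. g (F (z + s *\<^sub>R c))) has_real_derivative g' (F z) * F' z) (at 0)"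
    using DERIV_chain2[OF assms(2) has_dir_derivD[OF assms(1), of z]] by simp
qed

lemma has_derivative_imp_has_dir_deriv:
  assumes "\<And>x. (f has_derivative f' x) (at x)"
  shows "has_dir_deriv c f (\<lambda>x. f' x c)"
  unfolding has_dir_deriv_def
proof
  fix z
  have "((\<lambda>s. z + s *\<^sub>R c) has_derivative (\<lambda>s. s *\<^sub>R c)) (at (0::real))"
    by (auto intro!: derivative_eq_intros)
  then have "((\<lambda>s. f (z + s *\<^sub>R c)) has_derivative (\<lambda>s. f' z (s *\<^sub>R c))) (at 0)"
    using has_derivative_compose[of "\<lambda>s. z + s *\<^sub>R c" "\<lambda>s. s *\<^sub>R c" 0 UNIV f "f' z"] assms[of z] by simp
  moreover have "f' z (s *\<^sub>R c) = f' z c * s" for s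
    using linear_scale[OF has_derivative_linear[OF assms], of z s c] by simp
  ultimately show "((\<lambda>s. f (z + s *\<^sub>R c)) has_real_derivative f' z c) (at 0)"
    by (simp add: has_field_derivative_def)
qed

lemma has_dir_deriv_quotient_bound:
  assumes "has_dir_deriv c F F'" "\<And>z. \<bar>F' z\<bar> \<le> C"
  shows "\<bar>F (z + h *\<^sub>R c) - F z\<bar> \<le> C * \<bar>h\<bar>"
proof -
  have "norm (F (z + h *\<^sub>R c) - F (z + 0 *\<^sub>R c)) \<le> C * norm (h - 0)"
    using has_dir_deriv_line[OF assms(1), of z] assms(2)
    by (intro field_differentiable_bound[where S = UNIV]) (auto simp: has_field_derivative_at_within)
  then show ?thesis by simp
qed

lemma has_dir_deriv_sequence:
  assumes "has_dir_deriv c F F'" "X \<longlonglongrightarrow> 0" "\<And>n. X n \<noteq> 0"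
  shows "(\<lambda>n. (F (z + X n *\<^sub>R c) - F z) / X n) \<longlonglongrightarrow> F' z"
  using has_dir_derivD[OF assms(1), of z] assms(2,3)
  by (auto simp: has_field_derivative_iff tendsto_at_iff_sequentially o_def)

section \<open>Translation invariance and integrals of derivatives\<close>

lemma lborel_translate:
  fixes f :: "'a::euclidean_space \<Rightarrow> real"
  assumes "f \<in> borel_measurable borel"
  shows "integrable lborel (\<lambda>z. f (z + c)) \<longleftrightarrow> integrable lborel f"
    and "(LINT z|lborel. f (z + c)) = (LINT z|lborel. f z)"
proof -
  have "integrable (distr lborel borel ((+) c)) f \<longleftrightarrow> integrable lborel (\<lambda>z. f (c + z))"
    by (rule integrable_distr_eq) (use assms in auto)
  then show "integrable lborel (\<lambda>z. f (z + c)) \<longleftrightarrow> integrable lborel f"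
    by (simp add: lborel_distr_plus add.commute)
  have "integral\<^sup>L (distr lborel borel ((+) c)) f = (LINT z|lborel. f (c + z))"
    by (rule integral_distr) (use assms in auto)
  then show "(LINT z|lborel. f (z + c)) = (LINT z|lborel. f z)"
    by (simp add: lborel_distr_plus add.commute)
qed

lemma lborel_reflect:
  fixes f :: "'a::euclidean_space \<Rightarrow> real"
  assumes "f \<in> borel_measurable borel"
  shows "integrable lborel (\<lambda>z. f (c - z)) \<longleftrightarrow> integrable lborel f"
    and "(LINT z|lborel. f (c - z)) = (LINT z|lborel. f z)"
proof -
  have [simp]: "distr lborel borel (\<lambda>x. c - x) = (lborel :: 'a measure)"
    using lborel_affine[of "-1" c] by (simp add: density_1)
  have "integrable (distr lborel borel (\<lambda>x. c - x)) f \<longleftrightarrow> integrable lborel (\<lambda>z. f (c - z))"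
    by (rule integrable_distr_eq) (use assms in auto)
  then show "integrable lborel (\<lambda>z. f (c - z)) \<longleftrightarrow> integrable lborel f" by simp
  have "integral\<^sup>L (distr lborel borel (\<lambda>x. c - x)) f = (LINT z|lborel. f (c - z))"
    by (rule integral_distr) (use assms in auto)
  then show "(LINT z|lborel. f (c - z)) = (LINT z|lborel. f z)" by simp
qed

lemma integrable_bounded_support:
  fixes f :: "'a::euclidean_space \<Rightarrow> real"
  assumes "f \<in> borel_measurable borel" "\<And>z. \<bar>f z\<bar> \<le> C" "bounded S" "\<And>z. z \<notin> S \<Longrightarrow> f z = 0"
  shows "integrable lborel f"
proof -
  obtain R where R: "S \<subseteq> cball 0 R"
    using assms(3) by (auto simp: bounded_iff subset_iff)
  have i: "integrable lborel (\<lambda>z :: 'a. C * indicator (cball 0 R) z)"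
    using emeasure_lborel_cball_finite[of "0 :: 'a" R] by (intro integrable_mult_right) (auto simp: integrable_indicator_iff)
  have b: "norm (f z) \<le> norm (C * indicator (cball 0 R) z)" for z
    using assms(2)[of z] assms(4)[of z] subsetD[OF R, of z] by (cases "z \<in> S") auto
  show ?thesis
    by (rule Bochner_Integration.integrable_bound[OF i _ AE_I2[OF b]]) (use assms(1) in simp)
qed

text \<open>Translation invariance makes the integral of every difference quotient vanish; dominated
  convergence does the rest, without any use of Fubini's theorem.\<close>

lemma integral_dir_deriv_eq_0:
  fixes F :: "'a::euclidean_space \<Rightarrow> real"
  assumes d: "has_dir_deriv c F F'" and cont: "continuous_on UNIV F"
    and b: "\<And>z. \<bar>F' z\<bar> \<le> C" and S: "bounded S" "\<And>z. z \<notin> S \<Longrightarrow> F z = 0"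
  shows "integrable lborel F'" "(LINT z|lborel. F' z) = 0"
proof -
  obtain R where R: "S \<subseteq> cball 0 R"
    using S(1) by (auto simp: bounded_iff subset_iff)
  define X :: "nat \<Rightarrow> real" where "X n = inverse (real (Suc n))" for n
  have X: "X \<longlonglongrightarrow> 0" "X n > 0" "X n \<le> 1" for n
    using LIMSEQ_inverse_real_of_nat unfolding X_def by (auto simp: inverse_le_1_iff)
  define q where "q n z = (F (z + X n *\<^sub>R c) - F z) / X n" for n z
  \<comment> \<open>All steps \<open>X n\<close> are at most 1, so the difference quotients vanish
    outside the support ball enlarged by \<open>norm c\<close>; inside, the mean value theorem
    bounds them by \<open>C\<close>.\<close>
  define w :: "'a \<Rightarrow> real" where "w z = C * indicator (cball 0 (R + norm c)) z" for z
  have [measurable]: "F \<in> borel_measurable borel"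
    using cont by (rule borel_measurable_continuous_onI)
  have q_meas[measurable]: "q n \<in> borel_measurable lborel" for n
    unfolding q_def by simp
  have lim: "(\<lambda>n. q n z) \<longlonglongrightarrow> F' z" for z
    unfolding q_def using X(2) by (intro has_dir_deriv_sequence[OF d X(1)]) (simp add: less_imp_neq[symmetric])
  have F'_meas: "F' \<in> borel_measurable lborel"
    using borel_measurable_LIMSEQ_real[OF lim q_meas] .
  have C: "C \<ge> 0" using b[of 0] by linarith
  have q_bound: "norm (q n z) \<le> w z" for n z
  proof (cases "z \<in> cball 0 (R + norm c)")
    case True
    have "\<bar>F (z + X n *\<^sub>R c) - F z\<bar> \<le> C * X n"
      using has_dir_deriv_quotient_bound[OF d b, of z "X n"] X(2)[of n] by simp
    then show ?thesis
      using True X(2)[of n] by (simp add: q_def w_def field_simps)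
  next
    case False
    have "norm (X n *\<^sub>R c) \<le> norm c"
      using X(2,3)[of n] mult_left_le_one_le[of "norm c" "X n"] by simp
    moreover have "norm z \<le> norm (z + X n *\<^sub>R c) + norm (X n *\<^sub>R c)"
      using norm_triangle_ineq4[of "z + X n *\<^sub>R c" "X n *\<^sub>R c"] by simp
    ultimately have "norm (z + X n *\<^sub>R c) > R" "norm z > R"
      using False by (auto simp: not_le[symmetric] intro: order_trans[of _ R])
    then have "z + X n *\<^sub>R c \<notin> S" "z \<notin> S"
      using R by auto
    then show ?thesis
      using S(2) C by (simp add: q_def w_def)
  qed
  have w: "integrable lborel w"
    unfolding w_def
    by (rule integrable_bounded_support[where C = C and S = "cball 0 (R + norm c)"])
      (use C in \<open>auto simp: indicator_def\<close>)
  show "integrable lborel F'"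
    by (rule integrable_dominated_convergence[OF F'_meas q_meas w AE_I2[OF lim] AE_I2[OF q_bound]])
  obtain B where B: "\<forall>z\<in>cball 0 R. \<bar>F z\<bar> \<le> B"
    using compact_imp_bounded[OF compact_continuous_image[OF continuous_on_subset[OF cont] compact_cball[of 0 R]]]
    by (auto simp: bounded_iff)
  have "\<bar>F z\<bar> \<le> max B 0" for z
    using bspec[OF B, of z] subsetD[OF R, of z] S(2)[of z] by (cases "z \<in> S") auto
  then have F_int: "integrable lborel F"
    by (intro integrable_bounded_support[OF _ _ S]) auto
  have "(LINT z|lborel. q n z) = 0" for n
    unfolding q_def using F_int lborel_translate[of F "X n *\<^sub>R c"] by (simp add: Bochner_Integration.integral_diff)
  moreover have "(\<lambda>n. LINT z|lborel. q n z) \<longlonglongrightarrow> (LINT z|lborel. F' z)"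
    by (rule integral_dominated_convergence[OF F'_meas q_meas w AE_I2[OF lim] AE_I2[OF q_bound]])
  ultimately show "(LINT z|lborel. F' z) = 0"
    by (simp add: LIMSEQ_const_iff)
qed

lemma has_dir_deriv_zero_outside:
  assumes "has_dir_deriv c F F'" "closed S" "\<And>z. z \<notin> S \<Longrightarrow> F z = 0" "z \<notin> S"
  shows "F' z = 0"
proof -
  have "((\<lambda>s::real. z + s *\<^sub>R c) \<longlongrightarrow> z + 0 *\<^sub>R c) (nhds 0)"
    by (intro tendsto_intros filterlim_ident)
  then have "eventually (\<lambda>s::real. z + s *\<^sub>R c \<in> - S) (nhds 0)"
    using topological_tendstoD[of _ "z + 0 *\<^sub>R c" _ "- S"] assms(2,4) by (auto simp: closed_def)
  then have "eventually (\<lambda>s::real. F (z + s *\<^sub>R c) = 0) (nhds 0)"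
    by (rule eventually_mono) (simp add: assms(3))
  then have "((\<lambda>s. F (z + s *\<^sub>R c)) has_real_derivative 0) (at 0)"
    by (subst DERIV_cong_ev[OF refl _ refl, where g = "\<lambda>y. 0"]) auto
  then show ?thesis
    using has_dir_derivD[OF assms(1), of z] DERIV_unique by blast
qed

lemma integrable_continuous_compact_support:
  fixes f :: "'a::euclidean_space \<Rightarrow> 'b::{banach, second_countable_topology}"
  assumes "continuous_on UNIV f" "compact S" "\<And>z. z \<notin> S \<Longrightarrow> f z = 0"
  shows "integrable lborel f"
proof -
  have "indicator S x *\<^sub>R f x = f x" for x
    using assms(3)[of x] by (cases "x \<in> S") auto
  then show ?thesis
    using borel_integrable_compact[OF assms(2) continuous_on_subset[OF assms(1)]] by simp
qed

lemma continuous_compact_support_bounded: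
  fixes f :: "'a::euclidean_space \<Rightarrow> real"
  assumes "continuous_on UNIV f" "compact S" "\<And>z. z \<notin> S \<Longrightarrow> f z = 0"
  obtains C where "C \<ge> 0" "\<And>z. \<bar>f z\<bar> \<le> C"
proof -
  obtain B where B: "\<And>z. z \<in> S \<Longrightarrow> \<bar>f z\<bar> \<le> B"
    using compact_imp_bounded[OF compact_continuous_image[OF continuous_on_subset[OF assms(1)] assms(2)]]
    by (auto simp: bounded_iff)
  have "\<bar>f z\<bar> \<le> max B 0" for z
    using B[of z] assms(3)[of z] by (cases "z \<in> S") auto
  then show ?thesis
    by (intro that[of "max B 0"]) auto
qed

text \<open>Only \<open>\<phi>\<close> has compact support; the product \<open>u * \<phi>\<close>
  inherits it, and the derivative of the product has integral zero.\<close>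

lemma integration_by_parts_dir:
  fixes u u' \<phi> \<phi>' :: "'a::euclidean_space \<Rightarrow> real"
  assumes u: "has_dir_deriv c u u'" "continuous_on UNIV u" "continuous_on UNIV u'"
    and \<phi>: "has_dir_deriv c \<phi> \<phi>'" "continuous_on UNIV \<phi>" "continuous_on UNIV \<phi>'"
    and S: "compact S" "\<And>z. z \<notin> S \<Longrightarrow> \<phi> z = 0"
  shows "integrable lborel (\<lambda>z. u z * \<phi>' z)" "integrable lborel (\<lambda>z. u' z * \<phi> z)"
    "(LINT z|lborel. u z * \<phi>' z) = - (LINT z|lborel. u' z * \<phi> z)"
proof -
  have S': "\<And>z. z \<notin> S \<Longrightarrow> \<phi>' z = 0"
    using has_dir_deriv_zero_outside[OF \<phi>(1) compact_imp_closed[OF S(1)] S(2)] .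
  show i1: "integrable lborel (\<lambda>z. u z * \<phi>' z)"
    by (rule integrable_continuous_compact_support[OF _ S(1)])
      (auto intro!: continuous_on_mult u \<phi> simp: S')
  show i2: "integrable lborel (\<lambda>z. u' z * \<phi> z)"
    by (rule integrable_continuous_compact_support[OF _ S(1)])
      (auto intro!: continuous_on_mult u \<phi> simp: S(2))
  have c: "continuous_on UNIV (\<lambda>z. u' z * \<phi> z + u z * \<phi>' z)"
    by (intro continuous_intros u \<phi>)
  obtain C where "C \<ge> 0" "\<And>z. \<bar>u' z * \<phi> z + u z * \<phi>' z\<bar> \<le> C"
    by (rule continuous_compact_support_bounded[OF c S(1)]) (simp_all add: S S')
  then have "(LINT z|lborel. u' z * \<phi> z + u z * \<phi>' z) = 0"
    using S by (intro integral_dir_deriv_eq_0(2)[OF has_dir_deriv_mult[OF u(1) \<phi>(1)], of C S] continuous_on_mult u \<phi>)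
      (auto simp: compact_imp_bounded)
  then show "(LINT z|lborel. u z * \<phi>' z) = - (LINT z|lborel. u' z * \<phi> z)"
    using i1 i2 by simp
qed

section \<open>Mollification\<close>

definition conv :: "('a::euclidean_space \<Rightarrow> real) \<Rightarrow> ('a \<Rightarrow> real) \<Rightarrow> 'a \<Rightarrow> real" where
  "conv g f z = (LINT y|lborel. g (z - y) * f y)"

lemma conv_integrable:
  fixes f g :: "'a::euclidean_space \<Rightarrow> real"
  assumes g: "continuous_on UNIV g" "\<And>z. \<bar>g z\<bar> \<le> C" and f: "integrable lborel f"
  shows "integrable lborel (\<lambda>y. g (z - y) * f y)"
proof (rule Bochner_Integration.integrable_bound)
  have [measurable]: "g \<in> borel_measurable borel" "f \<in> borel_measurable borel"
    using borel_measurable_continuous_onI[OF g(1)] borel_measurable_integrable[OF f] by auto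
  show "(\<lambda>y. g (z - y) * f y) \<in> borel_measurable lborel"
    by simp
  show "integrable lborel (\<lambda>y. C * f y)"
    using f by simp
  have "\<bar>g (z - y)\<bar> * \<bar>f y\<bar> \<le> \<bar>C\<bar> * \<bar>f y\<bar>" for y
    by (rule mult_right_mono) (use g(2)[of "z - y"] in auto)
  then show "AE y in lborel. norm (g (z - y) * f y) \<le> norm (C * f y)"
    by (simp add: abs_mult)
qed

lemma conv_bounded:
  fixes f g :: "'a::euclidean_space \<Rightarrow> real"
  assumes g: "continuous_on UNIV g" "\<And>z. \<bar>g z\<bar> \<le> C" and f: "integrable lborel f"
  shows "\<bar>conv g f z\<bar> \<le> C * (LINT y|lborel. \<bar>f y\<bar>)"
proof -
  have "\<bar>conv g f z\<bar> \<le> (LINT y|lborel. \<bar>g (z - y) * f y\<bar>)"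
    unfolding conv_def by (rule integral_abs_bound)
  also have "\<dots> \<le> (LINT y|lborel. C * \<bar>f y\<bar>)"
    by (rule integral_mono[OF integrable_abs[OF conv_integrable[OF assms]]])
      (use f g(2) in \<open>auto simp: abs_mult intro!: mult_right_mono\<close>)
  finally show ?thesis by simp
qed

lemma conv_continuous:
  fixes f g :: "'a::euclidean_space \<Rightarrow> real"
  assumes g: "continuous_on UNIV g" "\<And>z. \<bar>g z\<bar> \<le> C" and f: "integrable lborel f"
  shows "continuous_on UNIV (conv g f)"
proof (rule continuous_at_imp_continuous_on, rule ballI, unfold continuous_at_sequentially o_def, intro allI impI)
  fix z and x :: "nat \<Rightarrow> 'a" assume x: "x \<longlonglongrightarrow> z"
  have m: "(\<lambda>y. g (v - y) * f y) \<in> borel_measurable lborel" for v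
    using borel_measurable_integrable[OF conv_integrable[OF assms]] .
  have w: "integrable lborel (\<lambda>y. C * \<bar>f y\<bar>)"
    using f by simp
  have lim: "(\<lambda>n. g (x n - y) * f y) \<longlonglongrightarrow> g (z - y) * f y" for y
    using continuous_on_tendsto_compose[OF g(1) tendsto_diff[OF x tendsto_const]]
    by (intro tendsto_mult_right) auto
  have b: "norm (g (x n - y) * f y) \<le> C * \<bar>f y\<bar>" for n y
    using g(2) by (auto simp: abs_mult intro!: mult_right_mono)
  show "(\<lambda>n. conv g f (x n)) \<longlonglongrightarrow> conv g f z"
    unfolding conv_def
    by (rule integral_dominated_convergence[OF m m w AE_I2[OF lim] AE_I2[OF b]])
qed

text \<open>The derivative falls on the kernel, so integrability of \<open>f\<close> suffices: the
  difference quotients of \<open>g\<close> are bounded by the bound of \<open>g'\<close>, which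
  gives the majorant \<open>C * \<bar>f\<bar>\<close>.\<close>

lemma conv_dir_deriv:
  fixes f g g' :: "'a::euclidean_space \<Rightarrow> real"
  assumes g: "continuous_on UNIV g" "\<And>z. \<bar>g z\<bar> \<le> C"
    and g': "continuous_on UNIV g'" "\<And>z. \<bar>g' z\<bar> \<le> C"
    and d: "has_dir_deriv c g g'" and f: "integrable lborel f"
  shows "has_dir_deriv c (conv g f) (conv g' f)"
  unfolding has_dir_deriv_def has_field_derivative_iff tendsto_at_iff_sequentially
proof (intro allI impI)
  fix z and x :: "nat \<Rightarrow> real" assume x0: "\<forall>i. x i \<in> UNIV - {0}" and x: "x \<longlonglongrightarrow> 0"
  define q where "q n y = (g (z - y + x n *\<^sub>R c) - g (z - y)) / x n * f y" for n y
  have x1: "x n \<noteq> 0" for n using x0 by auto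
  have [measurable]: "g \<in> borel_measurable borel" "f \<in> borel_measurable borel"
    using borel_measurable_continuous_onI[OF g(1)] borel_measurable_integrable[OF f] by auto
  have qm: "q n \<in> borel_measurable lborel" for n
    unfolding q_def by simp
  have m: "(\<lambda>y. g' (z - y) * f y) \<in> borel_measurable lborel"
    using borel_measurable_integrable[OF conv_integrable[OF g' f]] .
  have w: "integrable lborel (\<lambda>y. C * \<bar>f y\<bar>)"
    using f by simp
  have lim: "(\<lambda>n. q n y) \<longlonglongrightarrow> g' (z - y) * f y" for y
    unfolding q_def by (intro tendsto_mult_right has_dir_deriv_sequence[OF d x x1])
  have b: "norm (q n y) \<le> C * \<bar>f y\<bar>" for n y
  proof -
    have "\<bar>(g (z - y + x n *\<^sub>R c) - g (z - y)) / x n\<bar> \<le> C"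
      using has_dir_deriv_quotient_bound[OF d g'(2), of "z - y" "x n"] x1[of n] by (simp add: field_simps)
    then show ?thesis
      unfolding q_def real_norm_def abs_mult by (rule mult_right_mono) simp
  qed
  have "(LINT y|lborel. q n y) = (conv g f (z + (0 + x n) *\<^sub>R c) - conv g f (z + 0 *\<^sub>R c)) / (0 + x n - 0)" for n
  proof -
    have "q n = (\<lambda>y. (g (z + x n *\<^sub>R c - y) * f y - g (z - y) * f y) / x n)"
      unfolding q_def by (simp add: fun_eq_iff algebra_simps diff_divide_distrib)
    then show ?thesis
      using conv_integrable[OF g f] by (simp add: conv_def)
  qed
  moreover have "(\<lambda>n. LINT y|lborel. q n y) \<longlonglongrightarrow> (LINT y|lborel. g' (z - y) * f y)"
    by (rule integral_dominated_convergence[OF m qm w AE_I2[OF lim] AE_I2[OF b]])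
  ultimately show "((\<lambda>y. (conv g f (z + y *\<^sub>R c) - conv g f (z + 0 *\<^sub>R c)) / (y - 0)) \<circ> x) \<longlonglongrightarrow> conv g' f z"
    by (simp add: o_def conv_def)
qed

section \<open>The standard mollifier and its inequalities\<close>

definition moll :: "nat \<Rightarrow> 'a::euclidean_space \<Rightarrow> real" where
  "moll k z = bump k z / (LINT y::'a|lborel. bump k y)"

abbreviation mollify :: "nat \<Rightarrow> ('a::euclidean_space \<Rightarrow> real) \<Rightarrow> 'a \<Rightarrow> real" where
  "mollify k \<equiv> conv (moll k)"

lemma bump_integrable: "integrable lborel (bump k :: 'a::euclidean_space \<Rightarrow> real)"
  using C_k_continuous[OF bump_C_k[of 0 k]]
  by (rule integrable_continuous_compact_support[of _ "cball 0 (1 / real (Suc k))"]) (auto intro: bump_eq_0 simp del: of_nat_Suc)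

text \<open>Turns almost everywhere inequalities between continuous functions into inequalities
  everywhere: the exceptional set is open, and balls have positive measure.\<close>

lemma open_AE_empty:
  fixes S :: "'a::euclidean_space set"
  assumes "open S" "AE z in lborel. z \<notin> S"
  shows "S = {}"
proof (rule ccontr)
  assume "S \<noteq> {}"
  then obtain x where "x \<in> S" by blast
  then obtain r where r: "r > 0" "ball x r \<subseteq> S"
    using assms(1) unfolding open_contains_ball by blast
  have "AE z in lborel. z \<notin> ball x r"
    using assms(2) by (rule eventually_mono) (use r(2) in auto)
  then have "emeasure lborel (ball x r) = 0"
    by (subst (asm) AE_iff_measurable[OF _ refl]) (auto simp: ball_def)
  then have "measure lborel (ball x r) = 0"
    by (simp add: measure_def)
  then show False
    using content_ball_pos[OF r(1), of x] by simp
qed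

lemma bump_integral_pos: "(LINT y::'a::euclidean_space|lborel. bump k y) > 0"
proof (rule ccontr)
  assume "\<not> (LINT y::'a|lborel. bump k y) > 0"
  moreover have "(LINT y::'a|lborel. bump k y) \<ge> 0"
    by (intro integral_nonneg_AE AE_I2 bump_nonneg)
  ultimately have "(LINT y::'a|lborel. bump k y) = 0"
    by simp
  then have "AE y::'a in lborel. bump k y = 0"
    using integral_nonneg_eq_0_iff_AE[OF bump_integrable[of k, where 'a = 'a]] by (simp add: bump_nonneg)
  then have "AE y::'a in lborel. y \<notin> ball 0 (1 / real (Suc k))"
    by (rule AE_mp) (auto intro!: AE_I2 simp: bump_pos_iff[symmetric] simp del: of_nat_Suc)
  then have "ball (0::'a) (1 / real (Suc k)) = {}"
    by (intro open_AE_empty) simp_all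
  then show False
    by (simp del: of_nat_Suc)
qed

lemma moll_C_k: "C_k m (moll k :: 'a::euclidean_space \<Rightarrow> real)"
  using C_k_mult[OF bump_C_k[of m k] C_k_const[of m "1 / (LINT y::'a|lborel. bump k y)"]]
  by (simp add: moll_def[abs_def])

lemma moll_nonneg: "moll k (z :: 'a::euclidean_space) \<ge> 0"
  using bump_integral_pos[of k, where 'a = 'a] bump_nonneg[of k z]
  by (simp add: moll_def)

lemma moll_eq_0: "norm z \<ge> 1 / real (Suc k) \<Longrightarrow> moll k z = 0"
  by (simp add: moll_def bump_eq_0 del: of_nat_Suc)

lemma moll_continuous: "continuous_on UNIV (moll k)"
  using C_k_continuous[OF moll_C_k[of 0 k]] .

lemma moll_borel[measurable]: "moll k \<in> borel_measurable borel"
  using borel_measurable_continuous_onI[OF moll_continuous] .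

lemma moll_bounded:
  obtains C where "C \<ge> 0" "\<And>z :: 'a::euclidean_space. \<bar>moll k z\<bar> \<le> C"
proof (rule continuous_compact_support_bounded[OF moll_continuous[of k, where 'a = 'a] compact_cball])
  show "moll k z = 0" if "z \<notin> cball 0 (1 / real (Suc k))" for z :: 'a
    using that by (intro moll_eq_0) (auto simp del: of_nat_Suc)
qed (rule that)

lemma moll_integrable: "integrable lborel (moll k)"
  unfolding moll_def[abs_def] by (intro Bochner_Integration.integrable_divide bump_integrable)

lemma moll_integral: "(LINT y::'a::euclidean_space|lborel. moll k y) = 1"
  using bump_integral_pos[of k, where 'a = 'a] by (simp add: moll_def)

lemma moll_integral_shift: "(LINT y::'a::euclidean_space|lborel. moll k (z - y)) = 1"
  "integrable lborel (\<lambda>y::'a. moll k (z - y))"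
  using lborel_reflect[OF moll_borel, of k z] moll_integral[of k, where 'a = 'a] moll_integrable[of k, where 'a = 'a]
  by auto

text \<open>Strict convexity of the power at a positive point, by the mean value theorem. Jensen's
  inequality uses the weak form; the strict form gives the room in the touching argument. The
  endpoint \<open>t = 0\<close> is separate because the power rule is applied on positive numbers
  only.\<close>

lemma powr_above_tangent:
  fixes s m t :: real
  assumes "s > 1" "m > 0" "t \<ge> 0" "t \<noteq> m"
  shows "m powr s + s * m powr (s - 1) * (t - m) < t powr s"
proof -
  have D: "((\<lambda>x. x powr s) has_real_derivative s * x powr (s - 1)) (at x)" if "x > 0" for x
    using that by (rule has_real_derivative_powr)
  consider "t = 0" | "0 < t" "t < m" | "m < t"
    using assms by linarith
  then show ?thesis
  proof cases
    case 1
    have "m powr s = m powr (s - 1) * m"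
      using assms(2) by (simp add: powr_mult_base[symmetric] mult.commute powr_diff)
    then show ?thesis
      using 1 assms by (simp add: algebra_simps)
  next
    case 2
    obtain x where x: "t < x" "x < m" "m powr s - t powr s = (m - t) * (s * x powr (s - 1))"
      using MVT2[of t m "\<lambda>x. x powr s" "\<lambda>x. s * x powr (s - 1)"] 2 D by force
    have "x powr (s - 1) < m powr (s - 1)"
      using x 2 assms by (intro powr_less_mono2) auto
    then have "(m - t) * (s * x powr (s - 1)) < (m - t) * (s * m powr (s - 1))"
      using 2 assms by (intro mult_strict_left_mono) auto
    then show ?thesis using x(3) by (simp add: algebra_simps)
  next
    case 3
    obtain x where x: "m < x" "x < t" "t powr s - m powr s = (t - m) * (s * x powr (s - 1))"
      using MVT2[of m t "\<lambda>x. x powr s" "\<lambda>x. s * x powr (s - 1)"] 3 assms D by force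
    have "m powr (s - 1) < x powr (s - 1)"
      using x 3 assms by (intro powr_less_mono2) auto
    then have "(t - m) * (s * m powr (s - 1)) < (t - m) * (s * x powr (s - 1))"
      using 3 assms by (intro mult_strict_left_mono) auto
    then show ?thesis using x(3) by (simp add: algebra_simps)
  qed
qed

lemma conv_moll_integrable:
  fixes f :: "'a::euclidean_space \<Rightarrow> real"
  assumes "integrable lborel f"
  shows "integrable lborel (\<lambda>y. moll k (z - y) * f y)"
  using moll_bounded[of k, where 'a = 'a] conv_integrable[OF moll_continuous _ assms] by metis

lemma mollify_continuous:
  fixes f :: "'a::euclidean_space \<Rightarrow> real"
  assumes "integrable lborel f"
  shows "continuous_on UNIV (mollify k f)"
  using moll_bounded[of k, where 'a = 'a] conv_continuous[OF moll_continuous _ assms] by metis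

lemma mollify_borel:
  fixes f :: "'a::euclidean_space \<Rightarrow> real"
  assumes "integrable lborel f"
  shows "mollify k f \<in> borel_measurable borel"
  using borel_measurable_continuous_onI[OF mollify_continuous[OF assms]] .

lemma mollify_nonneg: "(\<And>z. f z \<ge> 0) \<Longrightarrow> mollify k f z \<ge> 0"
  unfolding conv_def by (intro integral_nonneg_AE AE_I2 mult_nonneg_nonneg moll_nonneg) auto

lemma mollify_diff:
  fixes f g :: "'a::euclidean_space \<Rightarrow> real"
  assumes "integrable lborel f" "integrable lborel g"
  shows "mollify k (\<lambda>z. f z - g z) z = mollify k f z - mollify k g z"
  using assms[THEN conv_moll_integrable, of k z] unfolding conv_def by (simp add: right_diff_distrib)

lemma abs_mollify_le:
  fixes f :: "'a::euclidean_space \<Rightarrow> real"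
  shows "\<bar>mollify k f z\<bar> \<le> mollify k (\<lambda>z. \<bar>f z\<bar>) z"
  using integral_abs_bound[of lborel "\<lambda>y. moll k (z - y) * f y"]
  by (simp add: conv_def abs_mult moll_nonneg abs_of_nonneg)

text \<open>Tonelli's theorem, the kernel having integral one in either variable. The equality of
  the integrals, rather than a bound, is what later allows the majorants to cancel.\<close>

lemma mollify_integral_nonneg:
  fixes f :: "'a::euclidean_space \<Rightarrow> real"
  assumes f: "integrable lborel f" and nonneg: "\<And>z. f z \<ge> 0"
  shows "integrable lborel (mollify k f)" "(LINT z|lborel. mollify k f z) = (LINT z|lborel. f z)"
proof -
  have [measurable]: "f \<in> borel_measurable borel"
    using borel_measurable_integrable[OF f] by simp
  have "(\<integral>\<^sup>+z. ennreal (mollify k f z) \<partial>lborel)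
      = (\<integral>\<^sup>+z. (\<integral>\<^sup>+y. ennreal (moll k (z - y) * f y) \<partial>lborel) \<partial>lborel)"
    unfolding conv_def
    by (intro nn_integral_cong nn_integral_eq_integral[symmetric] conv_moll_integrable f AE_I2)
      (simp add: moll_nonneg nonneg)
  also have "\<dots> = (\<integral>\<^sup>+y. (\<integral>\<^sup>+z. ennreal (moll k (z - y) * f y) \<partial>lborel) \<partial>lborel)"
    by (rule lborel_pair.Fubini') measurable
  also have "\<dots> = (\<integral>\<^sup>+y. ennreal (f y) \<partial>lborel)"
  proof (rule nn_integral_cong)
    fix y :: 'a
    have tr: "integrable lborel (\<lambda>z. moll k (z - y))" "(LINT z|lborel. moll k (z - y)) = 1"
      using lborel_translate[OF moll_borel, of k "- y"] moll_integrable[of k, where 'a = 'a]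
        moll_integral[of k, where 'a = 'a] by auto
    have "(\<integral>\<^sup>+z. ennreal (moll k (z - y) * f y) \<partial>lborel) = ennreal (LINT z|lborel. moll k (z - y) * f y)"
      using tr by (intro nn_integral_eq_integral AE_I2) (auto simp: moll_nonneg nonneg)
    then show "(\<integral>\<^sup>+z. ennreal (moll k (z - y) * f y) \<partial>lborel) = ennreal (f y)"
      using tr by simp
  qed
  also have "\<dots> = ennreal (LINT z|lborel. f z)"
    by (intro nn_integral_eq_integral f AE_I2 nonneg)
  finally have *: "(\<integral>\<^sup>+z. ennreal (mollify k f z) \<partial>lborel) = ennreal (LINT z|lborel. f z)" .
  show i: "integrable lborel (mollify k f)"
    using mollify_borel[OF f, of k] mollify_nonneg[of f, OF nonneg]
    by (intro integrableI_nn_integral_finite[OF _ _ *]) auto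
  have "ennreal (LINT z|lborel. mollify k f z) = ennreal (LINT z|lborel. f z)"
    using nn_integral_eq_integral[OF i AE_I2[OF mollify_nonneg[of f, OF nonneg]]] * by simp
  then show "(LINT z|lborel. mollify k f z) = (LINT z|lborel. f z)"
    by (subst (asm) ennreal_inj) (auto intro!: integral_nonneg_AE AE_I2 mollify_nonneg nonneg)
qed

lemma mollify_integrable:
  fixes f :: "'a::euclidean_space \<Rightarrow> real"
  assumes f: "integrable lborel f"
  shows "integrable lborel (mollify k f)" "(LINT z|lborel. \<bar>mollify k f z\<bar>) \<le> (LINT z|lborel. \<bar>f z\<bar>)"
proof -
  have *: "integrable lborel (mollify k (\<lambda>z. \<bar>f z\<bar>))"
    "(LINT z|lborel. mollify k (\<lambda>z. \<bar>f z\<bar>) z) = (LINT z|lborel. \<bar>f z\<bar>)"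
    using mollify_integral_nonneg[of "\<lambda>z. \<bar>f z\<bar>" k] f by auto
  show i: "integrable lborel (mollify k f)"
    by (rule Bochner_Integration.integrable_bound[OF *(1)])
      (use mollify_borel[OF f, of k] abs_mollify_le[of k f] in \<open>auto intro!: AE_I2 order_trans[OF _ abs_ge_self]\<close>)
  have "(LINT z|lborel. \<bar>mollify k f z\<bar>) \<le> (LINT z|lborel. mollify k (\<lambda>z. \<bar>f z\<bar>) z)"
    by (rule integral_mono[OF integrable_abs[OF i] *(1)]) (rule abs_mollify_le)
  then show "(LINT z|lborel. \<bar>mollify k f z\<bar>) \<le> (LINT z|lborel. \<bar>f z\<bar>)"
    using *(2) by simp
qed

text \<open>Jensen's inequality for the probability density \<open>moll k (z - y)\<close>: the
  tangent of the power at the mean \<open>m\<close> of \<open>\<bar>f\<bar>\<close> is integrated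
  against it, and its linear part drops out. The tangent requires \<open>m > 0\<close>; for
  \<open>m = 0\<close> the left-hand side is 0.\<close>

lemma mollify_jensen:
  fixes f :: "'a::euclidean_space \<Rightarrow> real"
  assumes s: "s > 1" and f: "integrable lborel f" "integrable lborel (\<lambda>z. \<bar>f z\<bar> powr s)"
  shows "\<bar>mollify k f z\<bar> powr s \<le> mollify k (\<lambda>z. \<bar>f z\<bar> powr s) z"
proof -
  define m where "m = mollify k (\<lambda>z. \<bar>f z\<bar>) z"
  have m0: "m \<ge> 0"
    unfolding m_def by (rule mollify_nonneg) simp
  have le: "\<bar>mollify k f z\<bar> powr s \<le> m powr s"
    using abs_mollify_le[of k f z] s unfolding m_def by (intro powr_mono2) auto
  show ?thesis
  proof (cases "m = 0")
    case True
    then show ?thesis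
      using le s by (intro order_trans[OF le]) (auto intro!: mollify_nonneg)
  next
    case False
    with m0 have m: "m > 0" by simp
    have ia: "integrable lborel (\<lambda>z. \<bar>f z\<bar>)" using f(1) by simp
    let ?c = "m powr s - s * m powr (s - 1) * m"
    have "m powr s = (LINT y|lborel. ?c * moll k (z - y) + s * m powr (s - 1) * (moll k (z - y) * \<bar>f y\<bar>))"
      using moll_integral_shift[of k z] conv_moll_integrable[OF ia, of k z]
      by (simp add: m_def[unfolded conv_def, symmetric])
    also have "\<dots> \<le> (LINT y|lborel. moll k (z - y) * \<bar>f y\<bar> powr s)"
    proof (rule integral_mono)
      show "integrable lborel (\<lambda>y. ?c * moll k (z - y) + s * m powr (s - 1) * (moll k (z - y) * \<bar>f y\<bar>))"
        using moll_integral_shift[of k z] conv_moll_integrable[OF ia, of k z] by simp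
      show "integrable lborel (\<lambda>y. moll k (z - y) * \<bar>f y\<bar> powr s)"
        by (rule conv_moll_integrable[OF f(2)])
      fix y
      have "m powr s + s * m powr (s - 1) * (\<bar>f y\<bar> - m) \<le> \<bar>f y\<bar> powr s"
        using powr_above_tangent[OF s m, of "\<bar>f y\<bar>"] by (cases "\<bar>f y\<bar> = m") auto
      then have "moll k (z - y) * (m powr s + s * m powr (s - 1) * (\<bar>f y\<bar> - m)) \<le> moll k (z - y) * \<bar>f y\<bar> powr s"
        by (rule mult_left_mono) (rule moll_nonneg)
      then show "?c * moll k (z - y) + s * m powr (s - 1) * (moll k (z - y) * \<bar>f y\<bar>) \<le> moll k (z - y) * \<bar>f y\<bar> powr s"
        by (simp add: algebra_simps)
    qed
    finally show ?thesis
      using le by (simp add: conv_def)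
  qed
qed

lemma mollify_tendsto_continuous:
  fixes g :: "'a::euclidean_space \<Rightarrow> real"
  assumes g: "continuous_on UNIV g" and gi: "integrable lborel g"
  shows "(\<lambda>k. mollify k g z) \<longlonglongrightarrow> g z"
proof (rule LIMSEQ_I)
  fix e :: real assume e: "e > 0"
  obtain d where d: "d > 0" "\<And>y. dist y z < d \<Longrightarrow> dist (g y) (g z) < e / 2"
    using g e unfolding continuous_on_iff by (metis UNIV_I half_gt_zero)
  obtain N where N: "1 / real (Suc N) < d"
    using d(1) reals_Archimedean by (auto simp: inverse_eq_divide)
  have "norm (mollify k g z - g z) < e" if "k \<ge> N" for k
  proof -
    have kd: "1 / real (Suc k) < d"
      using N that by (auto intro: order.strict_trans1[OF _ N] simp: frac_le)
    have i: "integrable lborel (\<lambda>y. moll k (z - y) * g y)" "integrable lborel (\<lambda>y. g z * moll k (z - y))"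
      using conv_moll_integrable[OF gi] moll_integral_shift[of k z] by auto
    have "mollify k g z - g z = (LINT y|lborel. moll k (z - y) * g y - g z * moll k (z - y))"
      using i moll_integral_shift[of k z] by (simp add: conv_def)
    also have "\<bar>\<dots>\<bar> \<le> (LINT y|lborel. \<bar>moll k (z - y) * g y - g z * moll k (z - y)\<bar>)"
      by (rule integral_abs_bound)
    also have "\<dots> \<le> (LINT y|lborel. e / 2 * moll k (z - y))"
    proof (rule integral_mono)
      fix y
      show "\<bar>moll k (z - y) * g y - g z * moll k (z - y)\<bar> \<le> e / 2 * moll k (z - y)"
      proof (cases "norm (z - y) < 1 / real (Suc k)")
        case True
        then have "\<bar>g y - g z\<bar> \<le> e / 2"
          using d(2)[of y] kd by (auto simp: dist_norm norm_minus_commute)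
        then have "moll k (z - y) * \<bar>g y - g z\<bar> \<le> moll k (z - y) * (e / 2)"
          by (rule mult_left_mono) (rule moll_nonneg)
        moreover have "moll k (z - y) * g y - g z * moll k (z - y) = moll k (z - y) * (g y - g z)"
          by (simp add: algebra_simps)
        ultimately show ?thesis
          by (simp only: abs_mult abs_of_nonneg[OF moll_nonneg] mult.commute)
      next
        case False
        then have "moll k (z - y) = 0"
          by (intro moll_eq_0) auto
        then show ?thesis by simp
      qed
    qed (use i moll_integral_shift[of k z] in auto)
    also have "\<dots> = e / 2"
      using moll_integral_shift[of k z] by simp
    finally show ?thesis using e by simp
  qed
  then show "\<exists>N. \<forall>k\<ge>N. norm (mollify k g z - g z) < e" by blast
qed

section \<open>Convergence of mollifications in L1 and almost everywhere\<close>

definition clip :: "real \<Rightarrow> real \<Rightarrow> real" where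
  "clip N x = max (- N) (min N x)"

definition cutoff :: "real \<Rightarrow> 'a::real_normed_vector \<Rightarrow> real" where
  "cutoff N z = max 0 (min 1 (N + 1 - norm z))"

text \<open>Truncating values and support of \<open>f\<close> costs little in L1 and gives a bounded
  \<open>h n\<close>. Continuous functions that converge to \<open>f\<close> almost everywhere,
  truncated in the same way, then converge to \<open>h n\<close> under a fixed integrable
  majorant.\<close>

lemma integrable_approx_continuous:
  fixes f :: "'a::euclidean_space \<Rightarrow> real"
  assumes f: "integrable lborel f" and e: "e > 0"
  obtains g R where "continuous_on UNIV g" "integrable lborel g" "\<And>z. norm z > R \<Longrightarrow> g z = 0"
    "(LINT z|lborel. \<bar>f z - g z\<bar>) < e"
proof -
  have fm[measurable]: "f \<in> borel_measurable borel"
    using borel_measurable_integrable[OF f] by simp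
  have cut: "continuous_on UNIV (cutoff N :: 'a \<Rightarrow> real)" for N
    unfolding cutoff_def by (intro continuous_intros)
  then have cutm[measurable]: "(cutoff N :: 'a \<Rightarrow> real) \<in> borel_measurable borel" for N
    by (rule borel_measurable_continuous_onI)
  have cut01: "0 \<le> cutoff N z" "cutoff N z \<le> 1" for N and z :: 'a
    by (auto simp: cutoff_def)
  have cut0: "cutoff N z = 0" if "norm z > N + 1" for N and z :: 'a
    using that by (simp add: cutoff_def)
  have clipm[measurable]: "clip N \<in> borel_measurable borel" for N
    unfolding clip_def by (intro borel_measurable_max borel_measurable_min borel_measurable_const measurable_ident_sets) simp
  have clip_le: "\<bar>clip N x\<bar> \<le> N" "\<bar>clip N x\<bar> \<le> \<bar>x\<bar>" if "N \<ge> 0" for N x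
    using that by (auto simp: clip_def max_def min_def)
  define h where "h n z = clip (real n) (f z) * cutoff (real n) z" for n z
  have hm[measurable]: "h n \<in> borel_measurable lborel" for n
    unfolding h_def by simp
  have h_le: "\<bar>h n z\<bar> \<le> \<bar>f z\<bar>" "\<bar>h n z\<bar> \<le> real n" for n z
    using mult_mono[OF clip_le(2)[of n "f z"] cut01(2)[of n z]] mult_mono[OF clip_le(1)[of n "f z"] cut01(2)[of n z]] cut01(1)[of n z]
    by (auto simp: h_def abs_mult)
  have "(\<lambda>n. h n z) \<longlonglongrightarrow> f z" for z
  proof (rule tendsto_eventually)
    obtain M :: nat where M: "real M \<ge> \<bar>f z\<bar> + norm z"
      using real_arch_simple by blast
    have "h n z = f z" if "n \<ge> M" for n
    proof -
      have "real n \<ge> \<bar>f z\<bar> + norm z" using M that by (meson of_nat_le_iff order_trans)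
      then have "- real n \<le> f z" "f z \<le> real n" "norm z \<le> real n"
        using norm_ge_zero[of z] by linarith+
      then have "clip (real n) (f z) = f z" "cutoff (real n) z = 1"
        by (auto simp: clip_def cutoff_def)
      then show ?thesis by (simp add: h_def)
    qed
    then show "eventually (\<lambda>n. h n z = f z) sequentially"
      by (auto simp: eventually_sequentially)
  qed
  then have lim: "(\<lambda>n. \<bar>f z - h n z\<bar>) \<longlonglongrightarrow> 0" for z
    using tendsto_rabs_zero[OF LIM_zero] by (force simp: tendsto_rabs_zero_iff abs_minus_commute LIM_zero_iff)
  have b: "norm \<bar>f z - h n z\<bar> \<le> 2 * \<bar>f z\<bar>" for n z
    using h_le(1)[of n z] by simp
  have "(\<lambda>n. LINT z|lborel. \<bar>f z - h n z\<bar>) \<longlonglongrightarrow> (LINT z::'a|lborel. (0::real))"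
    by (rule integral_dominated_convergence[OF _ _ _ AE_I2[OF lim] AE_I2[OF b]]) (use f in auto)
  then have "eventually (\<lambda>n. (LINT z|lborel. \<bar>f z - h n z\<bar>) < e / 2) sequentially"
    by (rule order_tendstoD(2)) (use e in simp)
  then obtain n where n: "(LINT z|lborel. \<bar>f z - h n z\<bar>) < e / 2"
    by (auto simp: eventually_sequentially)
  have hi: "integrable lborel (h n)"
    by (rule Bochner_Integration.integrable_bound[OF f]) (use h_le in \<open>auto intro!: AE_I2\<close>)
  have "f measurable_on UNIV"
    by (rule lebesgue_measurable_imp_measurable_on_real) (auto simp: measurable_completion)
  then obtain N G where N: "negligible N" and G: "\<And>j. continuous_on UNIV (G j)"
      "\<And>x. x \<notin> N \<Longrightarrow> (\<lambda>j. G j x) \<longlonglongrightarrow> f x"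
    unfolding measurable_on_def by auto
  define g where "g j z = clip (real n) (G j z) * cutoff (real n) z" for j z
  have gc: "continuous_on UNIV (g j)" for j
    unfolding g_def clip_def by (intro continuous_intros G cut)
  have gm: "g j \<in> borel_measurable borel" for j
    using borel_measurable_continuous_onI[OF gc] .
  have g_le: "\<bar>g j z\<bar> \<le> real n" for j z
    using mult_mono[OF clip_le(1)[of n "G j z"] cut01(2)[of n z]] cut01(1)[of n z]
    by (auto simp: g_def abs_mult)
  have g0: "g j z = 0" if "norm z > real n + 1" for j z
    using cut0[OF that] by (simp add: g_def)
  have gi: "integrable lborel (g j)" for j
    by (rule integrable_bounded_support[OF gm g_le bounded_cball[of 0 "real n + 1"]]) (auto intro: g0)
  have limg: "(\<lambda>j. \<bar>h n z - g j z\<bar>) \<longlonglongrightarrow> 0" if "z \<notin> N" for z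
  proof -
    have "(\<lambda>j. g j z) \<longlonglongrightarrow> h n z"
      unfolding g_def h_def clip_def by (intro tendsto_intros G that)
    then show ?thesis
      using tendsto_diff[OF tendsto_const, of _ "h n z" sequentially "h n z"] by (auto intro!: tendsto_rabs_zero)
  qed
  have aeN: "AE z in lborel. z \<notin> N"
    using AE_not_in[of N lebesgue] N by (simp only: negligible_iff_null_sets AE_completion_iff)
  define w :: "'a \<Rightarrow> real" where "w z = 2 * real n * indicator (cball 0 (real n + 1)) z" for z
  have w: "integrable lborel w"
    unfolding w_def
    by (rule integrable_bounded_support[where C = "2 * real n" and S = "cball 0 (real n + 1)"])
      (auto simp: indicator_def)
  have bg: "norm \<bar>h n z - g j z\<bar> \<le> w z" for j z
  proof (cases "norm z > real n + 1")
    case True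
    then show ?thesis using g0[OF True] cut0[OF True] by (simp add: h_def w_def)
  next
    case False
    then show ?thesis using h_le(2)[of n z] g_le[of j z] by (simp add: w_def)
  qed
  have "(\<lambda>j. LINT z|lborel. \<bar>h n z - g j z\<bar>) \<longlonglongrightarrow> (LINT z::'a|lborel. (0::real))"
    by (rule integral_dominated_convergence[OF _ _ w _ AE_I2[OF bg]])
      (use gm aeN limg in \<open>auto elim!: eventually_mono\<close>)
  then have "eventually (\<lambda>j. (LINT z|lborel. \<bar>h n z - g j z\<bar>) < e / 2) sequentially"
    by (rule order_tendstoD(2)) (use e in simp)
  then obtain j where j: "(LINT z|lborel. \<bar>h n z - g j z\<bar>) < e / 2"
    by (auto simp: eventually_sequentially)
  have "(LINT z|lborel. \<bar>f z - g j z\<bar>) \<le> (LINT z|lborel. \<bar>f z - h n z\<bar> + \<bar>h n z - g j z\<bar>)"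
    by (rule integral_mono) (use f hi gi in auto)
  also have "\<dots> = (LINT z|lborel. \<bar>f z - h n z\<bar>) + (LINT z|lborel. \<bar>h n z - g j z\<bar>)"
    by (rule Bochner_Integration.integral_add) (use f hi gi in auto)
  also have "\<dots> < e"
    using n j by simp
  finally show ?thesis
    using that[OF gc gi g0] by blast
qed

text \<open>Mollification does not increase the L1 norm, so the claim reduces to a nearby continuous
  \<open>g\<close> of bounded support, for which pointwise convergence is dominated.\<close>

lemma mollify_tendsto_L1:
  fixes f :: "'a::euclidean_space \<Rightarrow> real"
  assumes f: "integrable lborel f"
  shows "(\<lambda>k. LINT z|lborel. \<bar>mollify k f z - f z\<bar>) \<longlonglongrightarrow> 0"
proof (rule LIMSEQ_I)
  fix e :: real assume e: "e > 0"
  obtain g R where gc: "continuous_on UNIV g" and gi: "integrable lborel g" and g0: "\<And>z. norm z > R \<Longrightarrow> g z = 0"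
    and fg: "(LINT z|lborel. \<bar>f z - g z\<bar>) < e / 3"
    using integrable_approx_continuous[OF f, of "e / 3"] e by auto
  obtain C where C: "C \<ge> 0" "\<And>z. \<bar>g z\<bar> \<le> C"
    by (rule continuous_compact_support_bounded[OF gc compact_cball[of 0 R]]) (auto intro: g0)
  have mg: "\<bar>mollify k g z\<bar> \<le> C" for k z
  proof -
    have "\<bar>mollify k g z\<bar> \<le> (LINT y|lborel. moll k (z - y) * \<bar>g y\<bar>)"
      using abs_mollify_le[of k g z] by (simp add: conv_def)
    also have "\<dots> \<le> (LINT y|lborel. C * moll k (z - y))"
      using conv_moll_integrable[of "\<lambda>z. \<bar>g z\<bar>" k z] gi moll_integral_shift[of k z] C(2)
      by (intro integral_mono) (auto simp: mult.commute[of C] intro!: mult_left_mono moll_nonneg)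
    finally show ?thesis using moll_integral_shift[of k z] by simp
  qed
  have mg0: "mollify k g z = 0" if "norm z > R + 1" for k z
  proof -
    have *: "moll k (z - y) * g y = 0" for y
    proof (cases "norm y > R")
      case False
      have "1 / real (Suc k) \<le> 1" by simp
      also have "1 \<le> norm (z - y)"
        using False that norm_triangle_ineq2[of z y] by simp
      finally show ?thesis by (simp add: moll_eq_0 del: of_nat_Suc)
    qed (simp add: g0)
    then show ?thesis by (simp only: conv_def *) simp
  qed
  define w :: "'a \<Rightarrow> real" where "w z = 2 * C * indicator (cball 0 (R + 1)) z" for z
  have w: "integrable lborel w"
    unfolding w_def
    by (rule integrable_bounded_support[where C = "2 * C" and S = "cball 0 (R + 1)"])
      (use C in \<open>auto simp: indicator_def\<close>)
  have b: "norm \<bar>mollify k g z - g z\<bar> \<le> w z" for k z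
  proof (cases "norm z > R + 1")
    case True
    then show ?thesis using g0[of z] mg0[OF True] by (simp add: w_def)
  next
    case False
    then show ?thesis using mg[of k z] C(2)[of z] by (simp add: w_def)
  qed
  have lim: "(\<lambda>k. \<bar>mollify k g z - g z\<bar>) \<longlonglongrightarrow> 0" for z
    using mollify_tendsto_continuous[OF gc gi, of z] by (auto intro!: tendsto_rabs_zero LIM_zero)
  have m: "(\<lambda>z. \<bar>mollify k g z - g z\<bar>) \<in> borel_measurable lborel" for k
    using mollify_borel[OF gi, of k] borel_measurable_continuous_onI[OF gc] by simp
  have "(\<lambda>k. LINT z|lborel. \<bar>mollify k g z - g z\<bar>) \<longlonglongrightarrow> (LINT z::'a|lborel. (0::real))"
    by (rule integral_dominated_convergence[OF _ m w AE_I2[OF lim] AE_I2[OF b]]) simp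
  then have "eventually (\<lambda>k. (LINT z|lborel. \<bar>mollify k g z - g z\<bar>) < e / 3) sequentially"
    by (rule order_tendstoD(2)) (use e in simp)
  then obtain N where N: "\<And>k. k \<ge> N \<Longrightarrow> (LINT z|lborel. \<bar>mollify k g z - g z\<bar>) < e / 3"
    by (auto simp: eventually_sequentially)
  have "norm ((LINT z|lborel. \<bar>mollify k f z - f z\<bar>) - 0) < e" if "k \<ge> N" for k
  proof -
    let ?d = "\<lambda>z. f z - g z"
    have di: "integrable lborel ?d" using f gi by simp
    have i: "integrable lborel (\<lambda>z. \<bar>mollify k ?d z\<bar>)" "integrable lborel (\<lambda>z. \<bar>mollify k g z - g z\<bar>)"
      "integrable lborel (\<lambda>z. \<bar>f z - g z\<bar>)" "integrable lborel (\<lambda>z. \<bar>mollify k f z - f z\<bar>)"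
      using mollify_integrable(1)[OF di] mollify_integrable(1)[OF gi] mollify_integrable(1)[OF f] f gi by auto
    have "(LINT z|lborel. \<bar>mollify k f z - f z\<bar>)
        \<le> (LINT z|lborel. \<bar>mollify k ?d z\<bar> + \<bar>mollify k g z - g z\<bar> + \<bar>f z - g z\<bar>)"
      by (rule integral_mono) (use i in \<open>auto simp: mollify_diff[OF f gi]\<close>)
    also have "\<dots> = (LINT z|lborel. \<bar>mollify k ?d z\<bar>) + (LINT z|lborel. \<bar>mollify k g z - g z\<bar>) + (LINT z|lborel. \<bar>f z - g z\<bar>)"
      using i by simp
    also have "\<dots> < e"
      using mollify_integrable(2)[OF di, of k] N[OF that] fg by simp
    finally show ?thesis
      by (simp add: abs_of_nonneg integral_nonneg_AE)
  qed
  then show "\<exists>N. \<forall>k\<ge>N. norm ((LINT z|lborel. \<bar>mollify k f z - f z\<bar>) - 0) < e" by blast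
qed

text \<open>L1 convergence yields almost everywhere convergence along a subsequence; thinning once
  per function provides one subsequence for the whole finite family.\<close>

lemma mollify_AE_subseq:
  fixes F :: "('a::euclidean_space \<Rightarrow> real) set"
  assumes "finite F" "\<And>f. f \<in> F \<Longrightarrow> integrable lborel f"
  shows "\<exists>r. strict_mono r \<and> (\<forall>f\<in>F. AE z in lborel. (\<lambda>k. mollify (r k) f z) \<longlonglongrightarrow> f z)"
  using assms
proof (induction F rule: finite_induct)
  case empty
  then show ?case using strict_mono_id by auto
next
  case (insert f F)
  obtain r where r: "strict_mono r" "\<And>g. g \<in> F \<Longrightarrow> AE z in lborel. (\<lambda>k. mollify (r k) g z) \<longlonglongrightarrow> g z"
    using insert by auto
  have f: "integrable lborel f" using insert by auto
  have "(\<lambda>k. LINT z|lborel. norm (mollify (r k) f z - f z)) \<longlonglongrightarrow> 0"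
    using LIMSEQ_subseq_LIMSEQ[OF mollify_tendsto_L1[OF f] r(1)] by (simp add: o_def)
  moreover have "integrable lborel (\<lambda>z. mollify (r k) f z - f z)" for k
    using mollify_integrable(1)[OF f] f by simp
  ultimately obtain q where q: "strict_mono q" "AE z in lborel. (\<lambda>k. mollify (r (q k)) f z - f z) \<longlonglongrightarrow> 0"
    using tendsto_L1_AE_subseq[of lborel "\<lambda>k z. mollify (r k) f z - f z"] by auto
  have "AE z in lborel. (\<lambda>k. mollify ((r \<circ> q) k) g z) \<longlonglongrightarrow> g z" if "g \<in> insert f F" for g
  proof (cases "g = f")
    case True
    then show ?thesis
      using q(2) by (auto simp: LIM_zero_iff o_def)
  next
    case False
    then have "AE z in lborel. (\<lambda>k. mollify (r k) g z) \<longlonglongrightarrow> g z"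
      using r(2) that by blast
    then show ?thesis
      by (rule AE_mp) (auto intro!: AE_I2 dest: LIMSEQ_subseq_LIMSEQ[OF _ q(1)] simp: o_def)
  qed
  then show ?case
    using strict_mono_o[OF r(1) q(1)] by blast
qed

section \<open>Explicit solutions with linear flux\<close>

text \<open>The gradient of \<open>norm x powr l\<close>. For \<open>l < 2\<close> the scalar factor
  is unbounded near the origin; at the origin the factor \<open>x\<close> yields the correct value
  0.\<close>

definition grad_norm_powr :: "real \<Rightarrow> 'a::real_inner \<Rightarrow> 'a" where
  "grad_norm_powr l x = (l * norm x powr (l - 2)) *\<^sub>R x"

lemma norm_grad_norm_powr: "l > 1 \<Longrightarrow> norm (grad_norm_powr l x) = l * norm x powr (l - 1)"
  by (cases "x = 0") (auto simp: grad_norm_powr_def powr_mult_base[symmetric] powr_diff field_simps power2_eq_square)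

text \<open>Away from the origin the chain rule applies to
  \<open>(x \<bullet> x) powr (l / 2)\<close>. At the origin the difference quotient is
  \<open>norm h powr (l - 1)\<close>, which tends to 0 because \<open>l > 1\<close>.\<close>

lemma norm_powr_has_derivative:
  fixes x :: "'a::real_inner"
  assumes l: "l > 1"
  shows "((\<lambda>x. norm x powr l) has_derivative (\<lambda>v. grad_norm_powr l x \<bullet> v)) (at x)"
proof (cases "x = 0")
  case True
  have "((\<lambda>h::'a. norm h powr (l - 1)) \<longlongrightarrow> 0 powr (l - 1)) (at 0)"
    using l by (intro tendsto_powr' tendsto_norm_zero tendsto_const tendsto_ident_at) (auto simp: eventually_at_filter)
  moreover have "eventually (\<lambda>h::'a. norm h powr (l - 1) = norm (norm h powr l) / norm h) (at 0)"
    by (rule eventually_at_filter[THEN iffD2]) (auto intro!: always_eventually simp: powr_diff)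
  ultimately have "((\<lambda>h::'a. norm (norm h powr l) / norm h) \<longlongrightarrow> 0) (at 0)"
    by (simp add: filterlim_cong)
  then show ?thesis
    using True by (simp add: has_derivative_iff_norm grad_norm_powr_def)
next
  case False
  have "((\<lambda>x. x \<bullet> x) has_derivative (\<lambda>v. x \<bullet> v + v \<bullet> x)) (at x)"
    by (intro has_derivative_inner has_derivative_ident)
  moreover have "((\<lambda>s. s powr (l / 2)) has_derivative (\<lambda>r. (l / 2) * (x \<bullet> x) powr (l / 2 - 1) * r)) (at (x \<bullet> x))"
    by (rule has_derivative_eq_rhs[OF has_real_derivative_powr[unfolded has_field_derivative_def]])
      (use False in \<open>auto simp: fun_eq_iff\<close>)
  ultimately have D: "((\<lambda>x. (x \<bullet> x) powr (l / 2)) has_derivative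
      (\<lambda>v. (l / 2) * (x \<bullet> x) powr (l / 2 - 1) * (x \<bullet> v + v \<bullet> x))) (at x)"
    by (rule has_derivative_compose)
  have eq: "(x \<bullet> x) powr s = norm x powr (2 * s)" for s and x :: 'a
  proof (cases "x = 0")
    case False
    then have "x \<bullet> x = norm x powr 2"
      by (simp add: power2_norm_eq_inner)
    then show ?thesis by (simp only: powr_powr)
  qed simp
  have "(\<lambda>v. (l / 2) * (x \<bullet> x) powr (l / 2 - 1) * (x \<bullet> v + v \<bullet> x)) = (\<lambda>v. grad_norm_powr l x \<bullet> v)"
    unfolding eq by (simp add: fun_eq_iff grad_norm_powr_def inner_commute right_diff_distrib)
  then show ?thesis
    using D unfolding eq by simp
qed

lemma continuous_grad_norm_powr:
  assumes l: "l > 1"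
  shows "continuous_on UNIV (grad_norm_powr l :: 'a::real_inner \<Rightarrow> 'a)"
proof (rule continuous_at_imp_continuous_on, rule ballI)
  fix x :: 'a
  show "isCont (grad_norm_powr l) x"
  proof (cases "x = 0")
    case True
    have "((\<lambda>h::'a. norm h powr (l - 1)) \<longlongrightarrow> 0 powr (l - 1)) (at 0)"
      using l by (intro tendsto_powr' tendsto_norm_zero tendsto_const tendsto_ident_at) (auto simp: eventually_at_filter)
    then have "((\<lambda>h::'a. l * norm h powr (l - 1)) \<longlongrightarrow> l * 0 powr (l - 1)) (at 0)"
      by (rule tendsto_mult_left)
    then have "((\<lambda>h::'a. norm (grad_norm_powr l h)) \<longlongrightarrow> 0) (at 0)"
      using norm_grad_norm_powr[OF l, where 'a = 'a] by simp
    then have "(grad_norm_powr l \<longlongrightarrow> (0 :: 'a)) (at 0)"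
      by (rule tendsto_norm_zero_cancel)
    then show ?thesis
      using True by (simp add: isCont_def grad_norm_powr_def[of l 0])
  next
    case False
    then show ?thesis
      unfolding grad_norm_powr_def by (intro continuous_intros) auto
  qed
qed

lemma flux_norm_powr:
  fixes x :: "'a::real_inner"
  assumes p: "p > 2" and l: "l = p / (p - 1)" and a: "a > 0"
  shows "norm (a *\<^sub>R grad_norm_powr l x) powr (p - 2) *\<^sub>R (a *\<^sub>R grad_norm_powr l x) = (a * l) powr (p - 1) *\<^sub>R x"
proof (cases "x = 0")
  case True
  then show ?thesis by (simp add: grad_norm_powr_def)
next
  case False
  have l1: "l > 1" using p by (simp add: l less_divide_eq)
  \<comment> \<open>Equivalent to \<open>(l - 1) * (p - 1) = 1\<close>, the relation that singles
    out the exponent \<open>l\<close>: all powers of \<open>norm x\<close> cancel and the flux is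
    linear.\<close>
  have e: "(l - 1) * (p - 2) + (l - 2) = 0"
    using p by (simp add: l field_simps)
  have "norm (a *\<^sub>R grad_norm_powr l x) powr (p - 2) = (a * l) powr (p - 2) * norm x powr ((l - 1) * (p - 2))"
    using a l1 by (simp add: norm_grad_norm_powr powr_mult powr_powr mult.assoc[symmetric])
  moreover have "(a * l) powr (p - 2) * (a * l) = (a * l) powr (p - 1)"
    using a l1 powr_mult_base[of "a * l" "p - 2"] by (simp add: mult.commute)
  moreover have "norm x powr ((l - 1) * (p - 2)) * norm x powr (l - 2) = 1"
    using False e by (simp add: powr_add[symmetric])
  ultimately have "norm (a *\<^sub>R grad_norm_powr l x) powr (p - 2) * (a * (l * norm x powr (l - 2))) = (a * l) powr (p - 1)"
    by (metis (no_types, lifting) mult.assoc mult.commute mult.right_neutral)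
  then show ?thesis
    by (simp add: grad_norm_powr_def)
qed

section \<open>Test functions and integration by parts against them\<close>

lemma test_functionD:
  assumes "test_function V \<phi>"
  shows "has_dir_deriv v \<phi> (\<lambda>z. frechet_derivative \<phi> (at z) v)"
    and "b \<in> Basis \<Longrightarrow> continuous_on UNIV (\<lambda>z. frechet_derivative \<phi> (at z) b)"
    and "continuous_on UNIV \<phi>" and "\<phi> differentiable (at z)"
    and "compact (closure {z. \<phi> z \<noteq> 0})" "closure {z. \<phi> z \<noteq> 0} \<subseteq> V"
    and "z \<notin> closure {z. \<phi> z \<noteq> 0} \<Longrightarrow> \<phi> z = 0"
    and "z \<notin> closure {z. \<phi> z \<noteq> 0} \<Longrightarrow> frechet_derivative \<phi> (at z) v = 0"
proof -
  have k: "C_k k \<phi>" for k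
    using assms by (simp add: test_function_def)
  show d: "\<phi> differentiable (at z)" for z
    using k[of 1] by simp
  show h: "has_dir_deriv v \<phi> (\<lambda>z. frechet_derivative \<phi> (at z) v)"
    using has_derivative_imp_has_dir_deriv[of \<phi> "\<lambda>z. frechet_derivative \<phi> (at z)"] d frechet_derivative_works by blast
  show "b \<in> Basis \<Longrightarrow> continuous_on UNIV (\<lambda>z. frechet_derivative \<phi> (at z) b)"
    using k[of 1] by simp
  show "continuous_on UNIV \<phi>"
    using k[of 0] by simp
  show "compact (closure {z. \<phi> z \<noteq> 0})" "closure {z. \<phi> z \<noteq> 0} \<subseteq> V"
    using assms by (auto simp: test_function_def compactly_in_def)
  show z: "z \<notin> closure {z. \<phi> z \<noteq> 0} \<Longrightarrow> \<phi> z = 0" for z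
    using closure_subset[of "{z. \<phi> z \<noteq> 0}"] by auto
  show "z \<notin> closure {z. \<phi> z \<noteq> 0} \<Longrightarrow> frechet_derivative \<phi> (at z) v = 0"
    by (rule has_dir_deriv_zero_outside[OF h closed_closure z])
qed

text \<open>Leads from the measure of the definitions to \<open>lborel\<close> on the whole space,
  where the translation argument is available.\<close>

lemma lint_lebesgue_on_eq:
  fixes f :: "'a::euclidean_space \<Rightarrow> 'b::{banach, second_countable_topology}"
  assumes "f \<in> borel_measurable borel" "open V" "\<And>z. z \<notin> V \<Longrightarrow> f z = 0"
  shows "(LINT z|lebesgue_on V. f z) = (LINT z|lborel. f z)"
proof -
  have "(LINT z|lebesgue_on V. f z) = (LINT z|lebesgue. indicator V z *\<^sub>R f z)"
    using assms(2) by (intro integral_restrict_space) (auto simp: borel_open)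
  also have "(\<lambda>z. indicator V z *\<^sub>R f z) = f"
    using assms(3) by (auto simp: indicator_def fun_eq_iff)
  also have "(LINT z|lebesgue. f z) = (LINT z|lborel. f z)"
    using assms(1) by (intro integral_completion) auto
  finally show ?thesis .
qed

lemma test_function_ibp:
  fixes u u' \<phi> :: "'a::euclidean_space \<Rightarrow> real"
  assumes \<phi>: "test_function V \<phi>" and b: "b \<in> Basis"
    and u: "has_dir_deriv b u u'" "continuous_on UNIV u" "continuous_on UNIV u'"
  shows "integrable lborel (\<lambda>z. u z * frechet_derivative \<phi> (at z) b)" "integrable lborel (\<lambda>z. u' z * \<phi> z)"
    "(LINT z|lborel. u z * frechet_derivative \<phi> (at z) b) = - (LINT z|lborel. u' z * \<phi> z)"
proof -
  note i = integration_by_parts_dir[OF u test_functionD(1)[OF \<phi>] test_functionD(3)[OF \<phi>]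
        test_functionD(2)[OF \<phi> b] test_functionD(5)[OF \<phi>] test_functionD(7)[OF \<phi>]]
  show "integrable lborel (\<lambda>z. u z * frechet_derivative \<phi> (at z) b)" by (rule i(1))
  show "integrable lborel (\<lambda>z. u' z * \<phi> z)" by (rule i(2))
  show "(LINT z|lborel. u z * frechet_derivative \<phi> (at z) b) = - (LINT z|lborel. u' z * \<phi> z)" by (rule i(3))
qed

lemma grad_inner: "b \<in> Basis \<Longrightarrow> grad f x \<bullet> b = frechet_derivative f (at x) b"
  unfolding grad_def by (simp add: inner_sum_left inner_Basis if_distrib cong: if_cong)

lemma grad_x_inner:
  assumes "\<phi> differentiable (at z)" "b \<in> Basis"
  shows "grad_x \<phi> z \<bullet> b = frechet_derivative \<phi> (at z) (b, 0)"
proof -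
  have "((\<lambda>x. (x, snd z)) has_derivative (\<lambda>v. (v, 0))) (at (fst z))"
    by (auto intro!: derivative_eq_intros)
  then have D: "((\<lambda>x. \<phi> (x, snd z)) has_derivative (\<lambda>v. frechet_derivative \<phi> (at z) (v, 0))) (at (fst z))"
    by (rule has_derivative_compose) (use assms(1) in \<open>simp add: frechet_derivative_works\<close>)
  then show ?thesis
    by (simp add: grad_x_def grad_inner[OF assms(2)] frechet_derivative_at[OF D, symmetric])
qed

lemma deriv_t_eq:
  assumes "\<phi> differentiable (at z)"
  shows "deriv_t \<phi> z = frechet_derivative \<phi> (at z) (0, 1)"
proof -
  have "((\<lambda>t. (fst z, t)) has_derivative (\<lambda>s. (0, s))) (at (snd z))"
    by (auto intro!: derivative_eq_intros)
  then have D: "((\<lambda>t. \<phi> (fst z, t)) has_derivative (\<lambda>s. frechet_derivative \<phi> (at z) (0, s))) (at (snd z))"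
    by (rule has_derivative_compose) (use assms in \<open>simp add: frechet_derivative_works\<close>)
  have "frechet_derivative \<phi> (at z) (0, s) = frechet_derivative \<phi> (at z) (0, 1) * s" for s
    using linear_scale[OF linear_frechet_derivative[OF assms], of s "(0, 1)"] by simp
  then have "(\<lambda>s. frechet_derivative \<phi> (at z) (0, s)) = (*) (frechet_derivative \<phi> (at z) (0, 1))"
    by (rule ext)
  with D have "((\<lambda>t. \<phi> (fst z, t)) has_real_derivative frechet_derivative \<phi> (at z) (0, 1)) (at (snd z))"
    unfolding has_field_derivative_def by (simp only:)
  then show ?thesis
    unfolding deriv_t_def by (rule DERIV_imp_deriv)
qed

lemma integrable_on_bounded_open:
  fixes f :: "'a::euclidean_space \<Rightarrow> 'b::{banach, second_countable_topology}"
  assumes V: "open V" "bounded V" and f: "f \<in> borel_measurable (lebesgue_on V)" "\<And>z. z \<in> V \<Longrightarrow> norm (f z) \<le> B"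
  shows "integrable (lebesgue_on V) f"
proof -
  interpret finite_measure "lebesgue_on V"
    by (intro finite_measure_lebesgue_on lmeasurable_open V)
  show ?thesis
    by (rule integrable_const_bound[of _ B]) (use f in auto)
qed

lemma continuous_bounded_on_bounded:
  fixes f :: "'a::euclidean_space \<Rightarrow> 'b::real_normed_vector"
  assumes "continuous_on UNIV f" "bounded V"
  obtains B where "B \<ge> 0" "\<And>z. z \<in> V \<Longrightarrow> norm (f z) \<le> B"
proof -
  have "bounded (f ` closure V)"
    using assms by (intro compact_imp_bounded compact_continuous_image continuous_on_subset[OF assms(1)])
      (auto simp: compact_eq_bounded_closed)
  then obtain B where B: "\<forall>z\<in>closure V. norm (f z) \<le> B"
    by (auto simp: bounded_iff)
  show ?thesis
    using B closure_subset[of V] by (intro that[of "max B 0"]) force+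
qed

lemma in_Lp_continuous:
  fixes f :: "'a::euclidean_space \<Rightarrow> 'b::euclidean_space"
  assumes f: "continuous_on UNIV f" and V: "open V" "bounded V" and q: "q \<ge> 0"
  shows "in_Lp q V f"
proof -
  obtain B where B: "B \<ge> 0" "\<And>z. z \<in> V \<Longrightarrow> norm (f z) \<le> B"
    using continuous_bounded_on_bounded[OF f V(2)] by blast
  have m: "f \<in> borel_measurable (lebesgue_on V)"
    using V by (intro continuous_imp_measurable_on_sets_lebesgue continuous_on_subset[OF f]) auto
  have "integrable (lebesgue_on V) (\<lambda>x. norm (f x) powr q)"
    by (rule integrable_on_bounded_open[OF V, of _ "B powr q"]) (use m B q in \<open>auto intro!: powr_mono2\<close>)
  with m show ?thesis by (simp add: in_Lp_def)
qed

lemma test_function_zero_outside: "test_function V \<phi> \<Longrightarrow> z \<notin> V \<Longrightarrow> \<phi> z = 0"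
  using test_functionD(6,7) by blast

lemma test_function_deriv_zero_outside: "test_function V \<phi> \<Longrightarrow> z \<notin> V \<Longrightarrow> frechet_derivative \<phi> (at z) v = 0"
  using test_functionD(6,8) by blast

lemma sobolev_with_grad_C1:
  fixes v :: "'a::euclidean_space \<Rightarrow> real"
  assumes v: "\<And>x. (v has_derivative (\<lambda>w. g x \<bullet> w)) (at x)" and g: "continuous_on UNIV g"
    and U: "open U" "bounded U" and p: "p \<ge> 0"
  shows "sobolev_with_grad p U v g"
  unfolding sobolev_with_grad_def
proof (intro conjI allI impI)
  have vc: "continuous_on UNIV v"
    by (intro continuous_at_imp_continuous_on ballI has_derivative_continuous[OF v])
  show "in_Lp p U v" "in_Lp p U g"
    by (rule in_Lp_continuous[OF vc U p], rule in_Lp_continuous[OF g U p])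
  fix \<phi> assume \<phi>: "test_function U \<phi>"
  define K where "K = closure {z. \<phi> z \<noteq> 0}"
  note \<phi>K = test_functionD(5-8)[OF \<phi>, folded K_def]
  have gradc: "continuous_on UNIV (grad \<phi>)"
    unfolding grad_def[abs_def] by (intro continuous_on_sum continuous_on_scaleR continuous_on_const test_functionD(2)[OF \<phi>])
  have grad0: "grad \<phi> x = 0" if "x \<notin> K" for x
    using \<phi>K(4)[OF that] by (simp add: grad_def)
  have c: "continuous_on UNIV (\<lambda>x. v x *\<^sub>R grad \<phi> x)" "continuous_on UNIV (\<lambda>x. \<phi> x *\<^sub>R g x)"
    by (intro continuous_on_scaleR vc gradc g test_functionD(3)[OF \<phi>])+
  have i1: "integrable lborel (\<lambda>x. v x *\<^sub>R grad \<phi> x)"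
    by (rule integrable_continuous_compact_support[OF c(1) \<phi>K(1)]) (simp add: grad0)
  have i2: "integrable lborel (\<lambda>x. \<phi> x *\<^sub>R g x)"
    by (rule integrable_continuous_compact_support[OF c(2) \<phi>K(1)]) (simp add: \<phi>K(3))
  have "(LINT x|lebesgue_on U. v x *\<^sub>R grad \<phi> x) = (LINT x|lborel. v x *\<^sub>R grad \<phi> x)"
    using grad0 \<phi>K(2)
    by (intro lint_lebesgue_on_eq borel_measurable_continuous_onI c U) auto
  also have "\<dots> = - (LINT x|lborel. \<phi> x *\<^sub>R g x)"
  proof (rule euclidean_eqI)
    fix b :: 'a assume b: "b \<in> Basis"
    have "(LINT x|lborel. v x *\<^sub>R grad \<phi> x) \<bullet> b = (LINT x|lborel. v x * frechet_derivative \<phi> (at x) b)"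
      using i1 b by (subst integral_inner_left[symmetric]) (auto simp: grad_inner)
    also have "\<dots> = - (LINT x|lborel. (g x \<bullet> b) * \<phi> x)"
      using has_derivative_imp_has_dir_deriv[OF v]
      by (intro test_function_ibp[OF \<phi> b _ vc]) (auto intro!: continuous_intros g)
    also have "\<dots> = (- (LINT x|lborel. \<phi> x *\<^sub>R g x)) \<bullet> b"
      using i2 by (subst inner_minus_left, subst integral_inner_left[symmetric]) (auto simp: mult.commute)
    finally show "(LINT x|lborel. v x *\<^sub>R grad \<phi> x) \<bullet> b = (- (LINT x|lborel. \<phi> x *\<^sub>R g x)) \<bullet> b" .
  qed
  also have "(LINT x|lborel. \<phi> x *\<^sub>R g x) = (LINT x|lebesgue_on U. \<phi> x *\<^sub>R g x)"
    using \<phi>K(2,3)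
    by (intro lint_lebesgue_on_eq[symmetric] borel_measurable_continuous_onI c U) auto
  finally show "(LINT x|lebesgue_on U. v x *\<^sub>R grad \<phi> x) = - (LINT x|lebesgue_on U. \<phi> x *\<^sub>R g x)" .
qed

lemma inner_grad_x:
  "\<phi> differentiable (at z) \<Longrightarrow> w \<bullet> grad_x \<phi> z = (\<Sum>b\<in>Basis. (w \<bullet> b) * frechet_derivative \<phi> (at z) (b, 0))"
  by (subst euclidean_inner) (simp add: grad_x_inner)

lemma Basis_prod_left: "b \<in> Basis \<Longrightarrow> (b, 0) \<in> Basis" and Basis_prod_right: "(0, 1 :: real) \<in> Basis"
  by (auto simp: Basis_prod_def)

text \<open>The divergence of \<open>A *\<^sub>R (x - y)\<close> is the constant
  \<open>n * A\<close>, with \<open>n\<close> the dimension; for a linear flux this is the whole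
  p-Laplacian.\<close>

lemma radial_flux_test_function:
  fixes y :: "'a::euclidean_space"
  assumes \<phi>: "test_function V \<phi>"
  shows "integrable lborel (\<lambda>z. (A *\<^sub>R (fst z - y)) \<bullet> grad_x \<phi> z)"
    "(LINT z|lborel. (A *\<^sub>R (fst z - y)) \<bullet> grad_x \<phi> z) = - (real DIM('a) * A * (LINT z|lborel. \<phi> z))"
proof -
  have eq: "(A *\<^sub>R (fst z - y)) \<bullet> grad_x \<phi> z =
      (\<Sum>b\<in>Basis. (A * ((fst z - y) \<bullet> b)) * frechet_derivative \<phi> (at z) (b, 0))" for z
    by (simp add: inner_grad_x[OF test_functionD(4)[OF \<phi>]] sum_distrib_left)
  have ibp: "integrable lborel (\<lambda>z. (A * ((fst z - y) \<bullet> b)) * frechet_derivative \<phi> (at z) (b, 0))"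
    "(LINT z|lborel. (A * ((fst z - y) \<bullet> b)) * frechet_derivative \<phi> (at z) (b, 0)) = - (LINT z|lborel. A * \<phi> z)"
    if b: "b \<in> Basis" for b
  proof -
    have "((\<lambda>z :: 'a \<times> real. A * ((fst z - y) \<bullet> b)) has_derivative (\<lambda>w. A * (fst w \<bullet> b))) (at z)" for z
      by (auto intro!: derivative_eq_intros)
    then have d: "has_dir_deriv (b, 0 :: real) (\<lambda>z. A * ((fst z - y) \<bullet> b)) (\<lambda>z. A)"
      using has_derivative_imp_has_dir_deriv[of "\<lambda>z :: 'a \<times> real. A * ((fst z - y) \<bullet> b)" "\<lambda>z w. A * (fst w \<bullet> b)" "(b, 0)"] b
      by simp
    note t = test_function_ibp[OF \<phi> Basis_prod_left[OF b] d]
    show "integrable lborel (\<lambda>z. (A * ((fst z - y) \<bullet> b)) * frechet_derivative \<phi> (at z) (b, 0))"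
      by (rule t(1)) (intro continuous_intros)+
    show "(LINT z|lborel. (A * ((fst z - y) \<bullet> b)) * frechet_derivative \<phi> (at z) (b, 0)) = - (LINT z|lborel. A * \<phi> z)"
      by (rule t(3)) (intro continuous_intros)+
  qed
  show "integrable lborel (\<lambda>z. (A *\<^sub>R (fst z - y)) \<bullet> grad_x \<phi> z)"
    unfolding eq by (intro Bochner_Integration.integrable_sum ibp)
  show "(LINT z|lborel. (A *\<^sub>R (fst z - y)) \<bullet> grad_x \<phi> z) = - (real DIM('a) * A * (LINT z|lborel. \<phi> z))"
    unfolding eq by (subst Bochner_Integration.integral_sum[OF ibp(1)]) (simp_all add: ibp(2))
qed

lemma grad_x_borel:
  assumes \<phi>: "test_function V \<phi>"
  shows "grad_x \<phi> \<in> borel_measurable borel" "deriv_t \<phi> \<in> borel_measurable borel"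
proof -
  have "grad_x \<phi> = (\<lambda>z. \<Sum>b\<in>Basis. frechet_derivative \<phi> (at z) (b, 0) *\<^sub>R b)"
    using grad_x_inner[OF test_functionD(4)[OF \<phi>]] euclidean_representation[of "grad_x \<phi> _"] by (auto simp: fun_eq_iff)
  moreover have "continuous_on UNIV (\<lambda>z. \<Sum>b\<in>Basis. frechet_derivative \<phi> (at z) (b, 0) *\<^sub>R b)"
    by (intro continuous_on_sum continuous_on_scaleR continuous_on_const test_functionD(2)[OF \<phi>] Basis_prod_left)
  ultimately show "grad_x \<phi> \<in> borel_measurable borel"
    using borel_measurable_continuous_onI by metis
  have "deriv_t \<phi> = (\<lambda>z. frechet_derivative \<phi> (at z) (0, 1))"
    using deriv_t_eq[OF test_functionD(4)[OF \<phi>]] by auto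
  then show "deriv_t \<phi> \<in> borel_measurable borel"
    using borel_measurable_continuous_onI[OF test_functionD(2)[OF \<phi> Basis_prod_right]] by simp
qed

lemma grad_x_zero_outside:
  assumes "test_function V \<phi>" "z \<notin> V"
  shows "grad_x \<phi> z = 0" "deriv_t \<phi> z = 0"
  using test_function_deriv_zero_outside[OF assms]
    euclidean_eqI[of "grad_x \<phi> z" 0] grad_x_inner[OF test_functionD(4)[OF assms(1)]] deriv_t_eq[OF test_functionD(4)[OF assms(1)]]
  by auto

text \<open>The flux is \<open>- ((a * l) powr (p - 1))\<close> times \<open>x - y\<close>; its
  divergence \<open>- b\<close> is also the time derivative. Gradient and flux are continuous on the
  whole space, so the apex at \<open>y\<close> contributes no singular term.\<close>

theorem p_parabolic_barrier:
  fixes y :: "'a::euclidean_space"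
  assumes p: "p > 2" and l: "l = p / (p - 1)" and a: "a > 0" and b: "b = real DIM('a) * (a * l) powr (p - 1)"
  shows "p_parabolic p S (\<lambda>z. c - (a * norm (fst z - y) powr l + b * snd z))"
proof -
  define h :: "'a \<times> real \<Rightarrow> real" where "h z = c - (a * norm (fst z - y) powr l + b * snd z)" for z
  define G :: "'a \<times> real \<Rightarrow> 'a" where "G z = - (a *\<^sub>R grad_norm_powr l (fst z - y))" for z
  have l1: "l > 1" using p by (simp add: l less_divide_eq)
  have hc: "continuous_on UNIV h"
    unfolding h_def using l1 by (intro continuous_intros continuous_on_powr') auto
  have Gc: "continuous_on UNIV G"
    unfolding G_def
    by (intro continuous_intros continuous_on_compose2[OF continuous_grad_norm_powr[OF l1]]) auto
  have hd: "((\<lambda>x. h (x, t)) has_derivative (\<lambda>w. G (x, t) \<bullet> w)) (at x)" for x t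
  proof -
    have "((\<lambda>x. norm (x - y) powr l) has_derivative (\<lambda>v. grad_norm_powr l (x - y) \<bullet> v)) (at x)"
      by (rule has_derivative_compose[of "\<lambda>x. x - y" "\<lambda>v. v", OF _ norm_powr_has_derivative[OF l1]])
        (auto intro!: derivative_eq_intros)
    then have "((\<lambda>x. c - (a * norm (x - y) powr l + b * t)) has_derivative
        (\<lambda>v. 0 - (a * (grad_norm_powr l (x - y) \<bullet> v) + 0))) (at x)"
      by (intro has_derivative_diff has_derivative_const has_derivative_add has_derivative_mult_right)
    then show ?thesis
      by (simp add: h_def G_def)
  qed
  have flux: "norm (G z) powr (p - 2) *\<^sub>R G z = (- ((a * l) powr (p - 1))) *\<^sub>R (fst z - y)" for z
    using flux_norm_powr[OF p l a, of "fst z - y"] by (simp add: G_def)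
  have "weak_solution p S (\<lambda>z. ereal (h z))"
    unfolding weak_solution_def
  proof (intro allI impI, elim conjE)
    fix U :: "'a set" and t1 t2 :: real
    assume U: "open U" and t: "t1 < t2" and comp: "compactly_in (U \<times> {t1<..<t2}) S"
    let ?V = "U \<times> {t1<..<t2}"
    have V: "open ?V" using U by (intro open_Times) auto
    have "compact (closure ?V)" using comp by (simp add: compactly_in_def)
    then have Vb: "bounded ?V"
      using bounded_subset[OF compact_imp_bounded closure_subset] by blast
    have "U = fst ` ?V" using dense[OF t] by force
    then have Ub: "bounded U" using bounded_fst[OF Vb] by simp
    have slice: "continuous_on UNIV (\<lambda>x. h (x, t))" for t
      by (rule continuous_on_compose2[OF hc]) (auto intro!: continuous_intros)
    have L2: "continuous_in_L2 U t1 t2 (\<lambda>z. ereal (h z))"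
      unfolding continuous_in_L2_def
    proof (intro conjI ballI)
      show "in_Lp_ereal 2 U (\<lambda>x. ereal (h (x, t)))" for t
        using in_Lp_continuous[OF slice U Ub] by (simp add: in_Lp_ereal_def)
      fix s
      \<comment> \<open>Two time slices differ by the constant \<open>b * (s - t)\<close>, so their
        squared L2 distance is explicit.\<close>
      have "(\<lambda>t. LINT x|lebesgue_on U. (real_of_ereal (ereal (h (x, t))) - real_of_ereal (ereal (h (x, s))))\<^sup>2)
          = (\<lambda>t. measure (lebesgue_on U) (space (lebesgue_on U)) * (b * (s - t))\<^sup>2)"
        by (simp add: h_def algebra_simps)
      moreover have "((\<lambda>t. measure (lebesgue_on U) (space (lebesgue_on U)) * (b * (s - t))\<^sup>2) \<longlongrightarrow>
          measure (lebesgue_on U) (space (lebesgue_on U)) * (b * (s - s))\<^sup>2) (at s within {t1..t2})"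
        by (intro tendsto_intros)
      ultimately show "((\<lambda>t. LINT x|lebesgue_on U. (real_of_ereal (ereal (h (x, t))) - real_of_ereal (ereal (h (x, s))))\<^sup>2)
          \<longlongrightarrow> 0) (at s within {t1..t2})"
        by simp
    qed
    have W: "parabolic_sobolev_with_grad p U t1 t2 (\<lambda>z. ereal (h z)) G"
      unfolding parabolic_sobolev_with_grad_def in_Lp_ereal_def
    proof (intro conjI)
      show "in_Lp p ?V (\<lambda>x. real_of_ereal (ereal (h x)))" "in_Lp p ?V G"
        using in_Lp_continuous[OF hc V Vb] in_Lp_continuous[OF Gc V Vb] p by auto
      have "sobolev_with_grad p U (\<lambda>x. real_of_ereal (ereal (h (x, t)))) (\<lambda>x. G (x, t))" for t
        using p by (simp, intro sobolev_with_grad_C1[OF hd _ U Ub] continuous_on_compose2[OF Gc]) (auto intro!: continuous_intros)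
      then show "AE t in lebesgue_on {t1<..<t2}.
        sobolev_with_grad p U (\<lambda>x. real_of_ereal (ereal (h (x, t)))) (\<lambda>x. G (x, t))"
        by simp
    qed simp
    have "(LINT z|lebesgue_on ?V. (norm (G z) powr (p - 2) *\<^sub>R G z) \<bullet> grad_x \<phi> z)
        - (LINT z|lebesgue_on ?V. real_of_ereal (ereal (h z)) * deriv_t \<phi> z) = 0"
      if \<phi>: "test_function ?V \<phi>" for \<phi>
    proof -
      note m = grad_x_borel[OF \<phi>]
      have "(LINT z|lebesgue_on ?V. (norm (G z) powr (p - 2) *\<^sub>R G z) \<bullet> grad_x \<phi> z)
          = (LINT z|lborel. ((- ((a * l) powr (p - 1))) *\<^sub>R (fst z - y)) \<bullet> grad_x \<phi> z)"
        unfolding flux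
      proof (rule lint_lebesgue_on_eq[OF _ V])
        show "(\<lambda>z. ((- ((a * l) powr (p - 1))) *\<^sub>R (fst z - y)) \<bullet> grad_x \<phi> z) \<in> borel_measurable borel"
          by (intro borel_measurable_inner m(1) borel_measurable_continuous_onI) (intro continuous_intros)
        show "((- ((a * l) powr (p - 1))) *\<^sub>R (fst z - y)) \<bullet> grad_x \<phi> z = 0" if "z \<notin> ?V" for z
          by (subst grad_x_zero_outside[OF \<phi> that]) simp
      qed
      also have "\<dots> = b * (LINT z|lborel. \<phi> z)"
        unfolding radial_flux_test_function(2)[OF \<phi>] b by simp
      finally have 1: "(LINT z|lebesgue_on ?V. (norm (G z) powr (p - 2) *\<^sub>R G z) \<bullet> grad_x \<phi> z) = b * (LINT z|lborel. \<phi> z)" .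
      have "(LINT z|lebesgue_on ?V. h z * deriv_t \<phi> z) = (LINT z|lborel. h z * deriv_t \<phi> z)"
      proof (rule lint_lebesgue_on_eq[OF _ V])
        show "(\<lambda>z. h z * deriv_t \<phi> z) \<in> borel_measurable borel"
          by (intro borel_measurable_times m(2) borel_measurable_continuous_onI hc)
        show "h z * deriv_t \<phi> z = 0" if "z \<notin> ?V" for z
          by (subst grad_x_zero_outside[OF \<phi> that]) simp
      qed
      also have "\<dots> = (LINT z|lborel. h z * frechet_derivative \<phi> (at z) (0, 1))"
        by (simp add: deriv_t_eq[OF test_functionD(4)[OF \<phi>]])
      also have "\<dots> = - (LINT z|lborel. (- b) * \<phi> z)"
      proof (rule test_function_ibp(3)[OF \<phi> Basis_prod_right _ hc])
        have "((\<lambda>s. h (z + s *\<^sub>R (0, 1))) has_real_derivative - b) (at 0)" for z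
        proof -
          have "((\<lambda>s. c - (a * norm (fst z - y) powr l + b * (snd z + s))) has_real_derivative 0 - (0 + b * (0 + 1))) (at 0)"
            by (intro DERIV_diff DERIV_add DERIV_cmult DERIV_const DERIV_ident)
          then show ?thesis by (simp add: h_def)
        qed
        then show "has_dir_deriv (0, 1) h (\<lambda>z. - b)"
          by (simp add: has_dir_deriv_def)
      qed (intro continuous_intros)
      also have "\<dots> = b * (LINT z|lborel. \<phi> z)" by simp
      finally show ?thesis using 1 by simp
    qed
    with L2 W show "continuous_in_L2 U t1 t2 (\<lambda>z. ereal (h z)) \<and>
        (\<exists>G. parabolic_sobolev_with_grad p U t1 t2 (\<lambda>z. ereal (h z)) G \<and>
           (\<forall>\<phi>. test_function ?V \<phi> \<longrightarrow>
              (LINT z|lebesgue_on ?V. (norm (G z) powr (p - 2) *\<^sub>R G z) \<bullet> grad_x \<phi> z)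
            - (LINT z|lebesgue_on ?V. real_of_ereal (ereal (h z)) * deriv_t \<phi> z) = 0))"
      by blast
  qed
  then show ?thesis
    using continuous_on_subset[OF hc subset_UNIV, of S] by (simp add: p_parabolic_def h_def[abs_def])
qed

section \<open>The mollified energy identity\<close>

text \<open>Young's inequality with crude constants: according to the order of \<open>b\<close> and
  \<open>a powr (p - 1)\<close>, one of the two powers alone bounds the product.\<close>

lemma mult_le_powr_add_powr:
  fixes a b p :: real
  assumes "a \<ge> 0" "b \<ge> 0" "p > 1"
  shows "a * b \<le> a powr p + b powr (p / (p - 1))"
proof (cases "b \<le> a powr (p - 1)")
  case True
  have "a * b \<le> a * a powr (p - 1)"
    using True assms by (intro mult_left_mono)
  also have "\<dots> = a powr p"
    using powr_mult_base[OF assms(1), of "p - 1"] by simp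
  finally show ?thesis by (simp add: add_increasing2)
next
  case False
  have "a = (a powr (p - 1)) powr (1 / (p - 1))"
    using assms by (simp add: powr_powr)
  also have "\<dots> \<le> b powr (1 / (p - 1))"
    using False assms by (intro powr_mono2) auto
  finally have "a * b \<le> b powr (1 / (p - 1)) * b"
    using assms by (intro mult_right_mono)
  also have "\<dots> = b powr (1 + 1 / (p - 1))"
    using powr_mult_base[OF assms(2), of "1 / (p - 1)"] by (simp add: mult.commute)
  also have "1 + 1 / (p - 1) = p / (p - 1)"
    using assms by (simp add: field_simps)
  finally show ?thesis by (simp add: add_increasing)
qed

section \<open>Derivatives of mollified functions\<close>

lemma moll_test_function: "test_function UNIV (moll k :: 'a::euclidean_space \<Rightarrow> real)"
proof -
  have "closure {z :: 'a. moll k z \<noteq> 0} \<subseteq> cball 0 (1 / real (Suc k))"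
    using moll_eq_0[of k] by (intro closure_minimal) (force simp del: of_nat_Suc simp: not_less[symmetric])+
  then have "compact (closure {z :: 'a. moll k z \<noteq> 0})"
    using bounded_subset[OF bounded_cball] by (simp add: compact_eq_bounded_closed)
  then show ?thesis
    by (simp add: test_function_def compactly_in_def moll_C_k)
qed

definition dmoll :: "nat \<Rightarrow> 'a::euclidean_space \<Rightarrow> 'a \<Rightarrow> real" where
  "dmoll k v x = frechet_derivative (moll k) (at x) v"

lemma dmoll_bounded:
  assumes "b \<in> Basis"
  obtains C where "C \<ge> 0" "\<And>z :: 'a::euclidean_space. \<bar>dmoll k b z\<bar> \<le> C"
proof (rule continuous_compact_support_bounded)
  show "continuous_on UNIV (dmoll k b)"
    unfolding dmoll_def[abs_def] by (rule test_functionD(2)[OF moll_test_function assms])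
  show "compact (closure {z :: 'a. moll k z \<noteq> 0})"
    by (rule test_functionD(5)[OF moll_test_function])
  show "dmoll k b z = 0" if "z \<notin> closure {z :: 'a. moll k z \<noteq> 0}" for z
    unfolding dmoll_def by (rule test_functionD(8)[OF moll_test_function that])
qed (rule that)

lemma dmoll_continuous: "b \<in> Basis \<Longrightarrow> continuous_on UNIV (dmoll k b)"
  unfolding dmoll_def[abs_def] by (rule test_functionD(2)[OF moll_test_function])

lemma mollify_has_dir_deriv:
  fixes f :: "'a::euclidean_space \<Rightarrow> real"
  assumes b: "b \<in> Basis" and f: "integrable lborel f"
  shows "has_dir_deriv b (mollify k f) (conv (dmoll k b) f)"
proof -
  obtain C1 where C1: "\<And>z :: 'a. \<bar>moll k z\<bar> \<le> C1"
    using moll_bounded by blast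
  obtain C2 where C2: "\<And>z. \<bar>dmoll k b z\<bar> \<le> C2"
    using dmoll_bounded[OF b] by blast
  show ?thesis
  proof (rule conv_dir_deriv[OF moll_continuous _ dmoll_continuous[OF b] _ _ f])
    show "\<bar>moll k z\<bar> \<le> max C1 C2" "\<bar>dmoll k b z\<bar> \<le> max C1 C2" for z
      using C1[of z] C2[of z] by linarith+
    show "has_dir_deriv b (moll k) (dmoll k b)"
      unfolding dmoll_def[abs_def] by (rule test_functionD(1)[OF moll_test_function])
  qed
qed

lemma conv_dmoll_bounded:
  fixes f :: "'a::euclidean_space \<Rightarrow> real"
  assumes b: "b \<in> Basis" and f: "integrable lborel f"
  obtains C where "C \<ge> 0" "\<And>z. \<bar>conv (dmoll k b) f z\<bar> \<le> C"
proof -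
  obtain C2 where C2: "C2 \<ge> 0" "\<And>z. \<bar>dmoll k b z\<bar> \<le> C2"
    using dmoll_bounded[OF b] by blast
  show ?thesis
    using conv_bounded[OF dmoll_continuous[OF b] C2(2) f] C2(1)
    by (intro that[of "C2 * (LINT y|lborel. \<bar>f y\<bar>)"]) auto
qed

lemma mollify_bounded:
  fixes f :: "'a::euclidean_space \<Rightarrow> real"
  assumes f: "integrable lborel f"
  obtains C where "C \<ge> 0" "\<And>z. \<bar>mollify k f z\<bar> \<le> C"
proof -
  obtain C2 where C2: "C2 \<ge> 0" "\<And>z::'a. \<bar>moll k z\<bar> \<le> C2"
    using moll_bounded by blast
  show ?thesis
    using conv_bounded[OF moll_continuous C2(2) f] C2(1)
    by (intro that[of "C2 * (LINT y|lborel. \<bar>f y\<bar>)"]) auto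
qed

lemma mollify_le_const:
  fixes f :: "'a::euclidean_space \<Rightarrow> real"
  assumes f: "integrable lborel f" and M: "\<And>z. f z \<le> M"
  shows "mollify k f z \<le> M"
proof -
  have "mollify k f z \<le> (LINT y|lborel. M * moll k (z - y))"
    unfolding conv_def
  proof (rule integral_mono[OF conv_moll_integrable[OF f]])
    show "moll k (z - y) * f y \<le> M * moll k (z - y)" for y
      using mult_left_mono[OF M[of y] moll_nonneg[of k "z - y"]] by (simp add: mult.commute)
  qed (use moll_integral_shift[of k z] in simp)
  then show ?thesis using moll_integral_shift[of k z] by simp
qed

text \<open>The kernel centred at \<open>z\<close> is a test function once its ball lies in
  \<open>V\<close>. Inserted into a weak identity it yields a pointwise identity at \<open>z\<close>
  between mollified functions; the minus sign comes from the reflection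
  \<open>z - y\<close>.\<close>

lemma shifted_moll_test_function:
  fixes z :: "'a::euclidean_space"
  assumes "cball z (1 / real (Suc k)) \<subseteq> V"
  shows "test_function V (\<lambda>y. moll k (z - y))"
    and "frechet_derivative (\<lambda>y. moll k (z - y)) (at y) v = - dmoll k v (z - y)"
proof -
  have L: "bounded_linear (\<lambda>y :: 'a. - y)"
    by (intro bounded_linear_minus bounded_linear_ident)
  have C: "C_k m (\<lambda>y. moll k (z - y))" for m
    using C_k_affine[OF moll_C_k L, of m k z] by simp
  have sub: "closure {y. moll k (z - y) \<noteq> 0} \<subseteq> cball z (1 / real (Suc k))"
  proof (rule closure_minimal)
    show "{y. moll k (z - y) \<noteq> 0} \<subseteq> cball z (1 / real (Suc k))"
      using moll_eq_0[of k] by (auto simp: dist_norm not_le[symmetric] simp del: of_nat_Suc) force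
  qed simp
  then have "compact (closure {y. moll k (z - y) \<noteq> 0})"
    using bounded_subset[OF bounded_cball] by (simp add: compact_eq_bounded_closed)
  then show "test_function V (\<lambda>y. moll k (z - y))"
    using C sub assms by (auto simp: test_function_def compactly_in_def)
  have d: "moll k differentiable (at (z - y))"
    by (rule test_functionD(4)[OF moll_test_function])
  have "((\<lambda>y. z - y) has_derivative (\<lambda>w. - w)) (at y)"
    by (auto intro!: derivative_eq_intros)
  then have D: "((\<lambda>y. moll k (z - y)) has_derivative (\<lambda>w. frechet_derivative (moll k) (at (z - y)) (- w))) (at y)"
    by (rule has_derivative_compose) (use d in \<open>simp add: frechet_derivative_works\<close>)
  show "frechet_derivative (\<lambda>y. moll k (z - y)) (at y) v = - dmoll k v (z - y)"
    using linear_neg[OF linear_frechet_derivative[OF d]]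
    by (simp add: frechet_derivative_at[OF D, symmetric] dmoll_def)
qed

text \<open>Exponent at least 2 removes the corner at 0. Exponent 2 is the multiplier of the energy
  argument, exponent 3 provides its antiderivative.\<close>

lemma DERIV_pos_part_power:
  "((\<lambda>s. max 0 s ^ (Suc (Suc n))) has_real_derivative (real (Suc (Suc n)) * max 0 s ^ (Suc n))) (at (s::real))"
proof (cases s "0 :: real" rule: linorder_cases)
  case less
  then have ev: "eventually (\<lambda>y. max 0 y ^ (Suc (Suc n)) = 0) (nhds s)"
    using eventually_nhds_in_open[of "{..<0}" s] by (auto elim!: eventually_mono)
  show ?thesis
    using less by (subst DERIV_cong_ev[OF refl ev refl]) simp
next
  case greater
  then have ev: "eventually (\<lambda>y. max 0 y ^ (Suc (Suc n)) = y ^ (Suc (Suc n))) (nhds s)"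
    using eventually_nhds_in_open[of "{0<..}" s] by (auto elim!: eventually_mono)
  show ?thesis
    using greater DERIV_pow[of "Suc (Suc n)" s UNIV] by (subst DERIV_cong_ev[OF refl ev refl]) (simp add: max_def)
next
  case equal
  have "((\<lambda>h::real. max 0 h ^ Suc (Suc n) / h) \<longlongrightarrow> 0) (at 0)"
  proof (rule Lim_null_comparison)
    show "eventually (\<lambda>h::real. norm (max 0 h ^ Suc (Suc n) / h) \<le> max 0 h ^ Suc n) (at 0)"
      by (rule always_eventually) (auto simp: max_def)
    have "((\<lambda>h::real. max 0 h ^ Suc n) \<longlongrightarrow> max 0 0 ^ Suc n) (at 0)"
      by (intro tendsto_intros)
    then show "((\<lambda>h::real. max 0 h ^ Suc n) \<longlongrightarrow> 0) (at 0)" by simp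
  qed
  then show ?thesis
    using equal by (simp add: has_field_derivative_iff)
qed

text \<open>\<open>e\<close> plays the role of the difference of two functions, \<open>E\<close> and \<open>D\<close> are the differences of their
  gradients and fluxes, all extended by zero outside \<open>V\<close>, and \<open>\<kappa>\<close> measures by how much the second
  function is a strict supersolution. Testing with the square of the positive part of \<open>e\<close> becomes
  legitimate after mollification; \<open>e \<le> 0\<close> outside \<open>K\<close> removes all boundary terms.\<close>

locale mollified_energy =
  fixes V K :: "('a::euclidean_space \<times> real) set" and e \<kappa> :: "'a \<times> real \<Rightarrow> real"
    and E D :: "'a \<Rightarrow> 'a \<times> real \<Rightarrow> real" and p M :: real
  assumes V: "open V" "bounded V" and K: "compact K" "K \<subseteq> V"
    and e: "integrable lborel e" "\<And>z. e z \<le> M" "\<And>z. z \<notin> K \<Longrightarrow> e z \<le> 0" and M: "M \<ge> 0"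
    and \<kappa>: "integrable lborel \<kappa>" "\<And>z. \<kappa> z \<ge> 0"
    and p: "p > 1"
    and E: "\<And>i. i \<in> Basis \<Longrightarrow> integrable lborel (E i)"
      "\<And>i. i \<in> Basis \<Longrightarrow> integrable lborel (\<lambda>z. \<bar>E i z\<bar> powr p)"
    and D: "\<And>i. i \<in> Basis \<Longrightarrow> integrable lborel (D i)"
      "\<And>i. i \<in> Basis \<Longrightarrow> integrable lborel (\<lambda>z. \<bar>D i z\<bar> powr (p / (p - 1)))"
    and weak_grad: "\<And>\<phi> i. test_function V \<phi> \<Longrightarrow> i \<in> Basis \<Longrightarrow>
      (LINT z|lborel. frechet_derivative \<phi> (at z) (i, 0) * e z) = - (LINT z|lborel. \<phi> z * E i z)"
    and weak_eq: "\<And>\<phi>. test_function V \<phi> \<Longrightarrow>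
      (LINT z|lborel. frechet_derivative \<phi> (at z) (0, 1) * e z) =
      (\<Sum>i\<in>Basis. LINT z|lborel. frechet_derivative \<phi> (at z) (i, 0) * D i z) + (LINT z|lborel. \<phi> z * \<kappa> z)"
begin

text \<open>Restricted to points whose kernel ball stays in \<open>V\<close>: elsewhere the kernel
  would not be a test function on \<open>V\<close>, and the jump of the zero extension could
  contribute.\<close>

lemma conv_dmoll_weak_grad:
  assumes "cball z (1 / real (Suc k)) \<subseteq> V" "i \<in> Basis"
  shows "conv (dmoll k (i, 0)) e z = mollify k (E i) z"
  using weak_grad[OF shifted_moll_test_function(1)[OF assms(1)] assms(2)]
  unfolding shifted_moll_test_function(2)[OF assms(1)] conv_def by simp

lemma conv_dmoll_weak_eq:
  assumes "cball z (1 / real (Suc k)) \<subseteq> V"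
  shows "conv (dmoll k (0, 1)) e z = (\<Sum>i\<in>Basis. conv (dmoll k (i, 0)) (D i) z) - mollify k \<kappa> z"
  using weak_eq[OF shifted_moll_test_function(1)[OF assms(1)]]
  unfolding shifted_moll_test_function(2)[OF assms(1)] conv_def by (simp add: sum_negf)

definition pos2 :: "real \<Rightarrow> real" where "pos2 s = max 0 s ^ 2"

lemma pos2_DERIV: "(pos2 has_real_derivative 2 * max 0 s) (at s)"
  using DERIV_pos_part_power[of 0 s] by (simp add: pos2_def[abs_def] numeral_2_eq_2)

text \<open>Outside \<open>K\<close> the function \<open>e\<close> is nonpositive and the kernel is
  nonnegative, so a positive mean has to see a point of \<open>K\<close>. This confines the
  multiplier to a small neighbourhood of \<open>K\<close>.\<close>

lemma mollify_e_pos_near_K: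
  assumes "mollify k e z > 0"
  obtains y where "y \<in> K" "norm (z - y) < 1 / real (Suc k)"
proof (rule ccontr)
  note near = that
  assume "\<not> thesis"
  then have far: "moll k (z - y) = 0" if "y \<in> K" for y
  proof -
    have "\<not> norm (z - y) < 1 / real (Suc k)"
      using near[OF that] \<open>\<not> thesis\<close> by auto
    then show ?thesis
      by (intro moll_eq_0) (simp only: not_less)
  qed
  have "mollify k e z \<le> (LINT y|lborel. 0 * moll k (z - y))"
    unfolding conv_def
  proof (rule integral_mono[OF conv_moll_integrable[OF e(1)]])
    show "moll k (z - y) * e y \<le> 0 * moll k (z - y)" for y
      using far[of y] e(3)[of y] moll_nonneg[of k "z - y"] by (cases "y \<in> K") (auto simp: mult_nonneg_nonpos)
  qed simp
  then show False using assms by simp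
qed

text \<open>The integrand that remains when the mollified equation is multiplied by
  \<open>pos2\<close> of the mollified \<open>e\<close> and integrated by parts in space:
  differentiating \<open>pos2\<close> gives the first term, the strictness \<open>\<kappa>\<close>
  the second, and the time derivative integrates to zero.\<close>

definition energy :: "nat \<Rightarrow> 'a \<times> real \<Rightarrow> real" where
  "energy k z = 2 * max 0 (mollify k e z) * (\<Sum>i\<in>Basis. mollify k (E i) z * mollify k (D i) z)
     + pos2 (mollify k e z) * mollify k \<kappa> z"

lemma energy_integral_eq_0:
  assumes k: "\<And>z y. y \<in> K \<Longrightarrow> norm (z - y) < 1 / real (Suc k) \<Longrightarrow> cball z (1 / real (Suc k)) \<subseteq> V"
  shows "integrable lborel (energy k)" "(LINT z|lborel. energy k z) = 0"
proof -
  let ?u = "mollify k e"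
  have bt: "(0 :: 'a, 1 :: real) \<in> Basis" and bx: "\<And>i::'a. i \<in> Basis \<Longrightarrow> (i, 0 :: real) \<in> Basis"
    by (auto intro: Basis_prod_left Basis_prod_right)
  have near: "cball z (1 / real (Suc k)) \<subseteq> V" if "?u z > 0" for z
    using mollify_e_pos_near_K[OF that] k by metis
  have supp: "?u z \<le> 0" if "z \<notin> V" for z
  proof (rule ccontr)
    assume "\<not> ?u z \<le> 0"
    then have "cball z (1 / real (Suc k)) \<subseteq> V" by (intro near) simp
    then show False using that by (metis centre_in_cball divide_nonneg_nonneg of_nat_0_le_iff subsetD zero_le_one)
  qed
  obtain Cu where Cu: "Cu \<ge> 0" "\<And>z. \<bar>?u z\<bar> \<le> Cu"
    using mollify_bounded[OF e(1)] by blast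
  have g_le: "\<bar>pos2 (?u z)\<bar> \<le> Cu\<^sup>2" "\<bar>2 * max 0 (?u z)\<bar> \<le> 2 * Cu" for z
    using Cu(2)[of z] Cu(1) by (auto simp: pos2_def max_def abs_le_square_iff[symmetric] abs_le_iff)
  have uc: "continuous_on UNIV ?u"
    by (rule mollify_continuous[OF e(1)])
  have gc: "continuous_on UNIV (\<lambda>z. pos2 (?u z))"
    unfolding pos2_def by (intro continuous_intros uc)
  note ud = mollify_has_dir_deriv[OF _ e(1), of _ k]
  obtain Ct where Ct: "Ct \<ge> 0" "\<And>z. \<bar>conv (dmoll k (0, 1)) e z\<bar> \<le> Ct"
    using conv_dmoll_bounded[OF bt e(1)] by blast
  \<comment> \<open>\<open>Ft\<close> is the time derivative of \<open>max 0 u ^ 3 / 3\<close>, with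
    \<open>u\<close> the mollified \<open>e\<close>; \<open>Fx i\<close> below is the
    \<open>i\<close>-th spatial derivative of \<open>pos2 u\<close> times the mollified
    \<open>D i\<close>. All of them integrate to zero.\<close>
  define Ft where "Ft z = pos2 (?u z) * conv (dmoll k (0, 1)) e z" for z
  have Ft: "integrable lborel Ft" "(LINT z|lborel. Ft z) = 0"
  proof -
    have "((\<lambda>s. max 0 s ^ 3 / 3) has_real_derivative pos2 s) (at s)" for s :: real
      using DERIV_cdivide[OF DERIV_pos_part_power[of 1 s], of 3] by (simp add: pos2_def numeral_3_eq_3 numeral_2_eq_2)
    then have d: "has_dir_deriv (0, 1) (\<lambda>z. max 0 (?u z) ^ 3 / 3) Ft"
      unfolding Ft_def using has_dir_deriv_compose[OF ud[OF bt], of "\<lambda>s. max 0 s ^ 3 / 3" pos2] by simp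
    have c: "continuous_on UNIV (\<lambda>z. max 0 (?u z) ^ 3 / 3)"
      by (intro continuous_intros uc) auto
    have b: "\<bar>Ft z\<bar> \<le> Cu\<^sup>2 * Ct" for z
      unfolding Ft_def abs_mult using g_le(1)[of z] Ct(2)[of z] by (intro mult_mono) auto
    have z: "max 0 (?u z) ^ 3 / 3 = 0" if "z \<notin> V" for z
      using supp[OF that] by simp
    show "integrable lborel Ft" "(LINT z|lborel. Ft z) = 0"
      by (rule integral_dir_deriv_eq_0[OF d c b V(2) z], assumption)+
  qed
  define Fx where "Fx i z = 2 * max 0 (?u z) * conv (dmoll k (i, 0)) e z * mollify k (D i) z
      + pos2 (?u z) * conv (dmoll k (i, 0)) (D i) z" for i z
  have Fx: "integrable lborel (Fx i)" "(LINT z|lborel. Fx i z) = 0" if i: "i \<in> Basis" for i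
  proof -
    have d: "has_dir_deriv (i, 0) (\<lambda>z. pos2 (?u z) * mollify k (D i) z) (Fx i)"
      using has_dir_deriv_mult[OF has_dir_deriv_compose[OF ud[OF bx[OF i]] pos2_DERIV]
          mollify_has_dir_deriv[OF bx[OF i] D(1)[OF i], of k]]
      by (simp add: Fx_def[abs_def])
    have c: "continuous_on UNIV (\<lambda>z. pos2 (?u z) * mollify k (D i) z)"
      by (intro continuous_on_mult gc mollify_continuous D(1) i)
    obtain C1 where C1: "C1 \<ge> 0" "\<And>z. \<bar>conv (dmoll k (i, 0)) e z\<bar> \<le> C1"
      using conv_dmoll_bounded[OF bx[OF i] e(1)] by blast
    obtain C2 where C2: "C2 \<ge> 0" "\<And>z. \<bar>conv (dmoll k (i, 0)) (D i) z\<bar> \<le> C2"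
      using conv_dmoll_bounded[OF bx[OF i] D(1)[OF i]] by blast
    obtain C3 where C3: "C3 \<ge> 0" "\<And>z. \<bar>mollify k (D i) z\<bar> \<le> C3"
      using mollify_bounded[OF D(1)[OF i]] by blast
    have b: "\<bar>Fx i z\<bar> \<le> 2 * Cu * C1 * C3 + Cu\<^sup>2 * C2" for z
    proof -
      have "\<bar>2 * max 0 (?u z) * conv (dmoll k (i, 0)) e z * mollify k (D i) z\<bar> \<le> 2 * Cu * C1 * C3"
        unfolding abs_mult[of "_ * _ * _"] abs_mult[of "2 * max 0 (?u z)"]
        using g_le(2)[of z] C1 C3 Cu(1) by (intro mult_mono) auto
      moreover have "\<bar>pos2 (?u z) * conv (dmoll k (i, 0)) (D i) z\<bar> \<le> Cu\<^sup>2 * C2"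
        unfolding abs_mult using g_le(1)[of z] C2 by (intro mult_mono) auto
      ultimately show ?thesis unfolding Fx_def by linarith
    qed
    have z: "pos2 (?u z) * mollify k (D i) z = 0" if "z \<notin> V" for z
      using supp[OF that] by (simp add: pos2_def)
    show "integrable lborel (Fx i)" "(LINT z|lborel. Fx i z) = 0"
      by (rule integral_dir_deriv_eq_0[OF d c b V(2) z], assumption)+
  qed
  \<comment> \<open>Where the mollified \<open>e\<close> is positive, the point is close to
    \<open>K\<close> and the pointwise identities hold; where it is not, every term contains a
    vanishing factor.\<close>
  have "energy k z = (\<Sum>i\<in>Basis. Fx i z) - Ft z" for z
  proof (cases "?u z > 0")
    case True
    note w = conv_dmoll_weak_grad[OF near[OF True]] conv_dmoll_weak_eq[OF near[OF True]]
    have "(\<Sum>i\<in>Basis. Fx i z) = (\<Sum>i\<in>Basis. 2 * max 0 (?u z) * (mollify k (E i) z * mollify k (D i) z))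
        + (\<Sum>i\<in>Basis. pos2 (?u z) * conv (dmoll k (i, 0)) (D i) z)"
      unfolding Fx_def by (simp add: w(1) sum.distrib mult.assoc)
    also have "\<dots> = 2 * max 0 (?u z) * (\<Sum>i\<in>Basis. mollify k (E i) z * mollify k (D i) z)
        + pos2 (?u z) * (\<Sum>i\<in>Basis. conv (dmoll k (i, 0)) (D i) z)"
      by (simp only: sum_distrib_left)
    finally show ?thesis
      unfolding energy_def Ft_def w(2) by (simp add: right_diff_distrib)
  next
    case False
    then show ?thesis by (simp add: energy_def Fx_def Ft_def pos2_def)
  qed
  then have eq: "energy k = (\<lambda>z. (\<Sum>i\<in>Basis. Fx i z) - Ft z)"
    by (rule ext)
  show "integrable lborel (energy k)"
    unfolding eq by (intro Bochner_Integration.integrable_diff Bochner_Integration.integrable_sum Fx Ft)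
  have "(LINT z|lborel. energy k z) = (LINT z|lborel. (\<Sum>i\<in>Basis. Fx i z)) - (LINT z|lborel. Ft z)"
    unfolding eq
    by (rule Bochner_Integration.integral_diff, rule Bochner_Integration.integrable_sum, rule Fx(1), assumption, rule Ft(1))
  also have "(LINT z|lborel. (\<Sum>i\<in>Basis. Fx i z)) = (\<Sum>i\<in>Basis. LINT z|lborel. Fx i z)"
    by (rule Bochner_Integration.integral_sum) (rule Fx(1))
  finally show "(LINT z|lborel. energy k z) = 0"
    by (simp add: Fx Ft)
qed

text \<open>One kernel radius leads from \<open>K\<close> to \<open>z\<close> and a second one is
  taken by the ball around \<open>z\<close>, so the radius has to be below half the distance
  \<open>d\<close>.\<close>

lemma margin:
  obtains k0 where "\<And>k z y. k \<ge> k0 \<Longrightarrow> y \<in> K \<Longrightarrow> norm (z - y) < 1 / real (Suc k) \<Longrightarrow> cball z (1 / real (Suc k)) \<subseteq> V"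
proof -
  obtain d where d: "d > 0" "(\<Union>x\<in>K. cball x d) \<subseteq> V"
    using compact_subset_open_imp_cball_epsilon_subset[OF K(1) V(1) K(2)] by blast
  obtain k0 where k0: "1 / real (Suc k0) < d / 2"
    using reals_Archimedean[of "d / 2"] d(1) by (auto simp: inverse_eq_divide)
  show ?thesis
  proof (rule that[of k0])
    fix k z y assume k: "k \<ge> k0" "y \<in> K" "norm (z - y) < 1 / real (Suc k)"
    have "1 / real (Suc k) \<le> 1 / real (Suc k0)"
      using k(1) by (simp add: frac_le)
    then have "cball z (1 / real (Suc k)) \<subseteq> cball y d"
      using k(3) k0 unfolding cball_subset_cball_iff by (auto simp: dist_norm)
    then show "cball z (1 / real (Suc k)) \<subseteq> V"
      using d(2) k(2) by blast
  qed
qed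

text \<open>Before the limit the products of mollified gradient and flux differences have no sign.
  \<open>major_moll k\<close> bounds them, converges to \<open>major\<close> almost everywhere along
  a subsequence, and has the integral of \<open>major\<close> for every \<open>k\<close>.\<close>

definition major :: "'a \<times> real \<Rightarrow> real" where
  "major z = 2 * M * (\<Sum>i\<in>Basis. \<bar>E i z\<bar> powr p + \<bar>D i z\<bar> powr (p / (p - 1)))"

definition major_moll :: "nat \<Rightarrow> 'a \<times> real \<Rightarrow> real" where
  "major_moll k z = 2 * M * (\<Sum>i\<in>Basis. mollify k (\<lambda>z. \<bar>E i z\<bar> powr p) z + mollify k (\<lambda>z. \<bar>D i z\<bar> powr (p / (p - 1))) z)"

lemma major_moll:
  "integrable lborel (major_moll k)" "integrable lborel major"
  "(LINT z|lborel. major_moll k z) = (LINT z|lborel. major z)"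
proof -
  have i: "integrable lborel (mollify k (\<lambda>z. \<bar>E i z\<bar> powr p))"
    "integrable lborel (mollify k (\<lambda>z. \<bar>D i z\<bar> powr (p / (p - 1))))"
    "(LINT z|lborel. mollify k (\<lambda>z. \<bar>E i z\<bar> powr p) z) = (LINT z|lborel. \<bar>E i z\<bar> powr p)"
    "(LINT z|lborel. mollify k (\<lambda>z. \<bar>D i z\<bar> powr (p / (p - 1))) z) = (LINT z|lborel. \<bar>D i z\<bar> powr (p / (p - 1)))"
    if "i \<in> Basis" for i
    using mollify_integral_nonneg[OF E(2)[OF that], of k] mollify_integral_nonneg[OF D(2)[OF that], of k] by auto
  show "integrable lborel (major_moll k)" "integrable lborel major"
    unfolding major_moll_def[abs_def] major_def[abs_def]
    by (intro integrable_mult_right Bochner_Integration.integrable_sum Bochner_Integration.integrable_add i E D; assumption)+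
  show "(LINT z|lborel. major_moll k z) = (LINT z|lborel. major z)"
    unfolding major_moll_def major_def
    by (simp add: Bochner_Integration.integral_sum Bochner_Integration.integral_add Bochner_Integration.integrable_add i E D)
qed

text \<open>The bound \<open>e \<le> M\<close> survives mollification and controls the multiplier;
  Young's inequality splits each product and Jensen's moves the powers inside the mollification. The
  \<open>\<kappa>\<close> term is nonnegative by itself.\<close>

lemma energy_add_major_nonneg: "energy k z + major_moll k z \<ge> 0"
proof -
  have u: "0 \<le> 2 * max 0 (mollify k e z)" "2 * max 0 (mollify k e z) \<le> 2 * M"
    using mollify_le_const[OF e(1,2), of k z] M by auto
  let ?P = "\<lambda>i. mollify k (E i) z * mollify k (D i) z"
  let ?Q = "\<lambda>i. mollify k (\<lambda>z. \<bar>E i z\<bar> powr p) z + mollify k (\<lambda>z. \<bar>D i z\<bar> powr (p / (p - 1))) z"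
  have q: "p / (p - 1) > 1" using p by (simp add: less_divide_eq)
  have PQ: "\<bar>?P i\<bar> \<le> ?Q i" if i: "i \<in> Basis" for i
  proof -
    have "\<bar>?P i\<bar> \<le> \<bar>mollify k (E i) z\<bar> powr p + \<bar>mollify k (D i) z\<bar> powr (p / (p - 1))"
      unfolding abs_mult by (rule mult_le_powr_add_powr) (use p in auto)
    also have "\<dots> \<le> ?Q i"
      by (intro add_mono mollify_jensen p q E D i)
    finally show ?thesis .
  qed
  have "\<bar>\<Sum>i\<in>Basis. ?P i\<bar> \<le> (\<Sum>i\<in>Basis. ?Q i)"
    by (rule order_trans[OF sum_abs]) (intro sum_mono PQ)
  then have "2 * max 0 (mollify k e z) * \<bar>\<Sum>i\<in>Basis. ?P i\<bar> \<le> 2 * M * (\<Sum>i\<in>Basis. ?Q i)"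
    using u by (intro mult_mono) auto
  then have "2 * max 0 (mollify k e z) * (\<Sum>i\<in>Basis. ?P i) + major_moll k z \<ge> 0"
    using u(1) abs_mult[of "2 * max 0 (mollify k e z)" "\<Sum>i\<in>Basis. ?P i"] unfolding major_moll_def by linarith
  moreover have "pos2 (mollify k e z) * mollify k \<kappa> z \<ge> 0"
    using mollify_nonneg[of \<kappa>, OF \<kappa>(2)] by (simp add: pos2_def)
  ultimately show ?thesis unfolding energy_def by linarith
qed

text \<open>Fatou's lemma for \<open>energy + major_moll\<close>, whose integral equals that of
  \<open>major\<close> for large \<open>k\<close>. The limit is at least
  \<open>pos2 e * \<kappa> + major\<close>, because monotonicity holds for the quantities before
  mollification, and the finite integral of \<open>major\<close> cancels.\<close>

theorem energy_limit:
  assumes mono: "\<And>z. (\<Sum>i\<in>Basis. E i z * D i z) \<ge> 0"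
  shows "AE z in lborel. pos2 (e z) * \<kappa> z = 0"
proof -
  \<comment> \<open>The powers of \<open>E i\<close> and \<open>D i\<close> join the family so that
    the majorants converge along the same subsequence.\<close>
  define Fam where "Fam = {e, \<kappa>} \<union> E ` Basis \<union> D ` Basis \<union> (\<lambda>i z. \<bar>E i z\<bar> powr p) ` Basis
      \<union> (\<lambda>i z. \<bar>D i z\<bar> powr (p / (p - 1))) ` Basis"
  have "finite Fam" "\<And>f. f \<in> Fam \<Longrightarrow> integrable lborel f"
    unfolding Fam_def using e \<kappa> E D by auto
  then obtain r where r: "strict_mono r" "\<And>f. f \<in> Fam \<Longrightarrow> AE z in lborel. (\<lambda>k. mollify (r k) f z) \<longlonglongrightarrow> f z"
    using mollify_AE_subseq[of Fam] by blast
  have "AE z in lborel. \<forall>f\<in>Fam. (\<lambda>k. mollify (r k) f z) \<longlonglongrightarrow> f z"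
    using \<open>finite Fam\<close> r(2) by (simp add: AE_finite_all)
  then have lim: "AE z in lborel. (\<lambda>k. energy (r k) z + major_moll (r k) z) \<longlonglongrightarrow>
     2 * max 0 (e z) * (\<Sum>i\<in>Basis. E i z * D i z) + pos2 (e z) * \<kappa> z + major z"
  proof (rule AE_mp, intro AE_I2 impI)
    fix z assume *: "\<forall>f\<in>Fam. (\<lambda>k. mollify (r k) f z) \<longlonglongrightarrow> f z"
    have "e \<in> Fam" "\<kappa> \<in> Fam" "i \<in> Basis \<Longrightarrow> E i \<in> Fam" "i \<in> Basis \<Longrightarrow> D i \<in> Fam" for i
      by (auto simp: Fam_def)
    moreover have "i \<in> Basis \<Longrightarrow> (\<lambda>z. \<bar>E i z\<bar> powr p) \<in> Fam"
      "i \<in> Basis \<Longrightarrow> (\<lambda>z. \<bar>D i z\<bar> powr (p / (p - 1))) \<in> Fam" for i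
      using imageI[of i Basis "\<lambda>i z. \<bar>E i z\<bar> powr p"] imageI[of i Basis "\<lambda>i z. \<bar>D i z\<bar> powr (p / (p - 1))"]
      by (simp_all add: Fam_def)
    ultimately show "(\<lambda>k. energy (r k) z + major_moll (r k) z) \<longlonglongrightarrow>
       2 * max 0 (e z) * (\<Sum>i\<in>Basis. E i z * D i z) + pos2 (e z) * \<kappa> z + major z"
      unfolding energy_def major_moll_def major_def pos2_def
      by (intro tendsto_add tendsto_mult tendsto_const tendsto_sum tendsto_max tendsto_power bspec[OF *])
  qed
  obtain k0 where k0: "\<And>k z y. k \<ge> k0 \<Longrightarrow> y \<in> K \<Longrightarrow> norm (z - y) < 1 / real (Suc k) \<Longrightarrow> cball z (1 / real (Suc k)) \<subseteq> V"
    using margin by blast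
  have int: "(\<integral>\<^sup>+z. ennreal (energy (r k) z + major_moll (r k) z) \<partial>lborel) = ennreal (LINT z|lborel. major z)"
    if "k \<ge> k0" for k
  proof -
    have rk: "r k \<ge> k0" using that seq_suble[OF r(1), of k] by linarith
    have en: "integrable lborel (energy (r k))" "(LINT z|lborel. energy (r k) z) = 0"
      by (rule energy_integral_eq_0, rule k0[OF rk], assumption+)+
    have "(\<integral>\<^sup>+z. ennreal (energy (r k) z + major_moll (r k) z) \<partial>lborel)
        = ennreal (LINT z|lborel. energy (r k) z + major_moll (r k) z)"
      by (intro nn_integral_eq_integral Bochner_Integration.integrable_add en(1) major_moll AE_I2 energy_add_major_nonneg)
    also have "(LINT z|lborel. energy (r k) z + major_moll (r k) z) = (LINT z|lborel. major z)"
      by (subst Bochner_Integration.integral_add) (auto simp: en major_moll)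
    finally show ?thesis .
  qed
  have m: "(\<lambda>z. ennreal (energy (r (k + k0)) z + major_moll (r (k + k0)) z)) \<in> borel_measurable lborel" for k
  proof -
    have rk: "r (k + k0) \<ge> k0" using seq_suble[OF r(1), of "k + k0"] by linarith
    have en: "integrable lborel (energy (r (k + k0)))" "(LINT z|lborel. energy (r (k + k0)) z) = 0"
      by (rule energy_integral_eq_0, rule k0[OF rk], assumption+)+
    show ?thesis
      using borel_measurable_integrable[OF en(1)] borel_measurable_integrable[OF major_moll(1)] by simp
  qed
  have nn: "pos2 (e z) * \<kappa> z \<ge> 0" "major z \<ge> 0" for z
    using \<kappa>(2) M by (auto simp: pos2_def major_def intro!: mult_nonneg_nonneg sum_nonneg)
  have "(\<integral>\<^sup>+z. ennreal (pos2 (e z) * \<kappa> z) \<partial>lborel) + (\<integral>\<^sup>+z. ennreal (major z) \<partial>lborel)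
      = (\<integral>\<^sup>+z. ennreal (pos2 (e z) * \<kappa> z + major z) \<partial>lborel)"
    using borel_measurable_integrable[OF e(1)] borel_measurable_integrable[OF \<kappa>(1)] borel_measurable_integrable[OF major_moll(2)] nn
    unfolding pos2_def by (subst nn_integral_add[symmetric]) (auto simp: ennreal_plus)
  also have "\<dots> \<le> (\<integral>\<^sup>+z. liminf (\<lambda>k. ennreal (energy (r (k + k0)) z + major_moll (r (k + k0)) z)) \<partial>lborel)"
  proof (rule nn_integral_mono_AE, rule AE_mp[OF lim], intro AE_I2 impI)
    fix z assume l: "(\<lambda>k. energy (r k) z + major_moll (r k) z) \<longlonglongrightarrow>
       2 * max 0 (e z) * (\<Sum>i\<in>Basis. E i z * D i z) + pos2 (e z) * \<kappa> z + major z"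
    have "liminf (\<lambda>k. ennreal (energy (r (k + k0)) z + major_moll (r (k + k0)) z))
       = ennreal (2 * max 0 (e z) * (\<Sum>i\<in>Basis. E i z * D i z) + pos2 (e z) * \<kappa> z + major z)"
      by (intro lim_imp_Liminf tendsto_ennrealI LIMSEQ_ignore_initial_segment[OF l]) simp
    moreover have "2 * max 0 (e z) * (\<Sum>i\<in>Basis. E i z * D i z) \<ge> 0"
      using mono[of z] by simp
    ultimately show "ennreal (pos2 (e z) * \<kappa> z + major z)
        \<le> liminf (\<lambda>k. ennreal (energy (r (k + k0)) z + major_moll (r (k + k0)) z))"
      by (simp add: ennreal_leI)
  qed
  also have "\<dots> \<le> liminf (\<lambda>k. \<integral>\<^sup>+z. ennreal (energy (r (k + k0)) z + major_moll (r (k + k0)) z) \<partial>lborel)"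
    by (rule nn_integral_liminf[OF m])
  also have "\<dots> = ennreal (LINT z|lborel. major z)"
    by (simp add: int Liminf_const)
  also have "\<dots> = (\<integral>\<^sup>+z. ennreal (major z) \<partial>lborel)"
    by (rule nn_integral_eq_integral[symmetric]) (auto simp: major_moll nn)
  finally have le: "(\<integral>\<^sup>+z. ennreal (pos2 (e z) * \<kappa> z) \<partial>lborel) + (\<integral>\<^sup>+z. ennreal (major z) \<partial>lborel)
      \<le> 0 + (\<integral>\<^sup>+z. ennreal (major z) \<partial>lborel)" by simp
  have "(\<integral>\<^sup>+z. ennreal (major z) \<partial>lborel) < \<infinity>"
    using nn_integral_eq_integral[OF major_moll(2) AE_I2[OF nn(2)]] by simp
  then have "(\<integral>\<^sup>+z. ennreal (pos2 (e z) * \<kappa> z) \<partial>lborel) = 0"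
    using le unfolding add.commute[of _ "\<integral>\<^sup>+z. ennreal (major z) \<partial>lborel"] ennreal_add_left_cancel_le by auto
  then have "AE z in lborel. ennreal (pos2 (e z) * \<kappa> z) = 0"
    using borel_measurable_integrable[OF e(1)] borel_measurable_integrable[OF \<kappa>(1)]
    by (subst (asm) nn_integral_0_iff_AE) (auto simp: pos2_def)
  then show ?thesis
    by (rule AE_mp, intro AE_I2 impI antisym[OF _ nn(1)]) (simp only: ennreal_eq_0_iff)
qed

end

section \<open>Borel versions of weak solutions\<close>

lemma AE_lborel_slice_snd:
  fixes P :: "'a::euclidean_space \<times> 'b::euclidean_space \<Rightarrow> bool"
  assumes "AE z in lborel. P z"
  shows "AE t in lborel. AE x in lborel. P (x, t)"
proof -
  obtain N where N: "\<And>z. z \<notin> N \<Longrightarrow> P z" "N \<in> null_sets (lborel :: ('a \<times> 'b) measure)"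
    using AE_E3[OF assms] by auto
  have "AE z in lborel. z \<notin> N"
    by (rule AE_not_in[OF N(2)])
  then have "AE x in (lborel :: 'a measure). AE t in (lborel :: 'b measure). (x, t) \<notin> N"
    unfolding lborel_prod[symmetric] by (rule lborel_pair.AE_pair)
  moreover have "{z \<in> space (lborel \<Otimes>\<^sub>M lborel). (fst z, snd z) \<notin> N} \<in> sets (lborel \<Otimes>\<^sub>M lborel :: ('a \<times> 'b) measure)"
    using N(2) unfolding lborel_prod by (auto simp: null_sets_def Compl_eq[symmetric] Collect_neg_eq)
  ultimately have "AE t in (lborel :: 'b measure). AE x in (lborel :: 'a measure). (x, t) \<notin> N"
    by (subst (asm) lborel_pair.AE_commute) auto
  then show ?thesis
  proof (rule eventually_mono)
    fix t assume "AE x in (lborel :: 'a measure). (x, t) \<notin> N"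
    then show "AE x in lborel. P (x, t)"
      by (rule eventually_mono) (rule N(1))
  qed
qed

lemma lborel_integral_snd:
  fixes f :: "'a::euclidean_space \<times> 'b::euclidean_space \<Rightarrow> real"
  assumes "integrable lborel f"
  shows "(LINT z|lborel. f z) = (LINT t|lborel. LINT x|lborel. f (x, t))"
  using lborel_pair.integral_snd[of "\<lambda>x t. f (x, t)"] assms unfolding lborel_prod by simp

text \<open>The weak gradient in the definition is only Lebesgue measurable on \<open>V\<close>. A
  Borel function equal almost everywhere to its zero extension carries integral and integrability
  over to \<open>lborel\<close>, where product measures are available.\<close>

lemma lebesgue_on_borel_version:
  fixes f :: "'a::euclidean_space \<Rightarrow> 'b::{banach, second_countable_topology}"
  assumes V: "open V" and f: "f \<in> borel_measurable (lebesgue_on V)" and g: "g \<in> borel_measurable borel"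
    and eq: "AE z in lborel. indicator V z *\<^sub>R f z = g z"
  shows "(LINT z|lebesgue_on V. f z) = (LINT z|lborel. g z)"
    and "integrable (lebesgue_on V) f \<longleftrightarrow> integrable lborel g"
proof -
  have Vm: "V \<inter> space lebesgue \<in> sets lebesgue" using V by (simp add: borel_open)
  have m: "(\<lambda>z. indicator V z *\<^sub>R f z) \<in> borel_measurable lebesgue"
    using f borel_measurable_restrict_space_iff[OF Vm] by blast
  have gm: "g \<in> borel_measurable lebesgue" using g by (simp add: measurable_completion)
  have eq': "AE z in lebesgue. indicator V z *\<^sub>R f z = g z"
    using eq by (simp only: AE_completion_iff)
  have "(LINT z|lebesgue_on V. f z) = (LINT z|lebesgue. indicator V z *\<^sub>R f z)"
    by (rule integral_restrict_space[OF Vm])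
  also have "\<dots> = (LINT z|lebesgue. g z)"
    by (rule integral_cong_AE[OF m gm eq'])
  also have "\<dots> = (LINT z|lborel. g z)"
    using g by (intro integral_completion) auto
  finally show "(LINT z|lebesgue_on V. f z) = (LINT z|lborel. g z)" .
  have "integrable (lebesgue_on V) f \<longleftrightarrow> integrable lebesgue (\<lambda>z. indicator V z *\<^sub>R f z)"
    by (rule integrable_restrict_space[OF Vm])
  also have "\<dots> \<longleftrightarrow> integrable lebesgue g"
    by (rule integrable_cong_AE[OF m gm eq'])
  also have "\<dots> \<longleftrightarrow> integrable lborel g"
    using g by (intro integrable_completion) auto
  finally show "integrable (lebesgue_on V) f \<longleftrightarrow> integrable lborel g" .
qed

text \<open>Borel versions exist for real functions and are taken coordinate by coordinate; the
  indicator restores the value 0 outside \<open>V\<close> exactly.\<close>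

lemma lebesgue_on_ex_borel_version:
  fixes G :: "'a::euclidean_space \<Rightarrow> 'b::euclidean_space"
  assumes V: "open V" and G: "G \<in> borel_measurable (lebesgue_on V)"
  obtains G' where "G' \<in> borel_measurable borel" "AE z in lborel. z \<in> V \<longrightarrow> G z = G' z" "\<And>z. z \<notin> V \<Longrightarrow> G' z = 0"
proof -
  have Vm: "V \<inter> space lebesgue \<in> sets lebesgue" using V by (simp add: borel_open)
  have m: "(\<lambda>z. indicator V z *\<^sub>R G z) \<in> borel_measurable lebesgue"
    using G borel_measurable_restrict_space_iff[OF Vm] by blast
  then have "(\<lambda>z. (indicator V z *\<^sub>R G z) \<bullet> i) \<in> borel_measurable lebesgue" for i
    by (rule borel_measurable_inner[OF _ borel_measurable_const])
  then have "\<forall>i. \<exists>g\<in>borel_measurable lborel. AE z in lborel. (indicator V z *\<^sub>R G z) \<bullet> i = g z"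
    using completion_ex_borel_measurable_real by blast
  then obtain g where g: "\<And>i. g i \<in> borel_measurable lborel" "\<And>i. AE z in lborel. (indicator V z *\<^sub>R G z) \<bullet> i = g i z"
    by metis
  define G' where "G' z = indicator V z *\<^sub>R (\<Sum>i\<in>Basis. g i z *\<^sub>R i)" for z
  have [measurable]: "V \<in> sets borel" "\<And>i. g i \<in> borel_measurable borel"
    using V g(1) by (auto simp: borel_open)
  have "AE z in lborel. \<forall>i\<in>Basis. (indicator V z *\<^sub>R G z) \<bullet> i = g i z"
    using g(2) by (simp add: AE_finite_all)
  then have "AE z in lborel. z \<in> V \<longrightarrow> G z = G' z"
  proof (rule AE_mp, intro AE_I2 impI)
    fix z assume *: "\<forall>i\<in>Basis. (indicator V z *\<^sub>R G z) \<bullet> i = g i z" and "z \<in> V"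
    then have "G' z = (\<Sum>i\<in>Basis. (G z \<bullet> i) *\<^sub>R i)"
      by (simp add: G'_def)
    then show "G z = G' z" by (simp add: euclidean_representation)
  qed
  then show ?thesis
    by (intro that[of G']) (auto simp: G'_def[abs_def])
qed

lemma in_Lp_imp_integrable:
  fixes f :: "'a::euclidean_space \<Rightarrow> 'b::euclidean_space"
  assumes V: "open V" "bounded V" and q: "q \<ge> 1" and f: "in_Lp q V f"
  shows "integrable (lebesgue_on V) f"
proof -
  interpret finite_measure "lebesgue_on V"
    by (intro finite_measure_lebesgue_on lmeasurable_open V)
  have "integrable (lebesgue_on V) (\<lambda>x. 1 + norm (f x) powr q)"
    using f by (simp add: in_Lp_def)
  then show ?thesis
  proof (rule Bochner_Integration.integrable_bound)
    show "f \<in> borel_measurable (lebesgue_on V)" using f by (simp add: in_Lp_def)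
    have "norm (f x) \<le> 1 + norm (f x) powr q" for x
    proof (cases "norm (f x) \<le> 1")
      case False
      then have "norm (f x) powr 1 \<le> norm (f x) powr q"
        using q by (intro powr_mono) auto
      then show ?thesis using False by simp
    qed (simp add: add_increasing2)
    then show "AE x in lebesgue_on V. norm (f x) \<le> norm (1 + norm (f x) powr q)"
      by (intro AE_I2) (simp add: abs_of_nonneg)
  qed
qed

text \<open>Freezing the time of a space-time test function gives a spatial one with the matching
  gradient. This links the slicewise weak gradient of the definition to a weak gradient on the
  cylinder.\<close>

lemma test_function_slice:
  fixes U :: "'a::euclidean_space set" and I :: "real set"
  assumes \<phi>: "test_function (U \<times> I) \<phi>" and b: "b \<in> Basis"
  shows "test_function U (\<lambda>x. \<phi> (x, t))"
    and "grad (\<lambda>x. \<phi> (x, t)) x \<bullet> b = frechet_derivative \<phi> (at (x, t)) (b, 0)"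
proof -
  show "grad (\<lambda>x. \<phi> (x, t)) x \<bullet> b = frechet_derivative \<phi> (at (x, t)) (b, 0)"
    using grad_x_inner[OF test_functionD(4)[OF \<phi>] b, of "(x, t)"] by (simp add: grad_x_def)
  have L: "bounded_linear (\<lambda>x :: 'a. (x, 0 :: real))"
    by (intro bounded_linear_Pair bounded_linear_ident bounded_linear_zero)
  have "C_k k (\<lambda>x. \<phi> ((0, t) + (x, 0)))" for k
    using \<phi> by (intro C_k_affine[OF _ L]) (simp add: test_function_def)
  then have C: "C_k k (\<lambda>x. \<phi> (x, t))" for k by simp
  let ?K = "closure {z. \<phi> z \<noteq> 0}"
  have "compact ((\<lambda>x. (x, t)) -` ?K)"
  proof -
    have "bounded (fst ` ?K)"
      using test_functionD(5)[OF \<phi>] by (intro bounded_fst compact_imp_bounded)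
    then have "bounded ((\<lambda>x. (x, t)) -` ?K)"
    proof (rule bounded_subset, intro subsetI)
      fix x assume "x \<in> (\<lambda>x. (x, t)) -` ?K"
      then have "fst (x, t) \<in> fst ` ?K" by (intro imageI) simp
      then show "x \<in> fst ` ?K" by simp
    qed
    moreover have "closed ((\<lambda>x. (x, t)) -` ?K)"
      by (intro continuous_closed_vimage closed_closure) (auto intro!: continuous_intros)
    ultimately show ?thesis by (simp add: compact_eq_bounded_closed)
  qed
  moreover have sub: "closure {x. \<phi> (x, t) \<noteq> 0} \<subseteq> (\<lambda>x. (x, t)) -` ?K"
  proof (rule closure_minimal)
    show "{x. \<phi> (x, t) \<noteq> 0} \<subseteq> (\<lambda>x. (x, t)) -` ?K"
      using closure_subset[of "{z. \<phi> z \<noteq> 0}"] by auto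
    show "closed ((\<lambda>x. (x, t)) -` ?K)"
      by (intro continuous_closed_vimage closed_closure) (auto intro!: continuous_intros)
  qed
  ultimately have "compact (closure {x. \<phi> (x, t) \<noteq> 0})"
    using compact_Int_closed[of _ "closure {x. \<phi> (x, t) \<noteq> 0}"] by (metis closed_closure inf.absorb_iff2)
  moreover have "closure {x. \<phi> (x, t) \<noteq> 0} \<subseteq> U"
    using sub test_functionD(6)[OF \<phi>] by auto
  ultimately show "test_function U (\<lambda>x. \<phi> (x, t))"
    using C by (simp add: test_function_def compactly_in_def)
qed

lemma borel_measurable_lebesgue_on:
  fixes f :: "'a::euclidean_space \<Rightarrow> 'b::topological_space"
  shows "f \<in> borel_measurable borel \<Longrightarrow> f \<in> borel_measurable (lebesgue_on V)"
  by (intro measurable_restrict_space1 measurable_completion) simp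

text \<open>What the energy argument takes from a solution, restated over \<open>lborel\<close> with
  extension by zero. The definition provides a weak gradient on almost every time slice; integrating
  the slice identities in time gives the one on the cylinder.\<close>

lemma p_parabolic_borel_data:
  fixes h :: "'a::euclidean_space \<times> real \<Rightarrow> real"
  assumes p: "p > 1" and h: "p_parabolic p B h" and U: "open U" and s: "s1 < s2"
    and comp: "compactly_in (U \<times> {s1<..<s2}) B"
  defines "V \<equiv> U \<times> {s1<..<s2}"
  obtains G where "G \<in> borel_measurable borel" "\<And>z. z \<notin> V \<Longrightarrow> G z = 0"
    "integrable lborel (\<lambda>z. norm (G z) powr p)"
    "integrable lborel (\<lambda>z. indicator V z * h z)"
    "\<And>\<phi> i. test_function V \<phi> \<Longrightarrow> i \<in> Basis \<Longrightarrow>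
      (LINT z|lborel. frechet_derivative \<phi> (at z) (i, 0) * (indicator V z * h z)) = - (LINT z|lborel. \<phi> z * (G z \<bullet> i))"
    "\<And>\<phi>. test_function V \<phi> \<Longrightarrow>
      (LINT z|lborel. frechet_derivative \<phi> (at z) (0, 1) * (indicator V z * h z))
      = (LINT z|lborel. (norm (G z) powr (p - 2) *\<^sub>R G z) \<bullet> grad_x \<phi> z)"
proof -
  have Vo: "open V" unfolding V_def using U by (intro open_Times) auto
  have Vc: "compact (closure V)" "closure V \<subseteq> B"
    using comp by (auto simp: compactly_in_def V_def)
  then have Vb: "bounded V"
    using bounded_subset[OF compact_imp_bounded closure_subset] by blast
  have "U = fst ` V" unfolding V_def using dense[OF s] by force
  then have Ub: "bounded U" using bounded_fst[OF Vb] by simp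
  have hc: "continuous_on (closure V) h"
    using h Vc(2) continuous_on_subset unfolding p_parabolic_def by blast
  have "bounded (h ` closure V)"
    using hc Vc(1) by (intro compact_imp_bounded compact_continuous_image)
  then obtain Mh where Mh: "\<And>z. z \<in> V \<Longrightarrow> \<bar>h z\<bar> \<le> Mh"
    using closure_subset[of V] by (force simp: bounded_iff)
  define hh where "hh z = indicator V z * h z" for z
  have hhm[measurable]: "hh \<in> borel_measurable borel"
    using borel_measurable_continuous_on_indicator[OF borel_open[OF Vo] continuous_on_subset[OF hc closure_subset]]
    by (simp add: hh_def[abs_def])
  have hhb: "\<bar>hh z\<bar> \<le> \<bar>Mh\<bar>" for z
    using Mh[of z] by (cases "z \<in> V") (auto simp: hh_def)
  have hhi: "integrable lborel hh"
    by (rule integrable_bounded_support[OF hhm hhb Vb]) (simp add: hh_def)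
  have "\<exists>G. parabolic_sobolev_with_grad p U s1 s2 (\<lambda>z. ereal (h z)) G \<and>
           (\<forall>\<phi>. test_function V \<phi> \<longrightarrow>
              (LINT z|lebesgue_on V. (norm (G z) powr (p - 2) *\<^sub>R G z) \<bullet> grad_x \<phi> z)
            - (LINT z|lebesgue_on V. real_of_ereal (ereal (h z)) * deriv_t \<phi> z) = 0)"
    using h U s comp unfolding p_parabolic_def weak_solution_def V_def by blast
  then obtain G0 where
    sob: "parabolic_sobolev_with_grad p U s1 s2 (\<lambda>z. ereal (h z)) G0" and
    eqn: "\<And>\<phi>. test_function V \<phi> \<Longrightarrow>
              (LINT z|lebesgue_on V. (norm (G0 z) powr (p - 2) *\<^sub>R G0 z) \<bullet> grad_x \<phi> z)
            - (LINT z|lebesgue_on V. h z * deriv_t \<phi> z) = 0"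
    unfolding real_of_ereal.simps by blast
  have G0: "G0 \<in> borel_measurable (lebesgue_on V)" "integrable (lebesgue_on V) (\<lambda>z. norm (G0 z) powr p)"
    and sl: "AE t in lebesgue_on {s1<..<s2}. sobolev_with_grad p U (\<lambda>x. h (x, t)) (\<lambda>x. G0 (x, t))"
    using sob by (auto simp: parabolic_sobolev_with_grad_def in_Lp_def V_def)
  obtain G where Gm: "G \<in> borel_measurable borel" and GG: "AE z in lborel. z \<in> V \<longrightarrow> G0 z = G z"
    and Goff: "\<And>z. z \<notin> V \<Longrightarrow> G z = 0"
    using lebesgue_on_ex_borel_version[OF Vo G0(1)] by blast
  have Gp: "integrable lborel (\<lambda>z. norm (G z) powr p)"
  proof (subst lebesgue_on_borel_version(2)[OF Vo, symmetric])
    show "AE z in lborel. indicator V z *\<^sub>R norm (G0 z) powr p = norm (G z) powr p"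
      by (rule AE_mp[OF GG]) (auto intro!: AE_I2 simp: Goff indicator_def)
  qed (use G0 Gm in auto)
  have Gi: "integrable lborel (\<lambda>z. G z \<bullet> i)" for i
  proof -
    have "in_Lp p V G0" using G0 by (simp add: in_Lp_def)
    then have "integrable (lebesgue_on V) G0"
      using p by (intro in_Lp_imp_integrable[OF Vo Vb, of p]) auto
    moreover have "AE z in lborel. indicator V z *\<^sub>R G0 z = G z"
      by (rule AE_mp[OF GG]) (auto intro!: AE_I2 simp: Goff indicator_def)
    ultimately have "integrable lborel G"
      using lebesgue_on_borel_version(2)[OF Vo G0(1) Gm] by blast
    then show ?thesis by simp
  qed
  have p1: "(LINT z|lborel. frechet_derivative \<phi> (at z) (i, 0) * hh z) = - (LINT z|lborel. \<phi> z * (G z \<bullet> i))"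
    if \<phi>: "test_function V \<phi>" and i: "i \<in> Basis" for \<phi> i
  proof -
    define d where "d z = frechet_derivative \<phi> (at z) (i, 0)" for z
    have dc: "continuous_on UNIV d" unfolding d_def by (rule test_functionD(2)[OF \<phi> Basis_prod_left[OF i]])
    have \<phi>c: "continuous_on UNIV \<phi>" by (rule test_functionD(3)[OF \<phi>])
    obtain Cd where Cd: "Cd \<ge> 0" "\<And>z. \<bar>d z\<bar> \<le> Cd"
      using continuous_compact_support_bounded[OF dc test_functionD(5)[OF \<phi>]] test_functionD(8)[OF \<phi>] unfolding d_def by blast
    obtain Cp where Cp: "Cp \<ge> 0" "\<And>z. \<bar>\<phi> z\<bar> \<le> Cp"
      using continuous_compact_support_bounded[OF \<phi>c test_functionD(5)[OF \<phi>]] test_functionD(7)[OF \<phi>] by blast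
    have [measurable]: "d \<in> borel_measurable borel" "\<phi> \<in> borel_measurable borel" "G \<in> borel_measurable borel"
      using borel_measurable_continuous_onI[OF dc] borel_measurable_continuous_onI[OF \<phi>c] Gm by auto
    have i1: "integrable lborel (\<lambda>z. d z * hh z)"
    proof (rule integrable_bounded_support[OF _ _ Vb])
      show "\<bar>d z * hh z\<bar> \<le> Cd * \<bar>Mh\<bar>" for z
        unfolding abs_mult using Cd hhb by (intro mult_mono) auto
      show "d z * hh z = 0" if "z \<notin> V" for z using that by (simp add: hh_def)
    qed simp
    have i2: "integrable lborel (\<lambda>z. \<phi> z * (G z \<bullet> i))"
    proof (rule Bochner_Integration.integrable_bound[of _ "\<lambda>z. Cp * (G z \<bullet> i)"])
      show "AE z in lborel. norm (\<phi> z * (G z \<bullet> i)) \<le> norm (Cp * (G z \<bullet> i))"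
        using Cp by (intro AE_I2) (auto simp: abs_mult intro!: mult_right_mono)
    qed (use Gi[of i] in auto)
    have sl': "AE t in lborel. t \<in> {s1<..<s2} \<longrightarrow> sobolev_with_grad p U (\<lambda>x. h (x, t)) (\<lambda>x. G0 (x, t))"
      using sl by (simp add: AE_restrict_space_iff AE_completion_iff borel_open)
    \<comment> \<open>At almost every time the slice is a Sobolev function and, by Fubini for null
      sets, \<open>G\<close> agrees with \<open>G0\<close> almost everywhere on it.\<close>
    have "AE t in lborel. (LINT x|lborel. d (x, t) * hh (x, t) + \<phi> (x, t) * (G (x, t) \<bullet> i)) = 0"
    proof (rule AE_mp[OF AE_conjI[OF sl' AE_lborel_slice_snd[OF GG]]], intro AE_I2 impI, elim conjE)
      fix t
      assume S: "t \<in> {s1<..<s2} \<longrightarrow> sobolev_with_grad p U (\<lambda>x. h (x, t)) (\<lambda>x. G0 (x, t))"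
        and ae: "AE x in lborel. (x, t) \<in> V \<longrightarrow> G0 (x, t) = G (x, t)"
      show "(LINT x|lborel. d (x, t) * hh (x, t) + \<phi> (x, t) * (G (x, t) \<bullet> i)) = 0"
      proof (cases "t \<in> {s1<..<s2}")
        case False
        then have "(x, t) \<notin> V" for x by (simp add: V_def)
        then show ?thesis by (simp add: hh_def Goff)
      next
        case True
        let ?\<psi> = "\<lambda>x. \<phi> (x, t)"
        have \<psi>: "test_function U ?\<psi>" and gr: "grad ?\<psi> x \<bullet> i = d (x, t)" for x
          using test_function_slice[OF \<phi>[unfolded V_def] i] by (auto simp: d_def)
        have inV: "(x, t) \<in> V \<longleftrightarrow> x \<in> U" for x using True by (simp add: V_def)
        from S True have Lp: "in_Lp p U (\<lambda>x. h (x, t))" "in_Lp p U (\<lambda>x. G0 (x, t))"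
          and wk: "(LINT x|lebesgue_on U. h (x, t) *\<^sub>R grad ?\<psi> x) = - (LINT x|lebesgue_on U. ?\<psi> x *\<^sub>R G0 (x, t))"
          using \<psi> by (auto simp: sobolev_with_grad_def)
        have hm: "(\<lambda>x. h (x, t)) \<in> borel_measurable (lebesgue_on U)" "(\<lambda>x. G0 (x, t)) \<in> borel_measurable (lebesgue_on U)"
          using Lp by (auto simp: in_Lp_def)
        have gc: "continuous_on UNIV (grad ?\<psi>)"
          unfolding grad_def[abs_def] by (intro continuous_on_sum continuous_on_scaleR continuous_on_const test_functionD(2)[OF \<psi>])
        have grm: "grad ?\<psi> \<in> borel_measurable (lebesgue_on U)" "?\<psi> \<in> borel_measurable (lebesgue_on U)"
          by (intro borel_measurable_lebesgue_on borel_measurable_continuous_onI gc test_functionD(3)[OF \<psi>])+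
        obtain Cg where Cg: "Cg \<ge> 0" "\<And>x. x \<in> U \<Longrightarrow> norm (grad ?\<psi> x) \<le> Cg"
          using continuous_bounded_on_bounded[OF gc Ub] by blast
        have j1: "integrable (lebesgue_on U) (\<lambda>x. h (x, t) *\<^sub>R grad ?\<psi> x)"
        proof (rule integrable_on_bounded_open[OF U Ub])
          show "norm (h (x, t) *\<^sub>R grad ?\<psi> x) \<le> \<bar>Mh\<bar> * Cg" if "x \<in> U" for x
            using Cg(2)[OF that] Mh[of "(x, t)"] that inV[of x] by (auto intro!: mult_mono)
        qed (use hm grm in simp)
        have j2: "integrable (lebesgue_on U) (\<lambda>x. ?\<psi> x *\<^sub>R G0 (x, t))"
        proof (rule Bochner_Integration.integrable_bound[of _ "\<lambda>x. Cp *\<^sub>R G0 (x, t)"])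
          show "integrable (lebesgue_on U) (\<lambda>x. Cp *\<^sub>R G0 (x, t))"
            using in_Lp_imp_integrable[OF U Ub _ Lp(2)] p by simp
          show "(\<lambda>x. ?\<psi> x *\<^sub>R G0 (x, t)) \<in> borel_measurable (lebesgue_on U)"
            using hm grm by simp
          show "AE x in lebesgue_on U. norm (?\<psi> x *\<^sub>R G0 (x, t)) \<le> norm (Cp *\<^sub>R G0 (x, t))"
            using Cp by (intro AE_I2) (auto intro!: mult_right_mono)
        qed
        have t_slice: "(\<lambda>x. (x, t)) \<in> borel_measurable borel"
          by (intro borel_measurable_continuous_onI continuous_intros)
        have sm: "(\<lambda>x. d (x, t) * hh (x, t)) \<in> borel_measurable borel" "(\<lambda>x. ?\<psi> x * (G (x, t) \<bullet> i)) \<in> borel_measurable borel"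
          using measurable_compose[OF t_slice, of "\<lambda>z. d z * hh z" borel] measurable_compose[OF t_slice, of "\<lambda>z. \<phi> z * (G z \<bullet> i)" borel]
          by simp_all
        have a1: "(LINT x|lebesgue_on U. (h (x, t) *\<^sub>R grad ?\<psi> x) \<bullet> i) = (LINT x|lborel. d (x, t) * hh (x, t))"
          "integrable lborel (\<lambda>x. d (x, t) * hh (x, t))"
        proof -
          have m: "(\<lambda>x. (h (x, t) *\<^sub>R grad ?\<psi> x) \<bullet> i) \<in> borel_measurable (lebesgue_on U)"
            by (intro borel_measurable_inner borel_measurable_scaleR hm grm borel_measurable_const)
          have e: "AE x in lborel. indicator U x *\<^sub>R ((h (x, t) *\<^sub>R grad ?\<psi> x) \<bullet> i) = d (x, t) * hh (x, t)"
            using inV by (intro AE_I2) (auto simp: gr hh_def indicator_def)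
          note B = lebesgue_on_borel_version[OF U m sm(1) e]
          show "(LINT x|lebesgue_on U. (h (x, t) *\<^sub>R grad ?\<psi> x) \<bullet> i) = (LINT x|lborel. d (x, t) * hh (x, t))"
            by (rule B(1))
          show "integrable lborel (\<lambda>x. d (x, t) * hh (x, t))"
            using B(2) integrable_inner_left[of i _ "\<lambda>x. h (x, t) *\<^sub>R grad ?\<psi> x"] j1 by blast
        qed
        have a2: "(LINT x|lebesgue_on U. (?\<psi> x *\<^sub>R G0 (x, t)) \<bullet> i) = (LINT x|lborel. ?\<psi> x * (G (x, t) \<bullet> i))"
          "integrable lborel (\<lambda>x. ?\<psi> x * (G (x, t) \<bullet> i))"
        proof -
          have m: "(\<lambda>x. (?\<psi> x *\<^sub>R G0 (x, t)) \<bullet> i) \<in> borel_measurable (lebesgue_on U)"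
            by (intro borel_measurable_inner borel_measurable_scaleR hm grm borel_measurable_const)
          have e: "AE x in lborel. indicator U x *\<^sub>R ((?\<psi> x *\<^sub>R G0 (x, t)) \<bullet> i) = ?\<psi> x * (G (x, t) \<bullet> i)"
            by (rule AE_mp[OF ae]) (auto intro!: AE_I2 simp: inV Goff indicator_def)
          note B = lebesgue_on_borel_version[OF U m sm(2) e]
          show "(LINT x|lebesgue_on U. (?\<psi> x *\<^sub>R G0 (x, t)) \<bullet> i) = (LINT x|lborel. ?\<psi> x * (G (x, t) \<bullet> i))"
            by (rule B(1))
          show "integrable lborel (\<lambda>x. ?\<psi> x * (G (x, t) \<bullet> i))"
            using B(2) integrable_inner_left[of i _ "\<lambda>x. ?\<psi> x *\<^sub>R G0 (x, t)"] j2 by blast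
        qed
        have "(LINT x|lborel. d (x, t) * hh (x, t)) = (LINT x|lebesgue_on U. h (x, t) *\<^sub>R grad ?\<psi> x) \<bullet> i"
          unfolding a1(1)[symmetric] by (rule integral_inner_left) (rule j1)
        also have "\<dots> = - ((LINT x|lebesgue_on U. ?\<psi> x *\<^sub>R G0 (x, t)) \<bullet> i)"
          unfolding wk by (rule inner_minus_left)
        also have "(LINT x|lebesgue_on U. ?\<psi> x *\<^sub>R G0 (x, t)) \<bullet> i = (LINT x|lborel. ?\<psi> x * (G (x, t) \<bullet> i))"
          unfolding a2(1)[symmetric] by (rule integral_inner_left[symmetric]) (rule j2)
        finally show ?thesis
          by (subst Bochner_Integration.integral_add[OF a1(2) a2(2)]) linarith
      qed
    qed
    then have "(LINT z|lborel. d z * hh z + \<phi> z * (G z \<bullet> i)) = 0"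
      using i1 i2 by (subst lborel_integral_snd) (auto intro: integral_eq_zero_AE)
    then have "(LINT z|lborel. d z * hh z) + (LINT z|lborel. \<phi> z * (G z \<bullet> i)) = 0"
      by (subst (asm) Bochner_Integration.integral_add[OF i1 i2])
    then show ?thesis unfolding d_def by linarith
  qed
  have p2: "(LINT z|lborel. frechet_derivative \<phi> (at z) (0, 1) * hh z)
      = (LINT z|lborel. (norm (G z) powr (p - 2) *\<^sub>R G z) \<bullet> grad_x \<phi> z)"
    if \<phi>: "test_function V \<phi>" for \<phi>
  proof -
    note gm = grad_x_borel[OF \<phi>]
    have hm: "h \<in> borel_measurable (lebesgue_on V)"
      using continuous_on_subset[OF hc closure_subset] Vo by (intro continuous_imp_measurable_on_sets_lebesgue) auto
    have "(LINT z|lebesgue_on V. h z * deriv_t \<phi> z) = (LINT z|lborel. deriv_t \<phi> z * hh z)"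
    proof (rule lebesgue_on_borel_version(1)[OF Vo])
      show "(\<lambda>z. h z * deriv_t \<phi> z) \<in> borel_measurable (lebesgue_on V)"
        by (intro borel_measurable_times hm borel_measurable_lebesgue_on gm(2))
      show "(\<lambda>z. deriv_t \<phi> z * hh z) \<in> borel_measurable borel"
        by (intro borel_measurable_times gm(2) hhm)
      show "AE z in lborel. indicator V z *\<^sub>R (h z * deriv_t \<phi> z) = deriv_t \<phi> z * hh z"
        by (intro AE_I2) (simp add: hh_def)
    qed
    moreover have "(LINT z|lebesgue_on V. (norm (G0 z) powr (p - 2) *\<^sub>R G0 z) \<bullet> grad_x \<phi> z)
        = (LINT z|lborel. (norm (G z) powr (p - 2) *\<^sub>R G z) \<bullet> grad_x \<phi> z)"
    proof (rule lebesgue_on_borel_version(1)[OF Vo])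
      show "(\<lambda>z. (norm (G0 z) powr (p - 2) *\<^sub>R G0 z) \<bullet> grad_x \<phi> z) \<in> borel_measurable (lebesgue_on V)"
        using G0(1) borel_measurable_lebesgue_on[OF gm(1), of V] by measurable
      show "(\<lambda>z. (norm (G z) powr (p - 2) *\<^sub>R G z) \<bullet> grad_x \<phi> z) \<in> borel_measurable borel"
        using Gm gm(1) by measurable
      show "AE z in lborel. indicator V z *\<^sub>R ((norm (G0 z) powr (p - 2) *\<^sub>R G0 z) \<bullet> grad_x \<phi> z)
          = (norm (G z) powr (p - 2) *\<^sub>R G z) \<bullet> grad_x \<phi> z"
        by (rule AE_mp[OF GG]) (auto intro!: AE_I2 simp: Goff indicator_def)
    qed
    ultimately show ?thesis
      using eqn[OF \<phi>] by (simp add: deriv_t_eq[OF test_functionD(4)[OF \<phi>]])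
  qed
  show ?thesis
    by (rule that[OF Gm Goff Gp hhi[unfolded hh_def] p1[unfolded hh_def] p2[unfolded hh_def]])
qed

section \<open>Comparison with the barrier\<close>

text \<open>By Cauchy-Schwarz the inner product is at least \<open>(norm X powr (p - 1) - norm Y
  powr (p - 1)) * (norm X - norm Y)\<close>, a product of factors of equal sign since the power is
  increasing.\<close>

lemma flux_monotone:
  fixes X Y :: "'a::real_inner"
  assumes "p > 2"
  shows "0 \<le> (norm X powr (p - 2) *\<^sub>R X - norm Y powr (p - 2) *\<^sub>R Y) \<bullet> (X - Y)"
proof -
  let ?x = "norm X" and ?y = "norm Y"
  have pw: "norm Z powr (p - 2) * norm Z = norm Z powr (p - 1)" for Z :: 'a
    using powr_mult_base[of "norm Z" "p - 2"] by (simp add: mult.commute)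
  have "(?x powr (p - 1) - ?y powr (p - 1)) * (?x - ?y) \<ge> 0"
  proof (cases "?x \<le> ?y")
    case True
    then have "?x powr (p - 1) \<le> ?y powr (p - 1)" using assms by (intro powr_mono2) auto
    with True show ?thesis by (intro mult_nonpos_nonpos) auto
  next
    case False
    then have "?y powr (p - 1) \<le> ?x powr (p - 1)" using assms by (intro powr_mono2) auto
    with False show ?thesis by (intro mult_nonneg_nonneg) auto
  qed
  also have "(?x powr (p - 1) - ?y powr (p - 1)) * (?x - ?y)
      = ?x powr (p - 2) * (?x * ?x) + ?y powr (p - 2) * (?y * ?y) - (?x powr (p - 2) + ?y powr (p - 2)) * (?x * ?y)"
    unfolding pw[symmetric] by (simp add: algebra_simps)
  also have "\<dots> \<le> ?x powr (p - 2) * (?x * ?x) + ?y powr (p - 2) * (?y * ?y) - (?x powr (p - 2) + ?y powr (p - 2)) * (X \<bullet> Y)"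
    using mult_left_mono[OF norm_cauchy_schwarz[of X Y], of "?x powr (p - 2) + ?y powr (p - 2)"] by simp
  also have "\<dots> = (?x powr (p - 2) *\<^sub>R X - ?y powr (p - 2) *\<^sub>R Y) \<bullet> (X - Y)"
    by (simp add: inner_diff_left inner_diff_right inner_commute[of Y X] dot_square_norm power2_eq_square algebra_simps)
  finally show ?thesis .
qed

lemma abs_diff_powr_le:
  fixes r s q :: real
  assumes "q \<ge> 0"
  shows "\<bar>s - r\<bar> powr q \<le> 2 powr q * (\<bar>s\<bar> powr q + \<bar>r\<bar> powr q)"
proof -
  have "\<bar>s - r\<bar> powr q \<le> (2 * max \<bar>s\<bar> \<bar>r\<bar>) powr q"
    using assms by (intro powr_mono2) auto
  also have "\<dots> = 2 powr q * max \<bar>s\<bar> \<bar>r\<bar> powr q"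
    by (simp add: powr_mult)
  also have "\<dots> \<le> 2 powr q * (\<bar>s\<bar> powr q + \<bar>r\<bar> powr q)"
    by (intro mult_left_mono) (auto simp: max_def)
  finally show ?thesis .
qed

lemma integrable_indicator_continuous:
  fixes f :: "'a::euclidean_space \<Rightarrow> real"
  assumes f: "continuous_on UNIV f" and V: "open V" "bounded V"
  shows "integrable lborel (\<lambda>z. indicator V z * f z)"
proof -
  obtain B where B: "B \<ge> 0" "\<And>z. z \<in> V \<Longrightarrow> norm (f z) \<le> B"
    using continuous_bounded_on_bounded[OF f V(2)] by blast
  have [measurable]: "f \<in> borel_measurable borel" "V \<in> sets borel"
    using borel_measurable_continuous_onI[OF f] borel_open[OF V(1)] by auto
  show ?thesis
  proof (rule integrable_bounded_support[OF _ _ V(2)])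
    show "\<bar>indicator V z * f z\<bar> \<le> B" for z
      using B by (cases "z \<in> V") auto
  qed auto
qed

lemma integrable_test_function_mult:
  fixes f :: "'a::euclidean_space \<Rightarrow> real"
  assumes \<phi>: "test_function V \<phi>" and f: "integrable lborel f"
  shows "integrable lborel (\<lambda>z. \<phi> z * f z)"
    and "b \<in> Basis \<Longrightarrow> integrable lborel (\<lambda>z. frechet_derivative \<phi> (at z) b * f z)"
proof -
  have *: "integrable lborel (\<lambda>z. g z * f z)"
    if g: "continuous_on UNIV g" "\<And>z. z \<notin> closure {z. \<phi> z \<noteq> 0} \<Longrightarrow> g z = 0" for g
  proof -
    obtain C where C: "C \<ge> 0" "\<And>z. \<bar>g z\<bar> \<le> C"
      using continuous_compact_support_bounded[OF g(1) test_functionD(5)[OF \<phi>] g(2)] by blast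
    have [measurable]: "g \<in> borel_measurable borel" using borel_measurable_continuous_onI[OF g(1)] .
    show ?thesis
    proof (rule Bochner_Integration.integrable_bound[of _ "\<lambda>z. C * f z"])
      show "AE z in lborel. norm (g z * f z) \<le> norm (C * f z)"
        using C by (intro AE_I2) (auto simp: abs_mult intro!: mult_right_mono)
    qed (use f in auto)
  qed
  show "integrable lborel (\<lambda>z. \<phi> z * f z)"
    by (rule *[OF test_functionD(3)[OF \<phi>] test_functionD(7)[OF \<phi>]])
  show "b \<in> Basis \<Longrightarrow> integrable lborel (\<lambda>z. frechet_derivative \<phi> (at z) b * f z)"
    by (rule *[OF test_functionD(2)[OF \<phi>] test_functionD(8)[OF \<phi>]])
qed

text \<open>The exponential depends on time only, so \<open>W\<close> has the gradient and flux of
  the barrier, with the excess \<open>\<kappa>0 = \<delta> * m * exp (m * (t - t0))\<close> in its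
  time derivative. That excess is positive throughout \<open>V\<close>, so the energy limit excludes
  \<open>h > W\<close> on a set of positive measure; \<open>K\<close> keeps the positive part of
  \<open>h - W\<close> away from the boundary of \<open>V\<close>.\<close>

lemma strict_comparison_AE:
  fixes y :: "'a::euclidean_space" and h :: "'a \<times> real \<Rightarrow> real" and c t0 :: real
  assumes p: "p > 2" and l: "l = p / (p - 1)" and a: "a > 0" and b: "b = real DIM('a) * (a * l) powr (p - 1)"
    and \<delta>: "\<delta> > 0" "m > 0"
    and h: "p_parabolic p B h" and U: "open U" and s: "s1 < s2" and comp: "compactly_in (U \<times> {s1<..<s2}) B"
  defines "V \<equiv> U \<times> {s1<..<s2}"
    and "W \<equiv> \<lambda>z. c + (a * norm (fst z - y) powr l + b * snd z) + \<delta> * exp (m * (snd z - t0))"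
  assumes K: "compact K" "K \<subseteq> V" "\<And>z. z \<in> V \<Longrightarrow> z \<notin> K \<Longrightarrow> h z \<le> W z"
  shows "AE z in lborel. z \<in> V \<longrightarrow> h z \<le> W z"
proof -
  \<comment> \<open>The conjugate exponent: the flux has norm \<open>norm G powr (p - 1)\<close>,
    and \<open>(p - 1) * q = p\<close> makes its \<open>q\<close>-th power integrable.\<close>
  define q where "q = p / (p - 1)"
  have q1: "q > 1" "q \<ge> 0" and qp: "(p - 1) * q = p" using p by (auto simp: q_def less_divide_eq)
  have l1: "l > 1" using p by (simp add: l less_divide_eq)
  have Vo: "open V" unfolding V_def using U by (intro open_Times) auto
  have Vc: "compact (closure V)" "closure V \<subseteq> B"
    using comp by (auto simp: compactly_in_def V_def)
  then have Vb: "bounded V"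
    using bounded_subset[OF compact_imp_bounded closure_subset] by blast
  have p1: "p > 1" using p by simp
  obtain G where G: "G \<in> borel_measurable borel" "\<And>z. z \<notin> V \<Longrightarrow> G z = 0"
    "integrable lborel (\<lambda>z. norm (G z) powr p)"
    "integrable lborel (\<lambda>z. indicator V z * h z)"
    "\<And>\<phi> i. test_function V \<phi> \<Longrightarrow> i \<in> Basis \<Longrightarrow>
      (LINT z|lborel. frechet_derivative \<phi> (at z) (i, 0) * (indicator V z * h z)) = - (LINT z|lborel. \<phi> z * (G z \<bullet> i))"
    "\<And>\<phi>. test_function V \<phi> \<Longrightarrow>
      (LINT z|lborel. frechet_derivative \<phi> (at z) (0, 1) * (indicator V z * h z))
      = (LINT z|lborel. (norm (G z) powr (p - 2) *\<^sub>R G z) \<bullet> grad_x \<phi> z)"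
    by (rule p_parabolic_borel_data[OF p1 h U s comp, folded V_def]) (rule that)
  define gw :: "'a \<times> real \<Rightarrow> 'a" where "gw z = a *\<^sub>R grad_norm_powr l (fst z - y)" for z
  define A where "A = (a * l) powr (p - 1)"
  have flux: "norm (gw z) powr (p - 2) *\<^sub>R gw z = A *\<^sub>R (fst z - y)" for z
    unfolding gw_def A_def by (rule flux_norm_powr[OF p l a])
  define fG where "fG z = norm (G z) powr (p - 2) *\<^sub>R G z" for z
  have fG_norm: "norm (fG z) = norm (G z) powr (p - 1)" for z
    unfolding fG_def using powr_mult_base[of "norm (G z)" "p - 2"] by (simp add: mult.commute)
  have fGm: "fG \<in> borel_measurable borel"
    unfolding fG_def[abs_def] using G(1) by measurable
  define \<kappa>0 where "\<kappa>0 z = \<delta> * m * exp (m * (snd z - t0))" for z :: "'a \<times> real"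
  have gwc: "continuous_on UNIV gw"
    unfolding gw_def by (intro continuous_intros continuous_on_compose2[OF continuous_grad_norm_powr[OF l1]]) auto
  have Wc: "continuous_on UNIV W"
    unfolding W_def using l1 by (intro continuous_intros continuous_on_powr') auto
  have \<kappa>c: "continuous_on UNIV \<kappa>0"
    unfolding \<kappa>0_def by (intro continuous_intros)
  have Wx: "has_dir_deriv (i, 0) W (\<lambda>z. gw z \<bullet> i)" for i
  proof -
    have "((\<lambda>z. norm (fst z - y) powr l) has_derivative (\<lambda>v. grad_norm_powr l (fst z - y) \<bullet> fst v)) (at z)" for z :: "'a \<times> real"
      by (rule has_derivative_compose[of "\<lambda>z. fst z - y" "\<lambda>v. fst v", OF _ norm_powr_has_derivative[OF l1]])
        (auto intro!: derivative_eq_intros)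
    then have 1: "has_dir_deriv (i, 0 :: real) (\<lambda>z. norm (fst z - y) powr l) (\<lambda>z. grad_norm_powr l (fst z - y) \<bullet> fst (i, 0 :: real))"
      by (rule has_derivative_imp_has_dir_deriv)
    show ?thesis
      unfolding has_dir_deriv_def
    proof
      fix z :: "'a \<times> real"
      have "((\<lambda>s. c + (a * norm (fst z + s *\<^sub>R i - y) powr l + b * snd z) + \<delta> * exp (m * (snd z - t0)))
          has_real_derivative 0 + (a * (grad_norm_powr l (fst z - y) \<bullet> i) + 0) + 0) (at 0)"
        using has_dir_derivD[OF 1, of z] by (intro DERIV_add DERIV_cmult DERIV_const) simp
      then show "((\<lambda>s. W (z + s *\<^sub>R (i, 0))) has_real_derivative gw z \<bullet> i) (at 0)"
        by (simp add: W_def gw_def)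
    qed
  qed
  have Wt: "has_dir_deriv (0, 1) W (\<lambda>z. b + \<kappa>0 z)"
    unfolding has_dir_deriv_def
  proof
    fix z :: "'a \<times> real"
    have "((\<lambda>s. c + (a * norm (fst z - y) powr l + b * (snd z + s)) + \<delta> * exp (m * (snd z + s - t0)))
        has_real_derivative b + \<kappa>0 z) (at 0)"
      unfolding \<kappa>0_def by (rule derivative_eq_intros refl)+ simp
    then show "((\<lambda>s. W (z + s *\<^sub>R (0, 1))) has_real_derivative b + \<kappa>0 z) (at 0)"
      by (simp add: W_def)
  qed
  define e where "e z = indicator V z * (h z - W z)" for z
  define \<kappa> where "\<kappa> z = indicator V z * \<kappa>0 z" for z
  define E where "E i z = indicator V z * ((G z - gw z) \<bullet> i)" for i z
  define D where "D i z = indicator V z * ((fG z - A *\<^sub>R (fst z - y)) \<bullet> i)" for i z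
  have "bounded (h ` closure V)"
    using h Vc unfolding p_parabolic_def
    by (intro compact_imp_bounded compact_continuous_image) (auto intro: continuous_on_subset)
  then obtain Mh where Mh: "\<And>z. z \<in> V \<Longrightarrow> \<bar>h z\<bar> \<le> Mh"
    using closure_subset[of V] by (force simp: bounded_iff)
  obtain MW where MW: "MW \<ge> 0" "\<And>z. z \<in> V \<Longrightarrow> norm (W z) \<le> MW"
    using continuous_bounded_on_bounded[OF Wc Vb] by blast
  have [measurable]: "V \<in> sets borel" using borel_open[OF Vo] .
  have [measurable]: "G \<in> borel_measurable borel" "gw \<in> borel_measurable borel" "fG \<in> borel_measurable borel"
    using G(1) borel_measurable_continuous_onI[OF gwc] fGm by auto
  have ind1: "integrable lborel (\<lambda>z. indicator V z * 1 :: real)"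
    by (rule integrable_indicator_continuous[OF _ Vo Vb]) simp
  have eeq: "e = (\<lambda>z. indicator V z * h z - indicator V z * W z)"
    by (simp add: e_def fun_eq_iff right_diff_distrib)
  have ei: "integrable lborel e"
    unfolding eeq by (intro Bochner_Integration.integrable_diff G(4) integrable_indicator_continuous Wc Vo Vb)
  have Ep: "integrable lborel (\<lambda>z. \<bar>E i z\<bar> powr p)" and Ei: "integrable lborel (E i)" if i: "i \<in> Basis" for i
  proof -
    have gwi: "continuous_on UNIV (\<lambda>z. gw z \<bullet> i)" by (intro continuous_intros gwc)
    have gwp: "continuous_on UNIV (\<lambda>z. \<bar>gw z \<bullet> i\<bar> powr p)"
      using p by (intro continuous_on_powr' continuous_intros gwi) auto
    have dom: "integrable lborel (\<lambda>z. 2 powr p * (norm (G z) powr p + indicator V z * \<bar>gw z \<bullet> i\<bar> powr p))"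
      by (intro integrable_mult_right Bochner_Integration.integrable_add G(3) integrable_indicator_continuous gwp Vo Vb)
    have bd: "\<bar>E i z\<bar> powr p \<le> 2 powr p * (norm (G z) powr p + indicator V z * \<bar>gw z \<bullet> i\<bar> powr p)" for z
    proof (cases "z \<in> V")
      case True
      have "\<bar>E i z\<bar> powr p \<le> 2 powr p * (\<bar>G z \<bullet> i\<bar> powr p + \<bar>gw z \<bullet> i\<bar> powr p)"
        using True abs_diff_powr_le[of p "G z \<bullet> i" "gw z \<bullet> i"] p by (simp add: E_def inner_diff_left)
      also have "\<bar>G z \<bullet> i\<bar> powr p \<le> norm (G z) powr p"
        using p Basis_le_norm[OF i] by (intro powr_mono2) auto
      finally show ?thesis using True by simp
    qed (simp add: E_def)
    have Em[measurable]: "E i \<in> borel_measurable borel" unfolding E_def[abs_def] by measurable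
    show Ep: "integrable lborel (\<lambda>z. \<bar>E i z\<bar> powr p)"
      by (rule Bochner_Integration.integrable_bound[OF dom])
        (use bd in \<open>auto intro!: AE_I2 order_trans[OF _ abs_ge_self]\<close>)
    show "integrable lborel (E i)"
    proof (rule Bochner_Integration.integrable_bound[OF Bochner_Integration.integrable_add[OF ind1 Ep]])
      have "\<bar>E i z\<bar> \<le> indicator V z * 1 + \<bar>E i z\<bar> powr p" for z
      proof (cases "z \<in> V")
        case True
        then show ?thesis
          using powr_mono[of 1 p "\<bar>E i z\<bar>"] p by (cases "\<bar>E i z\<bar> \<le> 1") (auto simp: add_increasing2)
      qed (simp add: E_def)
      then show "AE z in lborel. norm (E i z) \<le> norm (indicator V z * 1 + \<bar>E i z\<bar> powr p)"
        by (intro AE_I2) (auto intro: order_trans[OF _ abs_ge_self])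
    qed simp
  qed
  have fGi: "integrable lborel (\<lambda>z. fG z \<bullet> i)" and Dq: "integrable lborel (\<lambda>z. \<bar>D i z\<bar> powr q)"
    and Di: "integrable lborel (D i)" if i: "i \<in> Basis" for i
  proof -
    have Ac: "continuous_on UNIV (\<lambda>z. (A *\<^sub>R (fst z - y)) \<bullet> i)" by (intro continuous_intros)
    have Aq: "continuous_on UNIV (\<lambda>z :: 'a \<times> real. \<bar>(A *\<^sub>R (fst z - y)) \<bullet> i\<bar> powr q)"
      using q1 by (intro continuous_on_powr' continuous_intros) auto
    have dom: "integrable lborel (\<lambda>z. 2 powr q * (norm (G z) powr p + indicator V z * \<bar>(A *\<^sub>R (fst z - y)) \<bullet> i\<bar> powr q))"
      by (intro integrable_mult_right Bochner_Integration.integrable_add G(3) integrable_indicator_continuous Aq Vo Vb)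
    have fq: "\<bar>fG z \<bullet> i\<bar> powr q \<le> norm (G z) powr p" for z
    proof -
      have "\<bar>fG z \<bullet> i\<bar> powr q \<le> norm (fG z) powr q"
        using q1 Basis_le_norm[OF i] by (intro powr_mono2) auto
      then show ?thesis by (simp add: fG_norm powr_powr qp)
    qed
    have bd: "\<bar>D i z\<bar> powr q \<le> 2 powr q * (norm (G z) powr p + indicator V z * \<bar>(A *\<^sub>R (fst z - y)) \<bullet> i\<bar> powr q)" for z
    proof (cases "z \<in> V")
      case True
      have "\<bar>D i z\<bar> powr q \<le> 2 powr q * (\<bar>fG z \<bullet> i\<bar> powr q + \<bar>(A *\<^sub>R (fst z - y)) \<bullet> i\<bar> powr q)"
        using True abs_diff_powr_le[OF q1(2), of "fG z \<bullet> i" "(A *\<^sub>R (fst z - y)) \<bullet> i"] by (simp add: D_def inner_diff_left)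
      also note fq
      finally show ?thesis using True by simp
    qed (simp add: D_def)
    have [measurable]: "(\<lambda>z :: 'a \<times> real. A *\<^sub>R (fst z - y)) \<in> borel_measurable borel"
      by (intro borel_measurable_continuous_onI continuous_intros)
    have Dm[measurable]: "D i \<in> borel_measurable borel"
      unfolding D_def[abs_def] by (intro borel_measurable_times borel_measurable_inner borel_measurable_diff) measurable
    show "integrable lborel (\<lambda>z. \<bar>D i z\<bar> powr q)"
      by (rule Bochner_Integration.integrable_bound[OF dom])
        (use bd in \<open>auto intro!: AE_I2 order_trans[OF _ abs_ge_self]\<close>)
    show f: "integrable lborel (\<lambda>z. fG z \<bullet> i)"
    proof (rule Bochner_Integration.integrable_bound[OF Bochner_Integration.integrable_add[OF ind1 G(3)]])
      have "\<bar>fG z \<bullet> i\<bar> \<le> indicator V z * 1 + norm (G z) powr p" for z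
      proof (cases "z \<in> V")
        case True
        then show ?thesis
          using powr_mono[of 1 q "\<bar>fG z \<bullet> i\<bar>"] q1 fq[of z]
          by (cases "\<bar>fG z \<bullet> i\<bar> \<le> 1") (auto simp: add_increasing2)
      qed (simp add: fG_def G(2))
      then show "AE z in lborel. norm (fG z \<bullet> i) \<le> norm (indicator V z * 1 + norm (G z) powr p)"
        by (intro AE_I2) (auto intro: order_trans[OF _ abs_ge_self])
    qed simp
    have "D i = (\<lambda>z. fG z \<bullet> i - indicator V z * ((A *\<^sub>R (fst z - y)) \<bullet> i))"
      by (auto simp: D_def fun_eq_iff inner_diff_left right_diff_distrib fG_def G(2) indicator_def)
    then show "integrable lborel (D i)"
      using Bochner_Integration.integrable_diff[OF f integrable_indicator_continuous[OF Ac Vo Vb]] by simp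
  qed
  have Gi: "integrable lborel (\<lambda>z. G z \<bullet> i)" if i: "i \<in> Basis" for i
  proof -
    have "(\<lambda>z. G z \<bullet> i) = (\<lambda>z. E i z + indicator V z * (gw z \<bullet> i))"
      by (auto simp: E_def fun_eq_iff inner_diff_left right_diff_distrib G(2) indicator_def)
    moreover have "integrable lborel (\<lambda>z. E i z + indicator V z * (gw z \<bullet> i))"
      by (intro Bochner_Integration.integrable_add Ei i integrable_indicator_continuous Vo Vb continuous_intros gwc)
    ultimately show ?thesis by simp
  qed
  interpret mollified_energy V K e \<kappa> E D p "\<bar>Mh\<bar> + MW"
  proof (unfold_locales)
    show "e z \<le> \<bar>Mh\<bar> + MW" for z
      using Mh[of z] MW(2)[of z] MW(1) by (cases "z \<in> V") (auto simp: e_def)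
    show "e z \<le> 0" if "z \<notin> K" for z
      using K(3)[of z] that by (cases "z \<in> V") (auto simp: e_def)
    show "integrable lborel \<kappa>"
      unfolding \<kappa>_def[abs_def] by (rule integrable_indicator_continuous[OF \<kappa>c Vo Vb])
    show "\<kappa> z \<ge> 0" for z using \<delta> by (simp add: \<kappa>_def \<kappa>0_def)
    show "integrable lborel (\<lambda>z. \<bar>D i z\<bar> powr (p / (p - 1)))" if "i \<in> Basis" for i
      using Dq[OF that] by (simp add: q_def)
    fix \<phi> assume \<phi>: "test_function V \<phi>"
    have off: "\<phi> z = 0" "frechet_derivative \<phi> (at z) v = 0" if "z \<notin> V" for z v
      using test_function_zero_outside[OF \<phi> that] test_function_deriv_zero_outside[OF \<phi> that] by auto
    have split_e: "(LINT z|lborel. frechet_derivative \<phi> (at z) v * e z)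
        = (LINT z|lborel. frechet_derivative \<phi> (at z) v * (indicator V z * h z))
          - (LINT z|lborel. W z * frechet_derivative \<phi> (at z) v)"
      if v: "v \<in> Basis" and W': "has_dir_deriv v W W'" "continuous_on UNIV W'" for v W'
    proof -
      have "frechet_derivative \<phi> (at z) v * e z = frechet_derivative \<phi> (at z) v * (indicator V z * h z)
          - W z * frechet_derivative \<phi> (at z) v" for z
        using off(2)[of z v] by (cases "z \<in> V") (auto simp: e_def algebra_simps)
      then show ?thesis
        using integrable_test_function_mult(2)[OF \<phi> G(4) v] test_function_ibp(1)[OF \<phi> v W'(1) Wc W'(2)]
        by (simp add: Bochner_Integration.integral_diff)
    qed
    show "(LINT z|lborel. frechet_derivative \<phi> (at z) (i, 0) * e z) = - (LINT z|lborel. \<phi> z * E i z)" if i: "i \<in> Basis" for i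
    proof -
      have gwi: "continuous_on UNIV (\<lambda>z. gw z \<bullet> i)" by (intro continuous_intros gwc)
      note ibp = test_function_ibp[OF \<phi> Basis_prod_left[OF i] Wx Wc gwi]
      have "\<phi> z * E i z = \<phi> z * (G z \<bullet> i) - (gw z \<bullet> i) * \<phi> z" for z
        using off(1)[of z] by (cases "z \<in> V") (auto simp: E_def inner_diff_left algebra_simps)
      then have "(LINT z|lborel. \<phi> z * E i z) = (LINT z|lborel. \<phi> z * (G z \<bullet> i)) - (LINT z|lborel. (gw z \<bullet> i) * \<phi> z)"
        using integrable_test_function_mult(1)[OF \<phi> Gi[OF i]] ibp(2) by (simp add: Bochner_Integration.integral_diff)
      then show ?thesis
        unfolding split_e[OF Basis_prod_left[OF i] Wx gwi] G(5)[OF \<phi> i] ibp(3) by simp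
    qed
    \<comment> \<open>The identity for \<open>h\<close> minus the one for \<open>W\<close>: the
      divergence of the linear flux and the linear time term of \<open>W\<close> both contribute
      \<open>b\<close> times the integral of \<open>\<phi>\<close> and cancel, so only
      \<open>\<kappa>\<close> survives.\<close>
    show "(LINT z|lborel. frechet_derivative \<phi> (at z) (0, 1) * e z) =
      (\<Sum>i\<in>Basis. LINT z|lborel. frechet_derivative \<phi> (at z) (i, 0) * D i z) + (LINT z|lborel. \<phi> z * \<kappa> z)"
    proof -
      have bc: "continuous_on UNIV (\<lambda>z. b + \<kappa>0 z)" by (intro continuous_intros \<kappa>c)
      note ibp = test_function_ibp[OF \<phi> Basis_prod_right Wt Wc bc]
      have \<phi>i: "integrable lborel \<phi>"
        by (rule integrable_continuous_compact_support[OF test_functionD(3)[OF \<phi>] test_functionD(5)[OF \<phi>] test_functionD(7)[OF \<phi>]])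
      have \<kappa>i: "integrable lborel (\<lambda>z. \<phi> z * \<kappa> z)"
        by (rule integrable_test_function_mult(1)[OF \<phi>])
          (unfold \<kappa>_def[abs_def], rule integrable_indicator_continuous[OF \<kappa>c Vo Vb])
      have "(b + \<kappa>0 z) * \<phi> z = b * \<phi> z + \<phi> z * \<kappa> z" for z
        using off(1)[of z] by (cases "z \<in> V") (auto simp: \<kappa>_def algebra_simps)
      then have 1: "(LINT z|lborel. (b + \<kappa>0 z) * \<phi> z) = b * (LINT z|lborel. \<phi> z) + (LINT z|lborel. \<phi> z * \<kappa> z)"
        using \<phi>i \<kappa>i by (simp add: Bochner_Integration.integral_add)
      have fx: "integrable lborel (\<lambda>z. frechet_derivative \<phi> (at z) (i, 0) * (fG z \<bullet> i))" if "i \<in> Basis" for i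
        by (rule integrable_test_function_mult(2)[OF \<phi> fGi[OF that] Basis_prod_left[OF that]])
      have fgr: "integrable lborel (\<lambda>z. fG z \<bullet> grad_x \<phi> z)"
        unfolding inner_grad_x[OF test_functionD(4)[OF \<phi>]]
        by (rule Bochner_Integration.integrable_sum) (use fx in \<open>simp add: mult.commute\<close>)
      note rad = radial_flux_test_function[OF \<phi>, of A y]
      have Ds: "(\<Sum>i\<in>Basis. frechet_derivative \<phi> (at z) (i, 0) * D i z) = fG z \<bullet> grad_x \<phi> z - (A *\<^sub>R (fst z - y)) \<bullet> grad_x \<phi> z" for z
      proof (cases "z \<in> V")
        case True
        then have "(\<Sum>i\<in>Basis. frechet_derivative \<phi> (at z) (i, 0) * D i z) = (fG z - A *\<^sub>R (fst z - y)) \<bullet> grad_x \<phi> z"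
          unfolding inner_grad_x[OF test_functionD(4)[OF \<phi>]] D_def by (simp add: mult.commute)
        then show ?thesis by (simp only: inner_diff_left)
      next
        case False
        then show ?thesis using grad_x_zero_outside[OF \<phi> False] by (simp add: off(2))
      qed
      have "(\<Sum>i\<in>Basis. LINT z|lborel. frechet_derivative \<phi> (at z) (i, 0) * D i z)
          = (LINT z|lborel. (\<Sum>i\<in>Basis. frechet_derivative \<phi> (at z) (i, 0) * D i z))"
        by (rule Bochner_Integration.integral_sum[symmetric])
          (intro integrable_test_function_mult(2)[OF \<phi>] Di Basis_prod_left)
      also have "\<dots> = (LINT z|lborel. fG z \<bullet> grad_x \<phi> z) - (LINT z|lborel. (A *\<^sub>R (fst z - y)) \<bullet> grad_x \<phi> z)"
        unfolding Ds by (rule Bochner_Integration.integral_diff[OF fgr rad(1)])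
      finally have 2: "(\<Sum>i\<in>Basis. LINT z|lborel. frechet_derivative \<phi> (at z) (i, 0) * D i z)
          = (LINT z|lborel. fG z \<bullet> grad_x \<phi> z) + b * (LINT z|lborel. \<phi> z)"
        unfolding rad(2) by (simp add: b A_def)
      show ?thesis
        unfolding split_e[OF Basis_prod_right Wt bc] ibp(3) 1 2 G(6)[OF \<phi>] by (simp add: fG_def)
    qed
  qed (use Vo Vb K ei Ep Ei Di p MW(1) in auto)
  have mono: "(\<Sum>i\<in>Basis. E i z * D i z) \<ge> 0" for z
  proof (cases "z \<in> V")
    case True
    then have "(\<Sum>i\<in>Basis. E i z * D i z) = (fG z - A *\<^sub>R (fst z - y)) \<bullet> (G z - gw z)"
      by (subst euclidean_inner) (simp add: E_def D_def mult.commute)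
    then show ?thesis
      using flux_monotone[OF assms(1), of "G z" "gw z"] by (simp add: flux fG_def)
  qed (simp add: E_def)
  have "AE z in lborel. pos2 (e z) * \<kappa> z = 0"
    by (rule energy_limit[OF mono])
  then show ?thesis
  proof (rule AE_mp, intro AE_I2 impI)
    fix z assume *: "pos2 (e z) * \<kappa> z = 0" and z: "z \<in> V"
    have "\<kappa> z > 0" using z \<delta> by (simp add: \<kappa>_def \<kappa>0_def)
    then have "max 0 (e z) = 0" using * by (simp add: pos2_def)
    then show "h z \<le> W z" using z by (simp add: e_def max_def split: if_splits)
  qed
qed

text \<open>Weak solutions are controlled only on cylinders compactly contained in their domain. The
  base is a distance neighbourhood of the projection of \<open>K\<close>; the end times lie halfway
  between those of \<open>K\<close> and of the large cylinder.\<close>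

lemma compactly_in_between:
  fixes K :: "('a::euclidean_space \<times> real) set"
  assumes K: "compact K" "K \<noteq> {}" "K \<subseteq> Q \<times> {t1<..<t2}" and Q: "open Q" "bounded Q"
  obtains U s1 s2 where "open U" "s1 < s2" "K \<subseteq> U \<times> {s1<..<s2}" "compactly_in (U \<times> {s1<..<s2}) (Q \<times> {t1<..<t2})"
proof -
  let ?C = "fst ` K" and ?T = "snd ` K"
  have C: "compact ?C" "?C \<noteq> {}" "?C \<subseteq> Q" and T: "compact ?T" "?T \<noteq> {}" "?T \<subseteq> {t1<..<t2}"
    using K by (auto intro!: compact_continuous_image continuous_intros)
  obtain d where d: "d > 0" "(\<Union>x\<in>?C. cball x d) \<subseteq> Q"
    using compact_subset_open_imp_cball_epsilon_subset[OF C(1) Q(1) C(3)] by blast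
  define U where "U = {x. infdist x ?C < d}"
  have U: "open U"
    unfolding U_def by (intro open_Collect_less continuous_intros)
  have "closure U \<subseteq> {x. infdist x ?C \<le> d}"
    unfolding U_def by (intro closure_minimal closed_Collect_le continuous_intros) auto
  also have "\<dots> \<subseteq> Q"
  proof
    fix x assume "x \<in> {x. infdist x ?C \<le> d}"
    moreover obtain c where "c \<in> ?C" "infdist x ?C = dist x c"
      using infdist_attains_inf[OF compact_imp_closed[OF C(1)] C(2), of x] by blast
    ultimately have "c \<in> ?C" "x \<in> cball c d" by (auto simp: dist_commute)
    then show "x \<in> Q" using d(2) by blast
  qed
  finally have UQ: "closure U \<subseteq> Q" .
  obtain tm where tm: "tm \<in> ?T" "\<And>t. t \<in> ?T \<Longrightarrow> tm \<le> t"
    using compact_attains_inf[OF T(1,2)] by blast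
  obtain tM where tM: "tM \<in> ?T" "\<And>t. t \<in> ?T \<Longrightarrow> t \<le> tM"
    using compact_attains_sup[OF T(1,2)] by blast
  define s1 where "s1 = (t1 + tm) / 2"
  define s2 where "s2 = (tM + t2) / 2"
  have s: "t1 < s1" "s1 < tm" "tM < s2" "s2 < t2"
    using tm(1) tM(1) T(3) unfolding s1_def s2_def by (auto simp: subset_iff)
  have s12: "s1 < s2" using s tm(2)[OF tM(1)] by linarith
  have "K \<subseteq> U \<times> {s1<..<s2}"
  proof
    fix z assume z: "z \<in> K"
    then have "fst z \<in> U" using d(1) by (simp add: U_def)
    moreover have "snd z \<in> {s1<..<s2}"
      using tm(2)[of "snd z"] tM(2)[of "snd z"] z s by auto
    ultimately show "z \<in> U \<times> {s1<..<s2}" by (simp add: mem_Times_iff)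
  qed
  moreover have "closure (U \<times> {s1<..<s2}) = closure U \<times> {s1..s2}"
    using s12 by (simp add: closure_Times)
  moreover have "compact (closure U)"
    using bounded_subset[OF Q(2) UQ] by (simp add: compact_eq_bounded_closed)
  ultimately show ?thesis
    using U s12 s UQ by (intro that[of U s1 s2]) (auto simp: compactly_in_def intro!: compact_Times)
qed

text \<open>Nothing is assumed about \<open>h\<close> at the final time, and equality is allowed on
  the parabolic boundary. The term \<open>\<delta> * exp (m * (t - t0))\<close> repairs both: it is
  positive everywhere and exceeds the maximal difference at \<open>t2\<close>, yet at the time
  \<open>t0\<close> of the supposed violation it is only half of that violation. Hence the set where
  \<open>h \<ge> W\<close> contains \<open>z\<close> and is compact inside the open cylinder,
  against strict comparison.\<close>

theorem barrier_comparison: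
  fixes y :: "'a::euclidean_space" and h :: "'a \<times> real \<Rightarrow> real" and c :: real
  assumes p: "p > 2" and l: "l = p / (p - 1)" and a: "a > 0" and b: "b = real DIM('a) * (a * l) powr (p - 1)"
    and Q: "open Q" "bounded Q" and t: "t1 < t2"
    and h: "p_parabolic p (Q \<times> {t1<..<t2}) h" "continuous_on (closure (Q \<times> {t1<..<t2})) h"
  defines "w \<equiv> \<lambda>z. c + (a * norm (fst z - y) powr l + b * snd z)"
  assumes le: "\<And>z. z \<in> parabolic_boundary Q t1 t2 \<Longrightarrow> h z \<le> w z" and z: "z \<in> Q \<times> {t1<..<t2}"
  shows "h z \<le> w z"
proof (rule ccontr)
  assume "\<not> h z \<le> w z"
  define B where "B = Q \<times> {t1<..<t2}"
  have zB: "z \<in> B" using z by (simp add: B_def)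
  have cB: "closure B = closure Q \<times> {t1..t2}"
    using t by (simp add: B_def closure_Times)
  have compB: "compact (closure B)"
    unfolding cB using Q(2) by (intro compact_Times) (auto simp: compact_eq_bounded_closed)
  have l1: "l > 1" using p by (simp add: l less_divide_eq)
  have wc: "continuous_on UNIV w"
    unfolding w_def using l1 by (intro continuous_intros continuous_on_powr') auto
  define \<delta> where "\<delta> = (h z - w z) / 2"
  have \<delta>: "\<delta> > 0" "h z - w z = 2 * \<delta>" using \<open>\<not> h z \<le> w z\<close> by (auto simp: \<delta>_def)
  have hw: "continuous_on (closure B) (\<lambda>z. h z - w z)"
    using h(2) continuous_on_subset[OF wc] by (intro continuous_on_diff) (auto simp: B_def)
  have "bounded ((\<lambda>z. h z - w z) ` closure B)"
    using compB hw by (intro compact_imp_bounded compact_continuous_image)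
  then obtain M where M: "\<And>z. z \<in> closure B \<Longrightarrow> \<bar>h z - w z\<bar> \<le> M"
    by (force simp: bounded_iff)
  have M0: "M \<ge> 0"
    using M[of z] zB closure_subset[of B] by (meson abs_ge_zero order_trans subsetD)
  define t0 where "t0 = snd z"
  have t0: "t1 < t0" "t0 < t2" using z by (auto simp: t0_def)
  \<comment> \<open>Chosen for \<open>\<delta> * (1 + m * (t2 - t0)) > M\<close>, which suffices
    because \<open>exp x \<ge> 1 + x\<close>.\<close>
  define m where "m = M / (\<delta> * (t2 - t0)) + 1"
  have m: "m > 0" using M0 \<delta>(1) t0 by (simp add: m_def add_nonneg_pos)
  have big: "\<delta> * exp (m * (t2 - t0)) > M"
  proof -
    have "m * (\<delta> * (t2 - t0)) = M + \<delta> * (t2 - t0)"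
      using \<delta>(1) t0 by (simp add: m_def distrib_right)
    then have "\<delta> * (1 + m * (t2 - t0)) = \<delta> + (M + \<delta> * (t2 - t0))"
      by (simp add: algebra_simps)
    moreover have "\<delta> * (t2 - t0) > 0" using \<delta>(1) t0 by simp
    ultimately have "M < \<delta> * (1 + m * (t2 - t0))" using \<delta>(1) by linarith
    also have "\<dots> \<le> \<delta> * exp (m * (t2 - t0))"
      using \<delta>(1) by (intro mult_left_mono exp_ge_add_one_self) auto
    finally show ?thesis .
  qed
  define W where "W z = w z + \<delta> * exp (m * (snd z - t0))" for z
  have Wc: "continuous_on UNIV W"
    unfolding W_def by (intro continuous_intros wc)
  define K where "K = {z \<in> closure B. 0 \<le> h z - W z}"
  have hW: "continuous_on (closure B) (\<lambda>z. h z - W z)"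
    using h(2) continuous_on_subset[OF Wc] by (intro continuous_on_diff) (auto simp: B_def)
  have K: "compact K"
  proof -
    have "closed (closure B \<inter> (\<lambda>z. h z - W z) -` {0..})"
      by (intro continuous_closed_preimage hW) auto
    moreover have "closure B \<inter> (\<lambda>z. h z - W z) -` {0..} = K" by (auto simp: K_def)
    ultimately show ?thesis
      using compB by (metis compact_Int_closed inf.left_idem)
  qed
  have zK: "z \<in> K"
    using zB closure_subset[of B] \<delta> by (auto simp: K_def W_def t0_def)
  have KB: "K \<subseteq> B"
  proof
    fix u assume u: "u \<in> K"
    obtain x s where xs: "u = (x, s)" by (cases u)
    have x: "x \<in> closure Q" "t1 \<le> s" "s \<le> t2" and ge: "W u \<le> h u"
      using u cB by (auto simp: K_def xs)
    have "w u < h u" using ge \<delta>(1) by (simp add: W_def) (smt (verit) exp_gt_zero mult_pos_pos)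
    then have "u \<notin> parabolic_boundary Q t1 t2" using le[of u] by auto
    then have "s \<noteq> t1" "x \<notin> frontier Q"
      using x by (auto simp: parabolic_boundary_def xs)
    moreover have "s \<noteq> t2"
    proof
      assume "s = t2"
      then have "h u - w u > M" using ge big by (simp add: W_def xs)
      then show False using M[of u] u by (auto simp: K_def)
    qed
    ultimately show "u \<in> B"
      using x Q(1) by (auto simp: B_def xs frontier_def interior_open)
  qed
  obtain U s1 s2 where U: "open U" "s1 < s2" "K \<subseteq> U \<times> {s1<..<s2}" "compactly_in (U \<times> {s1<..<s2}) (Q \<times> {t1<..<t2})"
    using compactly_in_between[OF K _ KB[unfolded B_def] Q] zK by blast
  let ?V = "U \<times> {s1<..<s2}"
  have VB: "?V \<subseteq> B"
    using U(4) closure_subset[of ?V] unfolding compactly_in_def B_def by blast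
  have "AE z in lborel. z \<in> ?V \<longrightarrow> h z \<le> c + (a * norm (fst z - y) powr l + b * snd z) + \<delta> * exp (m * (snd z - t0))"
  proof (rule strict_comparison_AE[OF p l a b \<delta>(1) m h(1) U(1,2,4) K U(3)])
    fix u assume "u \<in> ?V" "u \<notin> K"
    then have "h u - W u < 0"
      using VB closure_subset[of B] by (auto simp: K_def)
    then show "h u \<le> c + (a * norm (fst u - y) powr l + b * snd u) + \<delta> * exp (m * (snd u - t0))"
      by (simp add: W_def w_def)
  qed
  then have ae: "AE z in lborel. z \<notin> {z \<in> ?V. h z > W z}"
    by (rule eventually_mono) (auto simp: W_def w_def)
  have "open {z \<in> ?V. h z > W z}"
  proof -
    have "continuous_on ?V (\<lambda>z. h z - W z)"
      using VB closure_subset[of B] by (intro continuous_on_subset[OF hW]) blast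
    moreover have "open ?V" using U(1) by (intro open_Times) auto
    ultimately have "open (?V \<inter> (\<lambda>z. h z - W z) -` {0<..})"
      by (intro continuous_open_preimage) auto
    moreover have "?V \<inter> (\<lambda>z. h z - W z) -` {0<..} = {z \<in> ?V. h z > W z}" by auto
    ultimately show ?thesis by simp
  qed
  then have "{z \<in> ?V. h z > W z} = {}"
    using ae by (rule open_AE_empty)
  moreover have "z \<in> {z \<in> ?V. h z > W z}"
    using subsetD[OF U(3) zK] \<delta> by (auto simp: W_def t0_def)
  ultimately show False by blast
qed

theorem p_superparabolic_barrier:
  fixes y :: "'a::euclidean_space"
  assumes p: "p > 2" and l: "l = p / (p - 1)" and a: "a > 0" and b: "b = real DIM('a) * (a * l) powr (p - 1)"
  shows "p_superparabolic p \<Theta> (\<lambda>z. ereal (c + (a * norm (fst z - y) powr l + b * snd z)))"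
  unfolding p_superparabolic_def
proof (intro conjI ballI allI impI)
  let ?w = "\<lambda>z. c + (a * norm (fst z - y) powr l + b * snd z)"
  have l1: "l > 1" using p by (simp add: l less_divide_eq)
  have wc: "continuous_on UNIV ?w"
    using l1 by (intro continuous_intros continuous_on_powr') auto
  fix d
  have "continuous_on \<Theta> (\<lambda>z. ereal (?w z))"
    by (intro continuous_on_ereal continuous_on_subset[OF wc]) auto
  then have "openin (top_of_set \<Theta>) (\<Theta> \<inter> (\<lambda>z. ereal (?w z)) -` {d<..})"
    by (rule continuous_openin_preimage_gen) simp
  moreover have "\<Theta> \<inter> (\<lambda>z. ereal (?w z)) -` {d<..} = {z \<in> \<Theta>. d < ereal (?w z)}" by auto
  ultimately show "openin (top_of_set \<Theta>) {z \<in> \<Theta>. d < ereal (?w z)}" by simp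
next
  show "\<Theta> \<subseteq> closure {z \<in> \<Theta>. \<bar>ereal (c + (a * norm (fst z - y) powr l + b * snd z))\<bar> \<noteq> \<infinity>}"
    using closure_subset by auto
next
  fix q r t1 t2 h z
  assume *: "(\<forall>i\<in>Basis. q \<bullet> i < r \<bullet> i) \<and> t1 < t2 \<and> compactly_in (box q r \<times> {t1<..<t2}) \<Theta> \<and>
        p_parabolic p (box q r \<times> {t1<..<t2}) h \<and> continuous_on (closure (box q r \<times> {t1<..<t2})) h \<and>
        (\<forall>z\<in>parabolic_boundary (box q r) t1 t2. ereal (h z) \<le> ereal (c + (a * norm (fst z - y) powr l + b * snd z)))"
    and z: "z \<in> box q r \<times> {t1<..<t2}"
  then show "ereal (h z) \<le> ereal (c + (a * norm (fst z - y) powr l + b * snd z))"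
    using barrier_comparison[OF p l a b open_box bounded_box _ _ _ _ z, of h c y] by auto
qed auto

section \<open>Superparabolic functions lie above the barrier\<close>

text \<open>Vectors of equal norm but distinct have a strictly shorter convex combination, by the
  identity for the squared norm. If the norms differ, the power is strictly convex along them, by
  the strict tangent inequality at their mean \<open>s\<close>.\<close>

lemma norm_powr_strictly_convex:
  fixes u v :: "'a::real_inner"
  assumes l: "l > 1" and m: "0 < m" "m < 1" and "u \<noteq> v"
  shows "norm (m *\<^sub>R u + (1 - m) *\<^sub>R v) powr l < m * norm u powr l + (1 - m) * norm v powr l"
proof (cases "norm u = norm v")
  case True
  have "norm (u - v) > 0" using \<open>u \<noteq> v\<close> by simp
  have "(norm (m *\<^sub>R u + (1 - m) *\<^sub>R v))\<^sup>2 = m * (norm u)\<^sup>2 + (1 - m) * (norm v)\<^sup>2 - m * (1 - m) * (norm (u - v))\<^sup>2"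
    unfolding power2_norm_eq_inner by (simp add: algebra_simps inner_commute)
  also have "\<dots> < (norm u)\<^sup>2"
    using m \<open>norm (u - v) > 0\<close> by (simp add: True[symmetric] algebra_simps)
  finally have "norm (m *\<^sub>R u + (1 - m) *\<^sub>R v) < norm u"
    by (simp add: power_less_imp_less_base)
  then have "norm (m *\<^sub>R u + (1 - m) *\<^sub>R v) powr l < norm u powr l"
    using l by (intro powr_less_mono2) auto
  then show ?thesis by (simp add: True[symmetric] algebra_simps)
next
  case False
  define s where "s = m * norm u + (1 - m) * norm v"
  have s: "s > 0"
  proof -
    have "norm u > 0 \<or> norm v > 0" using False by auto
    then show ?thesis using m unfolding s_def by (auto intro: add_pos_nonneg add_nonneg_pos)
  qed
  have "norm u \<noteq> s" "norm v \<noteq> s"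
  proof -
    have "norm u - s = (1 - m) * (norm u - norm v)" "norm v - s = m * (norm v - norm u)"
      by (simp_all add: s_def algebra_simps)
    then show "norm u \<noteq> s" "norm v \<noteq> s" using False m by auto
  qed
  then have "s powr l + l * s powr (l - 1) * (norm u - s) < norm u powr l"
    "s powr l + l * s powr (l - 1) * (norm v - s) < norm v powr l"
    using powr_above_tangent[OF l s] by auto
  then have "m * (s powr l + l * s powr (l - 1) * (norm u - s)) + (1 - m) * (s powr l + l * s powr (l - 1) * (norm v - s))
      < m * norm u powr l + (1 - m) * norm v powr l"
    using m by (intro add_strict_mono mult_strict_left_mono) auto
  moreover have "m * (s powr l + l * s powr (l - 1) * (norm u - s)) + (1 - m) * (s powr l + l * s powr (l - 1) * (norm v - s))
      = s powr l + l * s powr (l - 1) * (m * norm u + (1 - m) * norm v - s)"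
    by (simp add: algebra_simps)
  ultimately have "s powr l < m * norm u powr l + (1 - m) * norm v powr l"
    by (simp add: s_def)
  moreover have "norm (m *\<^sub>R u + (1 - m) *\<^sub>R v) \<le> s"
    unfolding s_def using m norm_triangle_ineq[of "m *\<^sub>R u" "(1 - m) *\<^sub>R v"] by simp
  then have "norm (m *\<^sub>R u + (1 - m) *\<^sub>R v) powr l \<le> s powr l"
    using l by (intro powr_mono2) auto
  ultimately show ?thesis by linarith
qed

text \<open>A minimizing sequence of \<open>v - k\<close> has a limit point in the closure. At a
  frontier point the boundary inequality would force a nonnegative infimum, while the infimum is
  negative; so the point is interior, and lower semicontinuity makes it a minimizer.\<close>

lemma lsc_attains_min_below_boundary:
  fixes v :: "'a::euclidean_space \<Rightarrow> ereal" and k :: "'a \<Rightarrow> real"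
  assumes \<Theta>: "open \<Theta>" "bounded \<Theta>" and k: "continuous_on UNIV k"
    and lsc: "\<And>c. openin (top_of_set \<Theta>) {z \<in> \<Theta>. c < v z}"
    and bd: "\<And>\<xi>. \<xi> \<in> frontier \<Theta> \<Longrightarrow> ereal (k \<xi>) \<le> Liminf (at \<xi> within \<Theta>) v"
    and neg: "z1 \<in> \<Theta>" "v z1 < ereal (k z1)"
  obtains z0 where "z0 \<in> \<Theta>" "v z0 < ereal (k z0)" "\<And>z. z \<in> \<Theta> \<Longrightarrow> v z0 - ereal (k z0) \<le> v z - ereal (k z)"
proof -
  define u where "u z = v z - ereal (k z)" for z
  have u_less: "u z < ereal d \<longleftrightarrow> v z < ereal (k z + d)" "ereal d < u z \<longleftrightarrow> ereal (k z + d) < v z" for z d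
    by (cases "v z"; auto simp: u_def)+
  define m where "m = Inf (u ` \<Theta>)"
  have "u z1 < 0" using u_less(1)[of z1 0] neg by (simp add: zero_ereal_def)
  then have m0: "m < 0" unfolding m_def using neg(1) by (auto simp: Inf_less_iff)
  obtain s where s: "\<And>n. s n \<in> u ` \<Theta>" "s \<longlonglongrightarrow> m"
    using Inf_as_limit[of "u ` \<Theta>"] neg(1) unfolding m_def by blast
  have "\<forall>n. \<exists>x. x \<in> \<Theta> \<and> u x = s n"
    using s(1) by (simp add: image_iff eq_commute Bex_def)
  then obtain X where "\<forall>n. X n \<in> \<Theta> \<and> u (X n) = s n"
    by (rule choice[THEN exE])
  then have X: "\<And>n. X n \<in> \<Theta>" "\<And>n. u (X n) = s n"
    by auto
  have "compact (closure \<Theta>)" using \<Theta>(2) by (simp add: compact_eq_bounded_closed bounded_closure)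
  then obtain \<xi> r where r: "\<xi> \<in> closure \<Theta>" "strict_mono r" "(X \<circ> r) \<longlonglongrightarrow> \<xi>"
    using X(1) closure_subset[of \<Theta>] unfolding compact_def by (meson subsetD)
  have um: "(\<lambda>n. u (X (r n))) \<longlonglongrightarrow> m"
    using LIMSEQ_subseq_LIMSEQ[OF s(2) r(2)] by (simp add: X(2) o_def)
  have kX: "(\<lambda>n. k (X (r n))) \<longlonglongrightarrow> k \<xi>"
    using continuous_on_tendsto_compose[OF k r(3)] by (simp add: o_def)
  \<comment> \<open>Serves both cases: an eventual lower bound for \<open>v\<close> along the
    sequence, from the boundary limit or from semicontinuity, bounds the infimum from below. The gap
    between \<open>d\<close> and \<open>d'\<close> absorbs the variation of
    \<open>k\<close>.\<close>
  have ge: "ereal d \<le> m" if ev: "eventually (\<lambda>n. ereal (k \<xi> + d') < v (X (r n))) sequentially" and dd: "d < d'" for d d'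
  proof (rule ccontr)
    assume "\<not> ereal d \<le> m"
    then have "eventually (\<lambda>n. u (X (r n)) < ereal d) sequentially"
      using order_tendstoD(2)[OF um] by simp
    moreover have "eventually (\<lambda>n. k (X (r n)) < k \<xi> + (d' - d)) sequentially"
      using order_tendstoD(2)[OF kX] dd by simp
    ultimately have "eventually (\<lambda>n. False) sequentially"
      using ev
    proof eventually_elim
      case (elim n)
      then have "ereal (k \<xi> + d') < ereal (k (X (r n)) + d)"
        using u_less(1)[of "X (r n)" d] by (meson less_trans)
      then show ?case using elim(2) by simp
    qed
    then show False by simp
  qed
  have "\<xi> \<in> \<Theta>"
  proof (rule ccontr)
    assume "\<xi> \<notin> \<Theta>"
    then have fr: "\<xi> \<in> frontier \<Theta>" using r(1) \<Theta>(1) by (simp add: frontier_def interior_open)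
    obtain d where d: "m < ereal d" "ereal d < 0"
      using m0 ereal_dense2[of m 0] by blast
    have "ereal (k \<xi> + d / 2) < ereal (k \<xi>)" using d(2) by (simp add: zero_ereal_def)
    also have "\<dots> \<le> Liminf (at \<xi> within \<Theta>) v" by (rule bd[OF fr])
    finally have "eventually (\<lambda>z. ereal (k \<xi> + d / 2) < v z) (at \<xi> within \<Theta>)"
      by (rule less_LiminfD)
    moreover have "filterlim (\<lambda>n. X (r n)) (at \<xi> within \<Theta>) sequentially"
      using r(3) X(1) \<open>\<xi> \<notin> \<Theta>\<close> unfolding filterlim_at by (auto simp: o_def intro!: always_eventually)
    ultimately have "eventually (\<lambda>n. ereal (k \<xi> + d / 2) < v (X (r n))) sequentially"
      by (rule eventually_compose_filterlim)
    then have "ereal d \<le> m" by (rule ge) (use d(2) in simp)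
    then show False using d(1) by simp
  qed
  have "u \<xi> \<le> m"
  proof (rule ccontr)
    assume "\<not> u \<xi> \<le> m"
    then obtain d' where d': "m < ereal d'" "ereal d' < u \<xi>"
      using ereal_dense2[of m "u \<xi>"] unfolding not_le by blast
    obtain d where d: "m < ereal d" "ereal d < ereal d'"
      using ereal_dense2[OF d'(1)] by blast
    have "openin (top_of_set \<Theta>) {z \<in> \<Theta>. ereal (k \<xi> + d') < v z}" by (rule lsc)
    then have "open {z \<in> \<Theta>. ereal (k \<xi> + d') < v z}"
      using \<Theta>(1) openin_open_eq by blast
    moreover have "\<xi> \<in> {z \<in> \<Theta>. ereal (k \<xi> + d') < v z}"
      using \<open>\<xi> \<in> \<Theta>\<close> d'(2) u_less(2) by simp
    ultimately have "eventually (\<lambda>n. (X \<circ> r) n \<in> {z \<in> \<Theta>. ereal (k \<xi> + d') < v z}) sequentially"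
      by (rule topological_tendstoD[OF r(3)])
    then have "eventually (\<lambda>n. ereal (k \<xi> + d') < v (X (r n))) sequentially"
      by (rule eventually_mono) simp
    then have "ereal d \<le> m" by (rule ge) (use d(2) in simp)
    then show False using d(1) by simp
  qed
  then have min: "u \<xi> \<le> u z" if "z \<in> \<Theta>" for z
    using that unfolding m_def by (meson INF_lower order_trans)
  show ?thesis
  proof (rule that[OF \<open>\<xi> \<in> \<Theta>\<close>])
    have "u \<xi> < ereal 0" using \<open>u \<xi> \<le> m\<close> m0 by (simp add: zero_ereal_def)
    then show "v \<xi> < ereal (k \<xi>)" unfolding u_less(1) by simp
  qed (use min in \<open>simp add: u_def\<close>)
qed

text \<open>The comparison functions of the definition of superparabolicity have to solve the equation exactly.
  Contracting \<open>\<bar>x\<bar>\<^sup>l\<close> towards the touching point by the factor \<open>m\<close> keeps the gradient there,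
  makes the profile steeper and changes the speed \<open>b\<close> to \<open>b / m\<close>; strict convexity leaves room
  between the two profiles on the lateral boundary of a small cylinder.\<close>

theorem superparabolic_ge_barrier:
  fixes v :: "'a::euclidean_space \<times> real \<Rightarrow> ereal"
  assumes p: "p > 2" and l: "l = p / (p - 1)" and a: "a > 0" and b: "b = real DIM('a) * (a * l) powr (p - 1)"
    and \<Theta>: "open \<Theta>" "bounded \<Theta>" and v: "p_superparabolic p \<Theta> v"
    and bd: "\<And>\<xi>. \<xi> \<in> frontier \<Theta> \<Longrightarrow> ereal (c - (a * norm (fst \<xi>) powr l + b * snd \<xi>)) \<le> Liminf (at \<xi> within \<Theta>) v"
    and z: "z \<in> \<Theta>"
  shows "ereal (c - (a * norm (fst z) powr l + b * snd z)) \<le> v z"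
proof (rule ccontr)
  assume contr: "\<not> ereal (c - (a * norm (fst z) powr l + b * snd z)) \<le> v z"
  have l1: "l > 1" using p by (simp add: l less_divide_eq)
  have b0: "b > 0" using a l1 by (simp add: b)
  define h where "h z = c - (a * norm (fst z) powr l + b * snd z)" for z :: "'a \<times> real"
  have hc: "continuous_on UNIV h"
    unfolding h_def using l1 by (intro continuous_intros continuous_on_powr') auto
  have vfin: "v z \<noteq> -\<infinity>" if "z \<in> \<Theta>" for z using v that by (simp add: p_superparabolic_def)
  obtain T where T: "\<And>\<xi>. \<xi> \<in> closure \<Theta> \<Longrightarrow> \<bar>snd \<xi>\<bar> \<le> T" "T > 0"
  proof -
    have "bounded (snd ` closure \<Theta>)" using \<Theta>(2) by (intro bounded_snd bounded_closure)
    then show ?thesis using that by (auto simp: bounded_pos)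
  qed
  obtain r where r: "v z = ereal r" "r < h z"
    using contr vfin[OF z] unfolding h_def[symmetric] by (cases "v z") auto
  \<comment> \<open>The tilt \<open>\<delta> * (t + T)\<close> lies between 0 and
    \<open>2 * T * \<delta>\<close>, half of the violation at \<open>z\<close>. So \<open>k\<close>
    stays below \<open>h\<close> on the frontier and above \<open>v\<close> at \<open>z\<close>,
    while its time derivative \<open>- b - \<delta>\<close> makes it a strict subsolution.\<close>
  define \<delta> where "\<delta> = (h z - r) / (4 * T)"
  have \<delta>: "\<delta> > 0" "2 * T * \<delta> < h z - r" using r(2) T(2) by (auto simp: \<delta>_def)
  define k where "k z = h z - \<delta> * (snd z + T)" for z
  have kc: "continuous_on UNIV k" unfolding k_def by (intro continuous_intros hc)
  have "\<delta> * (snd z + T) \<le> \<delta> * (2 * T)"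
    using T(1)[of z] closure_subset[of \<Theta>] z \<delta>(1) by (intro mult_left_mono) auto
  then have neg: "v z < ereal (k z)" using \<delta>(2) r(1) by (simp add: k_def mult.commute)
  have kbd: "ereal (k \<xi>) \<le> Liminf (at \<xi> within \<Theta>) v" if "\<xi> \<in> frontier \<Theta>" for \<xi>
  proof -
    have "\<delta> * (snd \<xi> + T) \<ge> 0"
      using T(1)[of \<xi>] that \<delta>(1) by (intro mult_nonneg_nonneg) (auto simp: frontier_def)
    then have "ereal (k \<xi>) \<le> ereal (h \<xi>)" by (simp add: k_def)
    also have "\<dots> \<le> Liminf (at \<xi> within \<Theta>) v" unfolding h_def by (rule bd[OF that])
    finally show ?thesis .
  qed
  have lsc: "openin (top_of_set \<Theta>) {z \<in> \<Theta>. c < v z}" for c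
    using v by (simp add: p_superparabolic_def)
  obtain z0 where z0: "z0 \<in> \<Theta>" "v z0 < ereal (k z0)" "\<And>z. z \<in> \<Theta> \<Longrightarrow> v z0 - ereal (k z0) \<le> v z - ereal (k z)"
    using lsc_attains_min_below_boundary[OF \<Theta> kc lsc kbd z neg] by blast
  obtain r0 where r0: "v z0 = ereal r0" using vfin[OF z0(1)] z0(2) by (cases "v z0") auto
  define \<mu> where "\<mu> = r0 - k z0"
  have vge: "ereal (k z + \<mu>) \<le> v z" if "z \<in> \<Theta>" for z
    using z0(3)[OF that] by (cases "v z") (auto simp: r0 \<mu>_def)
  obtain x0 t0 where xt: "z0 = (x0, t0)" by (cases z0)
  \<comment> \<open>Gives the speed \<open>b / m = b + \<delta> / 2\<close>, halfway between the
    barrier and the tilted \<open>k\<close>. Relative to \<open>k\<close> the new solution rises in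
    time at rate \<open>\<delta> / 2\<close>, so it starts lower at the bottom of the
    cylinder.\<close>
  define m where "m = b / (b + \<delta> / 2)"
  have m: "0 < m" "m < 1" "b / m = b + \<delta> / 2"
    using b0 \<delta>(1) by (auto simp: m_def divide_less_eq)
  \<comment> \<open>With \<open>y = (1 - m) *\<^sub>R x0\<close> the new profile is
    \<open>a * m\<close> times the \<open>l\<close>-th power of \<open>norm (x - y) / m\<close>, the
    contraction towards \<open>x0\<close>. The same power of \<open>m\<close> divides
    \<open>(a * l) powr (p - 1)\<close> by \<open>m\<close>, as an exact solution of speed
    \<open>b / m\<close> demands.\<close>
  define a' where "a' = a * m powr (1 - l)"
  have a': "a' > 0" using a m by (simp add: a'_def)
  define y where "y = (1 - m) *\<^sub>R x0"
  have e1: "(1 - l) * (p - 1) = - 1" using p by (simp add: l field_simps)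
  have b': "b + \<delta> / 2 = real DIM('a) * (a' * l) powr (p - 1)"
  proof -
    have "(a' * l) powr (p - 1) = (a * l) powr (p - 1) * (m powr (1 - l)) powr (p - 1)"
      unfolding a'_def using a l1 m by (subst powr_mult[symmetric]) (auto simp: mult_ac)
    also have "(m powr (1 - l)) powr (p - 1) = 1 / m"
      using m by (simp add: powr_powr e1 powr_minus_divide)
    finally show ?thesis using m(3) by (simp add: b)
  qed
  define P where "P x = a' * norm (x - y) powr l - a * norm x powr l" for x
  have Pc: "continuous_on S P" for S
    unfolding P_def using l1 by (intro continuous_intros continuous_on_powr') auto
  \<comment> \<open>\<open>x\<close> is the convex combination, with weight \<open>m\<close>, of
    \<open>u = (x - y) / m\<close> and \<open>x0\<close>. Strict convexity puts the contracted
    profile, once the values at \<open>x0\<close> are matched, strictly above the original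
    one.\<close>
  have Pmin: "P x0 < P x" if "x \<noteq> x0" for x
  proof -
    define u where "u = (1 / m) *\<^sub>R (x - y)"
    have sc: "a' * norm (x - y) powr l = a * (m * norm ((1 / m) *\<^sub>R (x - y)) powr l)" for x
    proof -
      have "m powr (1 - l) * norm (x - y) powr l = m * (norm (x - y) / m) powr l"
        using m by (simp add: powr_divide powr_diff)
      then show ?thesis using m by (simp add: a'_def)
    qed
    have u0: "(1 / m) *\<^sub>R (x0 - y) = x0" using m(1) by (simp add: y_def algebra_simps)
    have xu: "x = m *\<^sub>R u + (1 - m) *\<^sub>R x0" using m(1) by (simp add: u_def y_def)
    have "u \<noteq> x0" using that xu by (metis add_diff_cancel_left' diff_add_cancel scaleR_collapse)
    from norm_powr_strictly_convex[OF l1 m(1,2) this]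
    have "norm x powr l < m * norm u powr l + (1 - m) * norm x0 powr l" by (simp add: xu[symmetric])
    then have "a * norm x powr l < a * (m * norm u powr l + (1 - m) * norm x0 powr l)"
      using a by simp
    then show ?thesis
      unfolding P_def sc u0 u_def[symmetric] by (simp add: algebra_simps)
  qed
  obtain e where e: "e > 0" "ball z0 e \<subseteq> \<Theta>"
    using \<Theta>(1) z0(1) by (auto simp: open_contains_ball)
  \<comment> \<open>Spatial radius \<open>e / 2\<close> and time radius \<open>e / 3\<close>
    together stay below \<open>e\<close>.\<close>
  obtain q r where qr: "cbox q r \<subseteq> ball x0 (e / 2)" "x0 \<in> box q r" "\<forall>i\<in>Basis. q \<bullet> i < r \<bullet> i"
    using open_contains_cbox[of "ball x0 (e / 2)" x0] e(1) by auto
  have box_ne: "box q r \<noteq> {}" using qr(2) by blast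
  obtain \<eta> where \<eta>: "\<eta> > 0" "\<And>x. x \<in> frontier (box q r) \<Longrightarrow> P x \<ge> P x0 + \<eta>"
  proof (cases "frontier (box q r) = {}")
    case True
    then show ?thesis using that[of 1] by simp
  next
    case False
    have "compact (frontier (box q r))" by (simp add: compact_frontier_bounded)
    then obtain x1 where x1: "x1 \<in> frontier (box q r)" "\<And>x. x \<in> frontier (box q r) \<Longrightarrow> P x1 \<le> P x"
      using continuous_attains_inf[OF _ False Pc] by blast
    have "x1 \<noteq> x0" using x1(1) qr(2) by (auto simp: frontier_box split: if_splits)
    then show ?thesis using Pmin x1(2) by (intro that[of "P x1 - P x0"]) auto
  qed
  define t1 where "t1 = t0 - e / 3"
  \<comment> \<open>The bound \<open>\<eta> / \<delta>\<close> keeps the relative rise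
    \<open>\<delta> / 2 * (t2 - t0)\<close> at most half of the lateral gap
    \<open>\<eta>\<close>.\<close>
  define t2 where "t2 = t0 + min (e / 3) (\<eta> / \<delta>)"
  have tt: "t1 < t0" "t0 < t2" "t2 \<le> t0 + e / 3" "\<delta> / 2 * (t2 - t0) \<le> \<eta> / 2"
  proof -
    have "\<delta> / 2 * (t2 - t0) \<le> \<delta> / 2 * (\<eta> / \<delta>)"
      using \<delta>(1) by (intro mult_left_mono) (auto simp: t2_def)
    then show "\<delta> / 2 * (t2 - t0) \<le> \<eta> / 2" using \<delta>(1) by simp
    show "t2 \<le> t0 + e / 3" unfolding t2_def by (intro add_left_mono min.cobounded1)
  qed (use e(1) \<eta>(1) \<delta>(1) in \<open>auto simp: t1_def t2_def\<close>)
  have sub: "cbox q r \<times> {t1..t2} \<subseteq> \<Theta>"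
  proof
    fix w assume w: "w \<in> cbox q r \<times> {t1..t2}"
    then have "t0 - e / 3 \<le> snd w" "snd w \<le> t0 + e / 3"
      using tt by (auto simp: t1_def)
    then have "dist t0 (snd w) \<le> e / 3"
      unfolding dist_real_def by linarith
    moreover have "dist x0 (fst w) < e / 2"
      using w qr(1) by auto
    ultimately have "dist z0 w < e"
      using sqrt_sum_squares_le_sum_abs[of "dist x0 (fst w)" "dist t0 (snd w)"] e(1)
      by (simp add: xt dist_prod_def)
    then show "w \<in> \<Theta>" using e(2) by auto
  qed
  have clo: "closure (box q r \<times> {t1<..<t2}) = cbox q r \<times> {t1..t2}"
    using tt box_ne by (simp add: closure_Times)
  have pb: "parabolic_boundary (box q r) t1 t2 \<subseteq> cbox q r \<times> {t1..t2}"
    using tt box_ne by (auto simp: parabolic_boundary_def frontier_box)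
  \<comment> \<open>The lift that both parts of the parabolic boundary can afford:
    \<open>\<eta> / 2\<close> is left on the sides after the rise in time, and
    \<open>\<delta> / 2 * (e / 3)\<close> is available at the bottom. At \<open>z0\<close> the
    lifted solution exceeds \<open>v\<close> by \<open>\<epsilon>\<close>, the
    contradiction.\<close>
  define \<epsilon> where "\<epsilon> = min (\<eta> / 2) (\<delta> / 2 * (e / 3))"
  have \<epsilon>: "\<epsilon> > 0" using \<eta>(1) \<delta>(1) e(1) by (simp add: \<epsilon>_def)
  define C where "C = k z0 + \<mu> + (a' * norm (x0 - y) powr l + (b + \<delta> / 2) * t0) + \<epsilon>"
  define g where "g z = C - (a' * norm (fst z - y) powr l + (b + \<delta> / 2) * snd z)" for z
  have g_eq: "g z = k z + \<mu> + \<epsilon> - (P (fst z) - P x0) + \<delta> / 2 * (snd z - t0)" for z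
    by (simp add: g_def C_def k_def h_def P_def xt field_simps)
  have g_par: "p_parabolic p S g" for S
    unfolding g_def[abs_def] by (rule p_parabolic_barrier[OF p l a' b'])
  have gc: "continuous_on S g" for S
    using g_par[of S] by (simp add: p_parabolic_def)
  have g_le: "ereal (g w) \<le> v w" if w: "w \<in> parabolic_boundary (box q r) t1 t2" for w
  proof -
    have "g w \<le> k w + \<mu>"
    proof (cases "snd w = t1")
      case True
      have "P (fst w) \<ge> P x0" using Pmin[of "fst w"] by (cases "fst w = x0") auto
      moreover have "\<delta> / 2 * (snd w - t0) = - (\<delta> / 2 * (e / 3))" using True by (simp add: t1_def)
      moreover have "\<epsilon> \<le> \<delta> / 2 * (e / 3)" by (simp add: \<epsilon>_def)
      ultimately show ?thesis unfolding g_eq by linarith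
    next
      case False
      then have f: "fst w \<in> frontier (box q r)" "snd w \<le> t2"
        using w by (auto simp: parabolic_boundary_def)
      have "\<delta> / 2 * (snd w - t0) \<le> \<delta> / 2 * (t2 - t0)"
        using \<delta>(1) f(2) by (intro mult_left_mono) auto
      moreover have "\<epsilon> \<le> \<eta> / 2" by (simp add: \<epsilon>_def)
      ultimately show ?thesis unfolding g_eq using \<eta>(2)[OF f(1)] tt(4) by linarith
    qed
    then have "ereal (g w) \<le> ereal (k w + \<mu>)" by simp
    also have "\<dots> \<le> v w" using w pb sub by (intro vge) auto
    finally show ?thesis .
  qed
  have "\<forall>z\<in>box q r \<times> {t1<..<t2}. ereal (g z) \<le> v z"
  proof -
    have "compactly_in (box q r \<times> {t1<..<t2}) \<Theta>"
      unfolding compactly_in_def clo using sub by (auto intro: compact_Times)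
    moreover have "t1 < t2" using tt by linarith
    ultimately show ?thesis
      using v qr(3) g_par gc g_le unfolding p_superparabolic_def by blast
  qed
  then have "ereal (g z0) \<le> v z0" using qr(2) tt by (simp add: xt)
  then have "g z0 \<le> r0" by (simp add: r0)
  moreover have "g z0 = r0 + \<epsilon>" unfolding g_eq by (simp add: xt \<mu>_def)
  ultimately show False using \<epsilon> by simp
qed

section \<open>The boundary point\<close>

lemma Theta_dom_open_bounded:
  assumes "\<theta> > 0" "l > 1"
  shows "open (Theta_dom l \<theta>)" "bounded (Theta_dom l \<theta>)"
proof -
  have eq: "Theta_dom l \<theta> = {z. 0 < - snd z} \<inter> {z. - snd z < \<theta> * norm (fst z) powr l}
      \<inter> {z. \<theta> * norm (fst z) powr l < \<theta>}"
    by (auto simp: Theta_dom_def)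
  have c: "continuous_on UNIV (\<lambda>z :: (real ^ 'n) \<times> real. norm (fst z) powr l)"
    using assms(2) by (intro continuous_on_powr' continuous_intros) auto
  show "open (Theta_dom l \<theta>)"
    unfolding eq
    by (intro open_Int open_Collect_less continuous_on_mult c continuous_on_minus continuous_on_snd
        continuous_on_const continuous_on_id)
  have "Theta_dom l \<theta> \<subseteq> ball 0 1 \<times> {- \<theta>..0}"
  proof clarify
    fix x :: "real ^ 'n" and t assume xt: "(x, t) \<in> Theta_dom l \<theta>"
    then have "norm x powr l < 1" using assms(1) by (auto simp: Theta_dom_def)
    then have "norm x < 1"
      using assms(2) ge_one_powr_ge_zero[of "norm x" l] by linarith
    then show "x \<in> ball 0 1 \<and> t \<in> {- \<theta>..0}"
      using xt by (auto simp: Theta_dom_def)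
  qed
  then show "bounded (Theta_dom l \<theta>)"
    by (rule bounded_subset[rotated]) (intro bounded_Times bounded_ball bounded_closed_interval)
qed

lemma Theta_dom_frontier:
  assumes "l > 1" "(x, t) \<in> frontier (Theta_dom l \<theta>)"
  shows "- t \<le> \<theta> * norm x powr l"
proof -
  have c: "continuous_on UNIV (\<lambda>z :: (real ^ 'n) \<times> real. norm (fst z) powr l)"
    using assms(1) by (intro continuous_on_powr' continuous_intros) auto
  have "closed {z :: (real ^ 'n) \<times> real. - snd z \<le> \<theta> * norm (fst z) powr l}"
    by (intro closed_Collect_le continuous_on_mult c continuous_on_minus continuous_on_snd
        continuous_on_const continuous_on_id)
  then have "closure (Theta_dom l \<theta>) \<subseteq> {z. - snd z \<le> \<theta> * norm (fst z) powr l}"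
    by (rule closure_minimal[rotated]) (auto simp: Theta_dom_def)
  then show ?thesis
    using assms(2) by (auto simp: frontier_def)
qed

lemma lower_class_iff: "u \<in> lower_class p \<Theta> f \<longleftrightarrow> (\<lambda>z. - u z) \<in> upper_class p \<Theta> (\<lambda>\<xi>. - f \<xi>)"
  unfolding lower_class_def upper_class_def p_subparabolic_def
  by (simp add: ereal_Liminf_uminus flip: uminus_ereal.simps(1))

definition bar :: "real \<Rightarrow> real \<Rightarrow> real \<Rightarrow> 'a::real_normed_vector \<times> real \<Rightarrow> real" where
  "bar l a b z = a * norm (fst z) powr l + b * snd z"

text \<open>Origin of \<open>a\<close>: in terms of \<open>s = a * l\<close>, the quantity
  \<open>a - b * \<theta>\<close> is \<open>(p - 1) / p * s - n * \<theta> * s powr (p - 1)\<close>,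
  which is stationary when \<open>n * p * \<theta> * s powr (p - 2) = 1\<close>. There
  \<open>b * \<theta> = s / p\<close>, which leaves \<open>(p - 2) / p * s\<close>.\<close>

lemma barrier_constants:
  fixes n p \<theta> l :: real
  assumes p: "p > 2" and \<theta>: "\<theta> > 0" and l: "l = p / (p - 1)" and n: "n > 0"
  defines "s \<equiv> (1 / (n * p * \<theta>)) powr (1 / (p - 2))"
  defines "a \<equiv> (p - 1) / p * s"
  defines "b \<equiv> n * (a * l) powr (p - 1)"
  shows "a > 0" "b > 0" "a - b * \<theta> = (p - 2) / p * s"
proof -
  have s: "s > 0" using p \<theta> n by (simp add: s_def)
  show a: "a > 0" using p s by (simp add: a_def)
  have al: "a * l = s" using p by (simp add: a_def l)
  then show "b > 0" using n s by (simp add: b_def)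
  have "s powr (p - 2) = 1 / (n * p * \<theta>)"
    unfolding s_def powr_powr using p \<theta> n by simp
  then have "b = n * (s * (1 / (n * p * \<theta>)))"
    using s powr_mult_base[of s "p - 2"] by (simp add: b_def al)
  then have "b * \<theta> = s / p" using p \<theta> n by (simp add: field_simps)
  then show "a - b * \<theta> = (p - 2) / p * s"
    using p by (simp add: a_def field_simps)
qed

text \<open>The time term costs at most \<open>b * \<theta> * norm x powr l\<close>, because
  \<open>- t \<le> \<theta> * norm x powr l\<close> passes to the frontier.\<close>

lemma bar_ge:
  assumes "l > 1" "b \<ge> 0" "(x, t) \<in> frontier (Theta_dom l \<theta>)"
  shows "(a - b * \<theta>) * norm x powr l \<le> bar l a b (x, t)"
  using mult_left_mono[OF Theta_dom_frontier[OF assms(1,3)] assms(2)] by (simp add: bar_def algebra_simps)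

lemma bar_continuous: "l > 1 \<Longrightarrow> continuous_on UNIV (bar l a b :: 'a::real_normed_vector \<times> real \<Rightarrow> real)"
  unfolding bar_def by (intro continuous_intros continuous_on_powr') auto

context
  fixes p \<theta> l a b :: real
  assumes p: "p > 2" and \<theta>: "\<theta> > 0" and l: "l = p / (p - 1)" and a: "a > 0"
    and b: "b = real DIM(real ^ 'n) * (a * l) powr (p - 1)"
begin

lemma upper_barrier_in_upper_class:
  fixes f :: "(real ^ 'n) \<times> real \<Rightarrow> real"
  assumes f: "\<And>\<xi>. \<xi> \<in> frontier (Theta_dom l \<theta>) \<Longrightarrow> f \<xi> \<le> c + bar l a b \<xi>"
  shows "(\<lambda>z. ereal (c + bar l a b z)) \<in> upper_class p (Theta_dom l \<theta>) f"
  unfolding upper_class_def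
proof (intro CollectI conjI ballI)
  show "p_superparabolic p (Theta_dom l \<theta>) (\<lambda>z :: (real ^ 'n) \<times> real. ereal (c + bar l a b z))"
    using p_superparabolic_barrier[OF p l a b, of "Theta_dom l \<theta>" c 0] by (simp add: bar_def)
  fix \<xi> :: "(real ^ 'n) \<times> real" assume \<xi>: "\<xi> \<in> frontier (Theta_dom l \<theta>)"
  have l1: "l > 1" using p by (simp add: l less_divide_eq)
  have "(bar l a b \<longlongrightarrow> bar l a b \<xi>) (at \<xi> within Theta_dom l \<theta>)"
    using continuous_on_subset[OF bar_continuous[OF l1], of UNIV]
    by (metis UNIV_I continuous_on_def subset_UNIV tendsto_within_subset)
  then have "((\<lambda>z. ereal (c + bar l a b z)) \<longlongrightarrow> ereal (c + bar l a b \<xi>)) (at \<xi> within Theta_dom l \<theta>)"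
    by (intro tendsto_ereal tendsto_add tendsto_const)
  then have "ereal (c + bar l a b \<xi>) \<le> Liminf (at \<xi> within Theta_dom l \<theta>) (\<lambda>z. ereal (c + bar l a b z))"
    unfolding le_Liminf_iff by (auto intro: order_tendstoD(1))
  moreover have "ereal (f \<xi>) \<le> ereal (c + bar l a b \<xi>)" using f[OF \<xi>] by simp
  ultimately show "ereal (f \<xi>) \<le> Liminf (at \<xi> within Theta_dom l \<theta>) (\<lambda>z. ereal (c + bar l a b z))"
    by (rule order_trans[rotated])
qed

lemma upper_class_ge_lower_barrier:
  fixes f :: "(real ^ 'n) \<times> real \<Rightarrow> real"
  assumes f: "\<And>\<xi>. \<xi> \<in> frontier (Theta_dom l \<theta>) \<Longrightarrow> c - bar l a b \<xi> \<le> f \<xi>"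
    and v: "v \<in> upper_class p (Theta_dom l \<theta>) f" and z: "z \<in> Theta_dom l \<theta>"
  shows "ereal (c - bar l a b z) \<le> v z"
proof -
  have l1: "l > 1" using p by (simp add: l less_divide_eq)
  have "ereal (c - (a * norm (fst \<xi>) powr l + b * snd \<xi>)) \<le> Liminf (at \<xi> within Theta_dom l \<theta>) v"
    if \<xi>: "\<xi> \<in> frontier (Theta_dom l \<theta>)" for \<xi>
  proof -
    have "ereal (c - (a * norm (fst \<xi>) powr l + b * snd \<xi>)) \<le> ereal (f \<xi>)"
      using f[OF \<xi>] by (simp add: bar_def)
    also have "\<dots> \<le> Liminf (at \<xi> within Theta_dom l \<theta>) v"
      using v \<xi> by (simp add: upper_class_def)
    finally show ?thesis .
  qed
  then show ?thesis
    using superparabolic_ge_barrier[OF p l a b Theta_dom_open_bounded[OF \<theta> l1] _ _ z, of v c] v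
    by (simp add: upper_class_def bar_def)
qed

end

theorem corollary1p7:
  fixes p \<theta> l :: real
    and f :: "(real ^ 'n) \<times> real \<Rightarrow> real"
  assumes "p > 2"
    and "\<theta> > 0"
    and "l = p / (p - 1)"
    and "\<And>x t. (x, t) \<in> frontier (Theta_dom l \<theta>) \<Longrightarrow>
           \<bar>f (x, t) - f (0, 0)\<bar> \<le> M_const CARD('n) p \<theta> * norm x powr (p / (p - 1))"
  shows "(lower_perron p (Theta_dom l \<theta>) f \<longlongrightarrow> ereal (f (0, 0)))
           (at (0, 0) within Theta_dom l \<theta>) \<and>
         (upper_perron p (Theta_dom l \<theta>) f \<longlongrightarrow> ereal (f (0, 0)))
           (at (0, 0) within Theta_dom l \<theta>)"
proof -
  let ?\<Theta> = "Theta_dom l \<theta> :: ((real ^ 'n) \<times> real) set"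
  let ?c = "f (0, 0)"
  define n where "n = real CARD('n)"
  define a where "a = (p - 1) / p * (1 / (n * p * \<theta>)) powr (1 / (p - 2))"
  define b where "b = n * (a * l) powr (p - 1)"
  have l1: "l > 1" using assms(1) by (simp add: assms(3) less_divide_eq)
  have n: "n > 0" by (simp add: n_def)
  have a: "a > 0" and b0: "b > 0" and M: "a - b * \<theta> = M_const CARD('n) p \<theta>"
    using barrier_constants[OF assms(1,2,3) n] unfolding a_def b_def M_const_def n_def by auto
  have b: "b = real DIM(real ^ 'n) * (a * l) powr (p - 1)"
    by (simp add: b_def n_def)
  have bound: "\<bar>f \<xi> - ?c\<bar> \<le> bar l a b \<xi>" if \<xi>: "\<xi> \<in> frontier ?\<Theta>" for \<xi>
  proof (cases \<xi>)
    case (Pair x t)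
    then show ?thesis
      using assms(4)[of x t] bar_ge[OF l1 less_imp_le[OF b0], of x t \<theta> a] \<xi> M by (simp add: assms(3))
  qed
  note U = upper_barrier_in_upper_class[OF assms(1,2,3) a b] upper_class_ge_lower_barrier[OF assms(1,2,3) a b]
  have up: "ereal (?c - bar l a b z) \<le> upper_perron p ?\<Theta> f z" "upper_perron p ?\<Theta> f z \<le> ereal (?c + bar l a b z)"
    and lo: "ereal (?c - bar l a b z) \<le> lower_perron p ?\<Theta> f z" "lower_perron p ?\<Theta> f z \<le> ereal (?c + bar l a b z)"
    if z: "z \<in> ?\<Theta>" for z
  proof -
    \<comment> \<open>The last two inequalities are the first two for \<open>- f\<close> and
      \<open>- ?c\<close>; through them the results on the upper class also serve the lower
      class.\<close>
    have f: "f \<xi> \<le> ?c + bar l a b \<xi>" "?c - bar l a b \<xi> \<le> f \<xi>"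
      "- f \<xi> \<le> - ?c + bar l a b \<xi>" "- ?c - bar l a b \<xi> \<le> - f \<xi>" if "\<xi> \<in> frontier ?\<Theta>" for \<xi>
      using bound[OF that] by linarith+
    show "ereal (?c - bar l a b z) \<le> upper_perron p ?\<Theta> f z"
      unfolding upper_perron_def by (intro INF_greatest U(2)[OF f(2) _ z])
    show "upper_perron p ?\<Theta> f z \<le> ereal (?c + bar l a b z)"
      unfolding upper_perron_def by (rule INF_lower[OF U(1)[OF f(1)]])
    show "ereal (?c - bar l a b z) \<le> lower_perron p ?\<Theta> f z"
    proof -
      have "(\<lambda>z. - ereal (?c - bar l a b z)) \<in> upper_class p ?\<Theta> (\<lambda>\<xi>. - f \<xi>)"
        using U(1)[OF f(3)] by simp
      then have "(\<lambda>z. ereal (?c - bar l a b z)) \<in> lower_class p ?\<Theta> f"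
        by (simp add: lower_class_iff)
      then show ?thesis
        unfolding lower_perron_def by (rule SUP_upper)
    qed
    show "lower_perron p ?\<Theta> f z \<le> ereal (?c + bar l a b z)"
      unfolding lower_perron_def
    proof (rule SUP_least)
      fix u assume "u \<in> lower_class p ?\<Theta> f"
      then have "ereal (- ?c - bar l a b z) \<le> - u z"
        using U(2)[OF f(4) _ z] by (simp add: lower_class_iff)
      then show "u z \<le> ereal (?c + bar l a b z)"
        by (cases "u z") auto
    qed
  qed
  \<comment> \<open>\<open>bar\<close> is continuous and vanishes at the origin, so the lower and
    upper bounds of both Perron solutions have the common limit \<open>?c\<close>.\<close>
  have "(bar l a b \<longlongrightarrow> bar l a b (0 :: real ^ 'n, 0)) (at (0, 0) within ?\<Theta>)"
    using bar_continuous[OF l1, of a b] by (metis UNIV_I continuous_on_def subset_UNIV tendsto_within_subset)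
  then have bar0: "(bar l a b \<longlongrightarrow> 0) (at (0 :: real ^ 'n, 0) within ?\<Theta>)"
    by (simp add: bar_def)
  have lim: "((\<lambda>z. ereal (?c - bar l a b z)) \<longlongrightarrow> ereal ?c) (at (0, 0) within ?\<Theta>)"
    "((\<lambda>z. ereal (?c + bar l a b z)) \<longlongrightarrow> ereal ?c) (at (0, 0) within ?\<Theta>)"
    using tendsto_diff[OF tendsto_const bar0, of ?c] tendsto_add[OF tendsto_const bar0, of ?c] by auto
  show ?thesis
    using up lo by (intro conjI; intro tendsto_sandwich[OF _ _ lim]) (auto simp: eventually_at_filter)
qed

end
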